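(* Let $K$ be a field of characteristic $0$, let $n\ge1$ and $0\le m\le n-1$ be integers, and let $r_0\le r_1\le\dots\le r_n$ be positive integers. In $K[x_0,\dots,x_n]$ put $$\widetilde{h_i}=x_0^{r_0}\cdots\widehat{x_i^{r_i}}\cdots x_n^{r_n}\ (0\le i\le n),\qquad \widetilde{f_1}=\sum_{i=m+1}^n\widetilde{h_i},\qquad \widetilde{f_2}=\sum_{i=0}^m\widetilde{h_i}$$ (so that $\deg\widetilde{f_2}\ge\deg\widetilde{f_1}$), and let $(\cdot)^h$ denote homogenization with respect to the variable $x_{n+1}$ in $K[x_0,\dots,x_{n+1}]$. (i) The divisor in $\mathbb{P}^{n+1}$ defined by the homogeneous polynomial $$x_{n+1}\big((\widetilde{f_1}\widetilde{f_2})^{\mathrm{red}}\big)^h=x_0\cdots x_{n+1}\left(\sum_{i=0}^m x_{n+1}^{r_i-r_0}x_0^{r_0}\cdots\widehat{x_i^{r_i}}\cdots x_m^{r_m}\right)\left(\sum_{i=m+1}^n x_{n+1}^{r_i-r_{m+1}}x_{m+1}^{r_{m+1}}\cdots\widehat{x_i^{r_i}}\cdots x_n^{r_n}\right)$$ is free with exponents $(1,1,r_1+1,r_2+1,\dots,\widehat{r_{m+1}+1},\dots,r_n+1)$. (ii) Let $k\ge3$ and let $[a_i;b_i]\in\mathbb{P}^1$, $3\le i\le k$, be such that the hypersurfaces $V\big((a_i\widetilde{f_1}+b_i\widetilde{f_2})^h\big)\subset\mathbb{P}^{n+1}$ are generic members of the pencil $C\big(x_{n+1}^{\deg\widetilde{f_2}-\deg\widetilde{f_1}}\cdot\widetilde{f_1}^h,\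 \widetilde{f_2}^h\big)$. Then the divisor in $\mathbb{P}^{n+1}$ defined by the homogeneous polynomial $$x_{n+1}\big((\widetilde{f_1}\widetilde{f_2})^{\mathrm{red}}\big)^h\prod_{i=3}^k\big(a_i\widetilde{f_1}+b_i\widetilde{f_2}\big)^h$$ is free with exponents $$\Big(1,r_1+1,r_2+1,\dots,\widehat{r_{m+1}+1},\dots,r_n+1,\ (k-2)\sum_{i=1}^n r_i+1\Big).$$
   Context: A hat means the factor (or entry) is omitted; empty products equal $1$. For a polynomial $f$, $f^{\mathrm{red}}$ is the product of its distinct irreducible factors. For homogeneous $g_1,g_2$ of the same degree, the pencil $C(g_1,g_2)$ is the family of hypersurfaces $V(ag_1+bg_2)$, $[a;b]\in\mathbb{P}^1$. "Generic members" means that the statement holds for $([a_3;b_3],\dots,[a_k;b_k])$ in some non-empty Zariski-open subset of $(\mathbb{P}^1)^{k-2}$ (in particular the members are pairwise distinct with all $a_i,b_i$ non-zero). For a reduced homogeneous $f\in S=K[x_0,\dots,x_{n+1}]$ (standard grading), $\mathrm{Der}_0(f)=\{\delta\in\mathrm{Der}_K(S):\delta(f)=0\}$; a derivation is homogeneous of degree $a$ if all its coefficients on the $\partial_{x_i}$ are homogeneous of degree $a$ (or zero). $V(f)\subset\mathbb{P}^{n+1}$ is free with exponents $(a_1,\dots,a_{n+1})$ if $\mathrm{Der}_0(f)$ is a free $S$-module with a basis of $n+1$ homogeneous derivations of degrees $a_1,\dots,a_{n+1}$ (in any order). *)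

theory Defs
  imports
    "HOL-Library.Poly_Mapping"
    "HOL-Library.FuncSet"
    "HOL-Computational_Algebra.Squarefree"
begin

text \<open>
  Polynomials in variables of type \<open>'v\<close> are finitely supported maps from monomials
  (exponent vectors) to coefficients; the ring structure is the convolution ring of
  \<^theory>\<open>HOL-Library.Poly_Mapping\<close>.
\<close>

type_synonym ('v, 'a) mpoly = "('v \<Rightarrow>\<^sub>0 nat) \<Rightarrow>\<^sub>0 'a"

definition Const :: "'a \<Rightarrow> ('v, 'a::zero) mpoly" where
  "Const c = Poly_Mapping.single 0 c"

definition X :: "'v \<Rightarrow> ('v, 'a::zero_neq_one) mpoly" where
  "X v = Poly_Mapping.single (Poly_Mapping.single v 1) 1"

text \<open>
  \<open>polys V\<close> is the polynomial ring \<open>K[x\<^sub>v : v \<in> V]\<close>, as a subring of the ring of polynomials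
  in all variables. For nonzero \<open>f \<in> polys V\<close> over a field, all divisors of \<open>f\<close> in the big ring
  lie in \<open>polys V\<close>, and the units of both rings are the nonzero constants. So
  \<^const>\<open>irreducible\<close>, \<^const>\<open>squarefree\<close> and divisibility have the same meaning in both.
\<close>

definition polys :: "'v set \<Rightarrow> ('v, 'a::zero) mpoly set" where
  "polys V = {p. \<forall>m \<in> Poly_Mapping.keys p. Poly_Mapping.keys m \<subseteq> V}"

definition mon_deg :: "('v \<Rightarrow>\<^sub>0 nat) \<Rightarrow> nat" where
  "mon_deg m = (\<Sum>v \<in> Poly_Mapping.keys m. Poly_Mapping.lookup m v)"

text \<open>The zero polynomial is given total degree \<open>0\<close>.\<close>

definition total_deg :: "('v, 'a::zero) mpoly \<Rightarrow> nat" where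
  "total_deg p = Max (insert 0 (mon_deg ` Poly_Mapping.keys p))"

text \<open>The zero polynomial is homogeneous of every degree.\<close>

definition homogeneous :: "nat \<Rightarrow> ('v, 'a::zero) mpoly \<Rightarrow> bool" where
  "homogeneous d p \<longleftrightarrow> (\<forall>m \<in> Poly_Mapping.keys p. mon_deg m = d)"

text \<open>
  Homogenization of \<open>p\<close> with respect to the variable \<open>z\<close>, to the total degree of \<open>p\<close>.
  It is meant for \<open>p\<close> in which \<open>z\<close> does not occur.
\<close>

definition homogenize :: "'v \<Rightarrow> ('v, 'a::comm_monoid_add) mpoly \<Rightarrow> ('v, 'a) mpoly" where
  "homogenize z p =
     (\<Sum>m \<in> Poly_Mapping.keys p.
        Poly_Mapping.single (m + Poly_Mapping.single z (total_deg p - mon_deg m))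
          (Poly_Mapping.lookup p m))"

definition eval_poly :: "('v \<Rightarrow> 'a) \<Rightarrow> ('v, 'a::comm_semiring_1) mpoly \<Rightarrow> 'a" where
  "eval_poly x p =
     (\<Sum>m \<in> Poly_Mapping.keys p.
        Poly_Mapping.lookup p m * (\<Prod>v \<in> Poly_Mapping.keys m. x v ^ Poly_Mapping.lookup m v))"

text \<open>
  \<open>is_red f g\<close>: \<open>g\<close> is a product of the distinct irreducible factors of \<open>f\<close>. These factors
  are only determined up to units, so this is a relation: \<open>P\<close> contains exactly one
  representative from each class of associated irreducible factors.
\<close>

definition is_red :: "'r::comm_semiring_1 \<Rightarrow> 'r \<Rightarrow> bool" where
  "is_red f g \<longleftrightarrow>
     (\<exists>P. finite P \<and> (\<forall>p \<in> P. irreducible p \<and> p dvd f) \<and>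
          (\<forall>q. irreducible q \<and> q dvd f \<longrightarrow> (\<exists>!p. p \<in> P \<and> p dvd q \<and> q dvd p)) \<and>
          g = \<Prod>P)"

text \<open>
  The \<open>K\<close>-derivations of \<open>S = polys V\<close>, as extensional functions on \<open>S\<close>. The coefficient of
  \<open>\<delta>\<close> on the partial derivative with respect to \<open>x\<^sub>v\<close> is \<open>\<delta> (X v)\<close>.
\<close>

definition Der :: "'v set \<Rightarrow> (('v, 'a::comm_ring_1) mpoly \<Rightarrow> ('v, 'a) mpoly) set" where
  "Der V = {\<delta> \<in> polys V \<rightarrow>\<^sub>E polys V.
     (\<forall>p \<in> polys V. \<forall>q \<in> polys V. \<delta> (p + q) = \<delta> p + \<delta> q) \<and>
     (\<forall>c. \<forall>p \<in> polys V. \<delta> (Const c * p) = Const c * \<delta> p) \<and>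
     (\<forall>p \<in> polys V. \<forall>q \<in> polys V. \<delta> (p * q) = p * \<delta> q + q * \<delta> p)}"

definition Der0 ::
  "'v set \<Rightarrow> ('v, 'a::comm_ring_1) mpoly \<Rightarrow> (('v, 'a) mpoly \<Rightarrow> ('v, 'a) mpoly) set" where
  "Der0 V f = {\<delta> \<in> Der V. \<delta> f = 0}"

definition der_homogeneous ::
  "'v set \<Rightarrow> nat \<Rightarrow> (('v, 'a::comm_ring_1) mpoly \<Rightarrow> ('v, 'a) mpoly) \<Rightarrow> bool" where
  "der_homogeneous V d \<delta> \<longleftrightarrow> (\<forall>v \<in> V. homogeneous d (\<delta> (X v)))"

text \<open>
  \<open>D 0, \<dots>, D (N - 1)\<close> is a basis of the \<open>polys V\<close>-module \<open>M\<close> of maps on \<open>polys V\<close>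
  (operations are pointwise).
\<close>

definition is_basis ::
  "'v set \<Rightarrow> (('v, 'a::comm_ring_1) mpoly \<Rightarrow> ('v, 'a) mpoly) set \<Rightarrow> nat
     \<Rightarrow> (nat \<Rightarrow> ('v, 'a) mpoly \<Rightarrow> ('v, 'a) mpoly) \<Rightarrow> bool" where
  "is_basis V M N D \<longleftrightarrow>
     (\<forall>j < N. D j \<in> M) \<and>
     (\<forall>\<delta> \<in> M. \<exists>c. (\<forall>j < N. c j \<in> polys V) \<and>
        (\<forall>g \<in> polys V. \<delta> g = (\<Sum>j < N. c j * D j g))) \<and>
     (\<forall>c. (\<forall>j < N. c j \<in> polys V) \<and> (\<forall>g \<in> polys V. (\<Sum>j < N. c j * D j g) = 0)
        \<longrightarrow> (\<forall>j < N. c j = 0))"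

text \<open>
  \<open>free_divisor n f es\<close>: \<open>f\<close> is a reduced homogeneous polynomial in \<open>K[x\<^sub>0, \<dots>, x\<^bsub>n+1\<^esub>]\<close> and
  \<open>V(f) \<subset> \<P>\<^sup>n\<^sup>+\<^sup>1\<close> is free with the \<open>n + 1\<close> exponents \<open>es\<close>. The basis may be reordered, so the
  order of \<open>es\<close> is irrelevant.
\<close>

definition free_divisor :: "nat \<Rightarrow> (nat, 'a::comm_ring_1) mpoly \<Rightarrow> nat list \<Rightarrow> bool" where
  "free_divisor n f es \<longleftrightarrow>
     f \<in> polys {..n+1} \<and> (\<exists>d. homogeneous d f) \<and> squarefree f \<and> length es = n + 1 \<and>
     (\<exists>D. is_basis {..n+1} (Der0 {..n+1} f) (n + 1) D \<and>
          (\<forall>j < n + 1. der_homogeneous {..n+1} (es ! j) (D j)))"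

text \<open>
  A point \<open>([a\<^sub>i; b\<^sub>i])\<^sub>i\<close> of \<open>(\<P>\<^sup>1)\<^sup>I\<close> is represented by homogeneous coordinates
  \<open>p i = (a\<^sub>i, b\<^sub>i) \<noteq> (0, 0)\<close>. A Zariski-open set is the set of all (coordinates of) points at
  which not all members of a family of multihomogeneous polynomials vanish; the variables
  \<open>(i, False)\<close> and \<open>(i, True)\<close> stand for \<open>a\<^sub>i\<close> and \<open>b\<^sub>i\<close>. Such a set is invariant under rescaling
  of the coordinates of each factor.
\<close>

definition P1_coords :: "'i set \<Rightarrow> ('i \<Rightarrow> 'a::zero \<times> 'a) set" where
  "P1_coords I = I \<rightarrow>\<^sub>E (UNIV - {(0, 0)})"

definition multihomogeneous :: "'i set \<Rightarrow> ('i \<times> bool, 'a::zero) mpoly \<Rightarrow> bool" where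
  "multihomogeneous I F \<longleftrightarrow>
     F \<in> polys (I \<times> UNIV) \<and>
     (\<exists>d. \<forall>m \<in> Poly_Mapping.keys F. \<forall>i \<in> I.
        Poly_Mapping.lookup m (i, False) + Poly_Mapping.lookup m (i, True) = d i)"

definition zariski_open :: "'i set \<Rightarrow> ('i \<Rightarrow> 'a::comm_semiring_1 \<times> 'a) set \<Rightarrow> bool" where
  "zariski_open I U \<longleftrightarrow>
     (\<exists>\<F>. (\<forall>F \<in> \<F>. multihomogeneous I F) \<and>
          U = {p \<in> P1_coords I.
                 \<exists>F \<in> \<F>. eval_poly (\<lambda>(i, s). if s then snd (p i) else fst (p i)) F \<noteq> 0})"

definition generically ::
  "'i set \<Rightarrow> (('i \<Rightarrow> 'a::comm_semiring_1 \<times> 'a) \<Rightarrow> bool) \<Rightarrow> bool" where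
  "generically I Q \<longleftrightarrow> (\<exists>U. zariski_open I U \<and> U \<noteq> {} \<and> (\<forall>p \<in> U. Q p))"

definition pencil_member ::
  "('v, 'a::comm_semiring_1) mpoly \<Rightarrow> ('v, 'a) mpoly \<Rightarrow> 'a \<times> 'a \<Rightarrow> ('v, 'a) mpoly" where
  "pencil_member g1 g2 ab = Const (fst ab) * g1 + Const (snd ab) * g2"

definition h_tilde :: "nat \<Rightarrow> (nat \<Rightarrow> nat) \<Rightarrow> nat \<Rightarrow> (nat, 'a::comm_semiring_1) mpoly" where
  "h_tilde n r i = (\<Prod>j \<in> {0..n} - {i}. X j ^ r j)"

definition f1_tilde :: "nat \<Rightarrow> nat \<Rightarrow> (nat \<Rightarrow> nat) \<Rightarrow> (nat, 'a::comm_semiring_1) mpoly" where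
  "f1_tilde n m r = (\<Sum>i = m+1..n. h_tilde n r i)"

definition f2_tilde :: "nat \<Rightarrow> nat \<Rightarrow> (nat \<Rightarrow> nat) \<Rightarrow> (nat, 'a::comm_semiring_1) mpoly" where
  "f2_tilde n m r = (\<Sum>i = 0..m. h_tilde n r i)"

definition base_divisor :: "nat \<Rightarrow> nat \<Rightarrow> (nat \<Rightarrow> nat) \<Rightarrow> (nat, 'a::comm_semiring_1) mpoly" where
  "base_divisor n m r =
     (\<Prod>i = 0..n+1. X i) *
     (\<Sum>i = 0..m. X (n+1) ^ (r i - r 0) * (\<Prod>j \<in> {0..m} - {i}. X j ^ r j)) *
     (\<Sum>i = m+1..n. X (n+1) ^ (r i - r (m+1)) * (\<Prod>j \<in> {m+1..n} - {i}. X j ^ r j))"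

definition middle_exponents :: "nat \<Rightarrow> nat \<Rightarrow> (nat \<Rightarrow> nat) \<Rightarrow> nat list" where
  "middle_exponents n m r = map (\<lambda>i. r i + 1) (filter (\<lambda>i. i \<noteq> m + 1) [1..<n+1])"

end

theory Submission
  imports Defs "HOL-Computational_Algebra.Polynomial"
begin

text \<open>
  Put \<open>u\<^sub>i = (x\<^bsub>n+1\<^esub> / x\<^sub>i)\<^bsup>r i\<^esup>\<close>. Up to monomials, the two sums in the divisor are the sums of
  the \<open>u\<^sub>i\<close> over the blocks \<open>i \<le> m\<close> and \<open>i > m\<close>, and the members of the pencil are the linear
  combinations of these two sums. A derivation that kills the divisor is logarithmic along every
  variable, say \<open>\<Sum> \<alpha>\<^sub>v x\<^sub>v \<partial>\<^sub>v\<close>, and along both block sums; the latter forces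
  \<open>r\<^sub>i (\<alpha>\<^sub>i - \<alpha>\<^bsub>n+1\<^esub>) = \<beta> + \<epsilon>\<^sub>i x\<^sub>i\<^bsup>r i\<^esup>\<close>, where \<open>\<beta>\<close> depends only on the block and the
  \<open>\<epsilon>\<^sub>i\<close> satisfy one linear relation per block, in which the least exponent has coefficient
  \<open>1\<close>. Tangency to the members says that their product divides the difference of the two
  \<open>\<beta>\<close>. The solutions of these conditions have an evident basis containing the Euler
  derivation, and subtracting multiples of the latter moves the other basis elements into
  \<open>Der0\<close>. Part (i) is the case of no members.
\<close>

section \<open>Substitution homomorphisms\<close>

text \<open>Write z = n + 1. The logarithmic derivative of u_i is - r_i (\<alpha>_i - \<alpha>_z),
  so tangency to a block sum, with \<beta> the resulting quotient, makes the elements r_i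
  (\<alpha>_i - \<alpha>_z) - \<beta> the coefficients of a linear relation between the u_i of the
  block. After clearing denominators every term but the i-th is divisible by x_i^(r_i); this
  produces the \<epsilon>_i x_i^(r_i). The exponents can now be read off, since \<alpha> of degree d
  gives a derivation of degree d + 1: the common \<beta> gives 1, the difference of the two \<beta>,
  a multiple of the product of the members, gives 1 plus the degree of that product, and each free
  \<epsilon>_i gives r_i + 1. The linear relation of a block determines the \<epsilon> at its first
  index, so the indices 0 and m + 1 contribute nothing. Passing from a product to its factors, and
  identifying the reduced polynomial, rests on irreducible polynomials being prime; this is shown
  inside one fixed ring by adding variables one at a time. Characteristic 0 enters through
  squarefreeness, through division by the r_i and by the degree of the divisor, and through the
  existence of distinct members.\<close>

lemma poly_mapping_expansion:
  fixes p :: "'a \<Rightarrow>\<^sub>0 'b::comm_monoid_add"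
  shows "p = (\<Sum>m \<in> Poly_Mapping.keys p. Poly_Mapping.single m (Poly_Mapping.lookup p m))"
proof (rule poly_mapping_eqI)
  fix k
  have "Poly_Mapping.lookup (\<Sum>m \<in> Poly_Mapping.keys p. Poly_Mapping.single m (Poly_Mapping.lookup p m)) k
      = (\<Sum>m \<in> Poly_Mapping.keys p. if m = k then Poly_Mapping.lookup p k else 0)"
    by (auto simp: lookup_sum lookup_single when_def intro!: sum.cong)
  also have "\<dots> = Poly_Mapping.lookup p k"
    by (simp add: in_keys_iff)
  finally show "Poly_Mapping.lookup p k =
      Poly_Mapping.lookup (\<Sum>m \<in> Poly_Mapping.keys p. Poly_Mapping.single m (Poly_Mapping.lookup p m)) k"
    by simp
qed

lemma poly_mapping_single_induct [case_names zero single add]: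
  fixes p :: "'a \<Rightarrow>\<^sub>0 'b::comm_monoid_add"
  assumes "P 0" and "\<And>m c. P (Poly_Mapping.single m c)" and "\<And>p q. P p \<Longrightarrow> P q \<Longrightarrow> P (p + q)"
  shows "P p"
proof -
  have "P (\<Sum>m \<in> A. Poly_Mapping.single m (Poly_Mapping.lookup p m))" if "finite A" for A
    using that by (induction A) (use assms in auto)
  then show ?thesis
    by (subst poly_mapping_expansion) simp
qed

definition mon_val :: "('v \<Rightarrow> 'b::comm_semiring_1) \<Rightarrow> ('v \<Rightarrow>\<^sub>0 nat) \<Rightarrow> 'b" where
  "mon_val x m = (\<Prod>v \<in> Poly_Mapping.keys m. x v ^ Poly_Mapping.lookup m v)"

lemma mon_val_superset:
  assumes "finite A" and "Poly_Mapping.keys m \<subseteq> A"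
  shows "mon_val x m = (\<Prod>v \<in> A. x v ^ Poly_Mapping.lookup m v)"
  unfolding mon_val_def
  by (rule prod.mono_neutral_left) (use assms in \<open>auto simp: in_keys_iff\<close>)

lemma mon_val_0 [simp]: "mon_val x 0 = 1"
  by (simp add: mon_val_def)

lemma mon_val_add: "mon_val x (m + m') = mon_val x m * mon_val x m'"
proof -
  let ?A = "Poly_Mapping.keys m \<union> Poly_Mapping.keys m'"
  have "Poly_Mapping.keys (m + m') \<subseteq> ?A"
    by (rule keys_add)
  then show ?thesis
    by (simp add: mon_val_superset[of ?A] lookup_add power_add prod.distrib)
qed

lemma mon_val_single [simp]: "mon_val x (Poly_Mapping.single v k) = x v ^ k"
  by (cases "k = 0") (simp_all add: mon_val_def)

text \<open>The target ring is arbitrary because one set of rules has to serve evaluation at points,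
  substitution of polynomials for variables, the passage to polynomials in an auxiliary variable,
  the grading and the construction of derivations.\<close>

definition msubst :: "('a::zero \<Rightarrow> 'b::comm_semiring_1) \<Rightarrow> ('v \<Rightarrow> 'b) \<Rightarrow> ('v, 'a) mpoly \<Rightarrow> 'b" where
  "msubst c x p = (\<Sum>m \<in> Poly_Mapping.keys p. c (Poly_Mapping.lookup p m) * mon_val x m)"

locale coeff_hom =
  fixes c :: "'a::comm_ring_1 \<Rightarrow> 'b::comm_ring_1"
  assumes hom_0: "c 0 = 0" and hom_1: "c 1 = 1"
    and hom_add: "c (s + t) = c s + c t" and hom_mult: "c (s * t) = c s * c t"
begin

lemma msubst_superset:
  assumes "finite A" and "Poly_Mapping.keys p \<subseteq> A"
  shows "msubst c x p = (\<Sum>m \<in> A. c (Poly_Mapping.lookup p m) * mon_val x m)"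
  unfolding msubst_def
  by (rule sum.mono_neutral_left) (use assms in \<open>auto simp: in_keys_iff hom_0\<close>)

lemma msubst_0 [simp]: "msubst c x 0 = 0"
  by (simp add: msubst_def)

lemma msubst_add: "msubst c x (p + q) = msubst c x p + msubst c x q"
proof -
  let ?A = "Poly_Mapping.keys p \<union> Poly_Mapping.keys q"
  have "Poly_Mapping.keys (p + q) \<subseteq> ?A"
    by (rule keys_add)
  then show ?thesis
    by (simp add: msubst_superset[of ?A] lookup_add hom_add sum.distrib algebra_simps)
qed

lemma msubst_single [simp]: "msubst c x (Poly_Mapping.single m a) = c a * mon_val x m"
  by (cases "a = 0") (simp_all add: msubst_def hom_0)

lemma msubst_mult: "msubst c x (p * q) = msubst c x p * msubst c x q"
proof (induction p rule: poly_mapping_single_induct)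
  case (single m a)
  show ?case
    by (induction q rule: poly_mapping_single_induct)
       (simp_all add: mult_single hom_mult mon_val_add msubst_add algebra_simps)
qed (simp_all add: msubst_add algebra_simps)

lemma msubst_1 [simp]: "msubst c x 1 = 1"
  unfolding single_one[symmetric] by (subst msubst_single) (simp add: hom_1)

lemma msubst_Const [simp]: "msubst c x (Const a) = c a"
  by (simp add: Const_def)

lemma msubst_X [simp]: "msubst c x (X v) = x v"
  by (simp add: X_def hom_1)

lemma msubst_power: "msubst c x (p ^ k) = msubst c x p ^ k"
  by (induction k) (simp_all add: msubst_mult)

lemma msubst_sum: "msubst c x (sum f A) = (\<Sum>i \<in> A. msubst c x (f i))"
  by (induction A rule: infinite_finite_induct) (simp_all add: msubst_add)

lemma msubst_prod: "msubst c x (prod f A) = (\<Prod>i \<in> A. msubst c x (f i))"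
  by (induction A rule: infinite_finite_induct) (simp_all add: msubst_mult)

lemmas msubst_simps = msubst_add msubst_mult msubst_power msubst_sum msubst_prod

lemma msubst_dvd: "p dvd q \<Longrightarrow> msubst c x p dvd msubst c x q"
  by (auto simp: msubst_mult elim!: dvdE)

end

lemma eval_poly_eq_msubst: "eval_poly x p = msubst (\<lambda>a. a) x p"
  by (simp add: eval_poly_def msubst_def mon_val_def)

lemma Const_0 [simp]: "Const 0 = 0" and Const_1 [simp]: "Const 1 = 1"
  by (simp_all add: Const_def)

lemma Const_add: "Const (a + b) = Const a + Const b"
  by (simp add: Const_def single_add)

lemma Const_mult: "Const (a * b) = Const a * (Const b :: ('v, 'a::comm_ring_1) mpoly)"
  by (simp add: Const_def mult_single)

lemma Const_diff: "Const (a - b) = Const a - (Const b :: ('v, 'a::comm_ring_1) mpoly)"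
  by (simp add: Const_def single_diff)

lemma Const_eq_0_iff [simp]: "Const a = 0 \<longleftrightarrow> a = 0"
  by (metis Const_def Const_0 lookup_single_eq)

lemma Const_of_nat: "Const (of_nat k) = (of_nat k :: ('v, 'a::comm_ring_1) mpoly)"
  by (induction k) (simp_all add: Const_add)

lemma Const_inverse_mult:
  fixes a :: "'a::field"
  assumes "a \<noteq> 0"
  shows "Const (inverse a) * Const a = 1" "Const a * Const (inverse a) = 1"
  using assms by (simp_all flip: Const_mult)

interpretation id_hom: coeff_hom "\<lambda>a::'a::comm_ring_1. a"
  by unfold_locales auto

interpretation Const_hom: coeff_hom "Const :: 'a::comm_ring_1 \<Rightarrow> ('v, 'a) mpoly"
  by unfold_locales (simp_all add: Const_add Const_mult)

interpretation pConst_hom: coeff_hom "\<lambda>a::'a::comm_ring_1. [:Const a :: ('v, 'a) mpoly:]"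
  by unfold_locales (simp_all add: Const_add Const_mult)

lemma single_eq_mon_val: 
  "Poly_Mapping.single m (a::'a::comm_ring_1) = Const a * mon_val X m"
proof -
  have P: "(\<Prod>v \<in> A. X v ^ Poly_Mapping.lookup m v) =
      Poly_Mapping.single (\<Sum>v \<in> A. Poly_Mapping.single v (Poly_Mapping.lookup m v)) (1::'a)" if "finite A" for A
    using that
  proof (induction A)
    case (insert v A)
    have "X v ^ k = Poly_Mapping.single (Poly_Mapping.single v k) (1::'a)" for k
      by (induction k) (simp_all add: X_def mult_single flip: single_add)
    with insert show ?case by (simp add: mult_single)
  qed auto
  have "mon_val X m = Poly_Mapping.single m (1::'a)"
    unfolding mon_val_def by (subst P) (simp_all flip: poly_mapping_expansion)
  then show ?thesis
    by (simp add: Const_def mult_single)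
qed

lemma msubst_Const_X [simp]: "msubst Const X p = (p :: ('v, 'a::comm_ring_1) mpoly)"
  unfolding msubst_def single_eq_mon_val[symmetric] by (rule poly_mapping_expansion[symmetric])

section \<open>Polynomials in a given set of variables\<close>

lemma polys_UNIV [simp]: "p \<in> polys UNIV"
  by (simp add: polys_def)

lemma polys_mono: "V \<subseteq> W \<Longrightarrow> polys V \<subseteq> polys W"
  by (auto simp: polys_def)

lemma polys_0 [simp]: "0 \<in> polys V"
  by (simp add: polys_def)

lemma polys_Const [simp]: "Const a \<in> polys V"
  by (simp add: polys_def Const_def)

lemma polys_1 [simp]: "(1 :: ('v, 'a::comm_ring_1) mpoly) \<in> polys V"
  unfolding Const_1[symmetric] by (rule polys_Const)

lemma polys_X [simp]: "(X v :: ('v, 'a::zero_neq_one) mpoly) \<in> polys V \<longleftrightarrow> v \<in> V"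
  by (simp add: polys_def X_def)

lemma polys_add: "p \<in> polys V \<Longrightarrow> q \<in> polys V \<Longrightarrow> p + q \<in> polys V"
  using keys_add[of p q] by (fastforce simp: polys_def)

lemma polys_mult:
  fixes p q :: "('v, 'a::comm_ring_1) mpoly"
  assumes "p \<in> polys V" and "q \<in> polys V"
  shows "p * q \<in> polys V"
  unfolding polys_def
proof safe
  fix m v assume "m \<in> Poly_Mapping.keys (p * q)" and v: "v \<in> Poly_Mapping.keys m"
  then obtain a b where "a \<in> Poly_Mapping.keys p" "b \<in> Poly_Mapping.keys q" "m = a + b"
    using keys_mult[of p q] by blast
  with v keys_add[of a b] assms show "v \<in> V"
    by (fastforce simp: polys_def)
qed

lemma polys_uminus: "p \<in> polys V \<Longrightarrow> - p \<in> polys V" for p :: "('v, 'a::comm_ring_1) mpoly"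
  using polys_mult[OF polys_Const[of "- 1"]] by (simp add: Const_def single_uminus)

lemma polys_diff: "p \<in> polys V \<Longrightarrow> q \<in> polys V \<Longrightarrow> p - q \<in> polys V"
  for p :: "('v, 'a::comm_ring_1) mpoly"
  using polys_add[OF _ polys_uminus] by fastforce

lemma polys_power: "p \<in> polys V \<Longrightarrow> p ^ k \<in> polys V" for p :: "('v, 'a::comm_ring_1) mpoly"
  by (induction k) (auto intro: polys_mult)

lemma polys_sum: "(\<And>i. i \<in> A \<Longrightarrow> f i \<in> polys V) \<Longrightarrow> sum f A \<in> polys V"
  by (induction A rule: infinite_finite_induct) (auto intro: polys_add)

lemma polys_prod: "(\<And>i. i \<in> A \<Longrightarrow> f i \<in> polys V) \<Longrightarrow> prod f A \<in> polys V"
  for f :: "_ \<Rightarrow> ('v, 'a::comm_ring_1) mpoly"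
  by (induction A rule: infinite_finite_induct) (auto intro: polys_mult)

lemmas polys_intros = polys_add polys_mult polys_uminus polys_diff polys_power polys_sum polys_prod

lemma polys_induct [consumes 1, case_names Const X add mult]:
  fixes p :: "('v, 'a::comm_ring_1) mpoly"
  assumes "p \<in> polys V" and C: "\<And>a. P (Const a)" and X: "\<And>v. v \<in> V \<Longrightarrow> P (X v)"
    and A: "\<And>p q. p \<in> polys V \<Longrightarrow> q \<in> polys V \<Longrightarrow> P p \<Longrightarrow> P q \<Longrightarrow> P (p + q)"
    and M: "\<And>p q. p \<in> polys V \<Longrightarrow> q \<in> polys V \<Longrightarrow> P p \<Longrightarrow> P q \<Longrightarrow> P (p * q)"
  shows "P p"
proof -
  have pow: "P (X v ^ k)" if "v \<in> V" for v k
    by (induction k) (use C[of 1] X[OF that] that in \<open>auto intro!: M polys_power\<close>)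
  have prod: "P (\<Prod>v \<in> A. X v ^ e v)" if "finite A" "A \<subseteq> V" for A e
    using that by (induction A) (use C[of 1] pow M in \<open>auto intro!: M polys_prod polys_power\<close>)
  have mon: "P (Const a * mon_val X m)" if "Poly_Mapping.keys m \<subseteq> V" for a m
    unfolding mon_val_def
    by (rule M) (use that prod C in \<open>auto intro!: polys_prod polys_power\<close>)
  have "P (\<Sum>m \<in> A. Const (Poly_Mapping.lookup p m) * mon_val X m)"
    if "finite A" "\<forall>m\<in>A. Poly_Mapping.keys m \<subseteq> V" for A
    using that
  proof (induction A)
    case (insert m A)
    then show ?case
      using C[of 0] mon
      by (auto simp: mon_val_def subset_iff intro!: A polys_mult polys_sum polys_prod polys_power)
  qed (use C[of 0] in simp)
  then have "P (\<Sum>m \<in> Poly_Mapping.keys p. Const (Poly_Mapping.lookup p m) * mon_val X m)"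
    using assms(1) by (auto simp: polys_def)
  then show ?thesis
    by (subst poly_mapping_expansion) (simp only: single_eq_mon_val)
qed

lemma msubst_cong:
  assumes "p \<in> polys V" and "\<And>v. v \<in> V \<Longrightarrow> x v = y v"
  shows "msubst c x p = msubst c y p"
  unfolding msubst_def mon_val_def
  using assms by (intro sum.cong prod.cong refl arg_cong2[of _ _ _ _ "(*)"]) (auto simp: polys_def subset_iff)

text \<open>Reads a polynomial as univariate in x_v. The coefficients stay in the ring of all
  variables, so an induction on the number of variables never changes the type.\<close>

definition as_poly :: "'v \<Rightarrow> ('v, 'a::comm_ring_1) mpoly \<Rightarrow> ('v, 'a) mpoly poly" where
  "as_poly v = msubst (\<lambda>a. [:Const a:]) (\<lambda>w. if w = v then [:0, 1:] else [:X w:])"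

lemma as_poly_add: "as_poly v (p + q) = as_poly v p + as_poly v q"
  and as_poly_mult: "as_poly v (p * q) = as_poly v p * as_poly v q"
  and as_poly_0 [simp]: "as_poly v 0 = 0"
  and as_poly_1 [simp]: "as_poly v 1 = 1"
  and as_poly_Const [simp]: "as_poly v (Const a) = [:Const a:]"
  and as_poly_X: "as_poly v (X w) = (if w = v then [:0, 1:] else [:X w:])"
  by (simp_all add: as_poly_def pConst_hom.msubst_simps)

lemma poly_as_poly [simp]: "poly (as_poly v p) (X v) = p"
proof -
  have "p \<in> polys UNIV" by simp
  then show ?thesis
    by (induction rule: polys_induct) (simp_all add: as_poly_add as_poly_mult as_poly_X)
qed

lemma coeff_as_poly_polys: "p \<in> polys W \<Longrightarrow> coeff (as_poly v p) i \<in> polys (W - {v})"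
proof (induction arbitrary: i rule: polys_induct)
  case (mult p q)
  then show ?case
    by (auto simp: as_poly_mult coeff_mult intro!: polys_sum polys_mult)
qed (auto simp: as_poly_add as_poly_X coeff_pCons split: nat.splits intro: polys_add)

lemma as_poly_eq_const: "p \<in> polys W \<Longrightarrow> v \<notin> W \<Longrightarrow> as_poly v p = [:p:]"
  by (induction rule: polys_induct) (auto simp: as_poly_add as_poly_mult as_poly_X)

text \<open>The other half of \<open>poly_as_poly\<close>: for v outside W, \<open>as_poly v\<close>
  identifies \<open>polys (insert v W)\<close> with the polynomials over
  \<open>polys W\<close>.\<close>

lemma as_poly_poly:
  assumes "\<And>i. coeff q i \<in> polys W" and "v \<notin> W"
  shows "as_poly v (poly q (X v)) = q"
  using assms(1)
proof (induction q)
  case (pCons a q)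
  have "a \<in> polys W"
    using pCons.prems[of 0] by simp
  moreover have "as_poly v (poly q (X v)) = q"
    using pCons.IH pCons.prems[of "Suc _"] by simp
  ultimately show ?case
    by (simp add: as_poly_add as_poly_mult as_poly_X as_poly_eq_const[OF _ assms(2)])
qed simp

lemma polys_degree_0:
  assumes "degree (as_poly v p) = 0"
  shows "p \<in> polys (- {v})"
proof -
  obtain a where a: "as_poly v p = [:a:]"
    using assms by (rule degree_eq_zeroE)
  have "p = coeff (as_poly v p) 0"
    using poly_as_poly[of v p] by (simp add: a)
  also have "\<dots> \<in> polys (UNIV - {v})"
    by (rule coeff_as_poly_polys) simp
  finally show ?thesis
    by (simp add: Compl_eq_Diff_UNIV)
qed

text \<open>Degrees in x_v add in a domain, so the factors of a nonzero product free of x_v are free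
  of x_v. The sort \<open>linorder\<close> of the variables gives access to the fact that the
  polynomials form a domain.\<close>

lemma polys_divisor_closed:
  fixes p q :: "('v::linorder, 'a::idom) mpoly"
  assumes "p * q \<in> polys V" and "p * q \<noteq> 0"
  shows "p \<in> polys V" "q \<in> polys V"
proof -
  have *: "p \<in> polys V" if "p * q \<in> polys V" "p * q \<noteq> 0" for p q :: "('v::linorder, 'a::idom) mpoly"
  proof -
    have "p \<in> polys (- {v})" if "v \<notin> V" for v
    proof (rule polys_degree_0)
      have "as_poly v p * as_poly v q = [:p * q:]"
        unfolding as_poly_mult[symmetric] using \<open>p * q \<in> polys V\<close> that by (rule as_poly_eq_const)
      moreover from this have "as_poly v p \<noteq> 0" "as_poly v q \<noteq> 0"
        using \<open>p * q \<noteq> 0\<close> by auto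
      ultimately show "degree (as_poly v p) = 0"
        by (metis add_is_0 degree_mult_eq degree_pCons_0)
    qed
    then show ?thesis
      by (auto simp: polys_def)
  qed
  show "p \<in> polys V" "q \<in> polys V"
    using *[of p q] *[of q p] assms by (simp_all add: mult.commute)
qed

section \<open>Total degree, units and existence of factorizations\<close>

lemma mon_deg_superset:
  assumes "finite A" and "Poly_Mapping.keys m \<subseteq> A"
  shows "mon_deg m = (\<Sum>v \<in> A. Poly_Mapping.lookup m v)"
  unfolding mon_deg_def by (rule sum.mono_neutral_left) (use assms in \<open>auto simp: in_keys_iff\<close>)

lemma mon_deg_add: "mon_deg (m + m') = mon_deg m + mon_deg m'"
proof -
  let ?A = "Poly_Mapping.keys m \<union> Poly_Mapping.keys m'"
  have "Poly_Mapping.keys (m + m') \<subseteq> ?A"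
    by (rule keys_add)
  then show ?thesis
    by (simp add: mon_deg_superset[of ?A] lookup_add sum.distrib)
qed

lemma mon_deg_eq_0_iff [simp]: "mon_deg m = 0 \<longleftrightarrow> m = 0"
proof
  assume "mon_deg m = 0"
  then have "Poly_Mapping.lookup m v = 0" for v
    by (cases "v \<in> Poly_Mapping.keys m") (auto simp: mon_deg_def in_keys_iff)
  then show "m = 0"
    by (intro poly_mapping_eqI) simp
qed (simp add: mon_deg_def)

lemma mon_deg_single [simp]: "mon_deg (Poly_Mapping.single v k) = k"
  by (simp add: mon_deg_def)

text \<open>The substitution of t x_w for x_w: the coefficient of t^k is the homogeneous component
  of degree k. It turns total degree into \<open>degree\<close> and homogenization into
  \<open>reflect_poly\<close>, so products are handled by the univariate theory.\<close>

definition grading :: "('v, 'a::comm_ring_1) mpoly \<Rightarrow> ('v, 'a) mpoly poly" where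
  "grading = msubst (\<lambda>a. [:Const a:]) (\<lambda>w. monom (X w) 1)"

lemma grading_mult: "grading (p * q) = grading p * grading q"
  and grading_sum: "grading (sum f A) = (\<Sum>i\<in>A. grading (f i))"
  and grading_0 [simp]: "grading 0 = 0"
  by (simp_all add: grading_def pConst_hom.msubst_simps)

lemma mon_val_monom_X: "mon_val (\<lambda>w. monom (X w) 1) m = monom (mon_val X m) (mon_deg m)"
proof -
  have "(\<Prod>v\<in>A. monom (X v) 1 ^ Poly_Mapping.lookup m v) =
      monom (\<Prod>v\<in>A. X v ^ Poly_Mapping.lookup m v) (\<Sum>v\<in>A. Poly_Mapping.lookup m v)" for A
    by (induction A rule: infinite_finite_induct) (simp_all add: monom_power mult_monom)
  then show ?thesis
    by (simp add: mon_val_def mon_deg_def)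
qed

lemma lookup_coeff_grading:
  "Poly_Mapping.lookup (coeff (grading p) k) m = (if mon_deg m = k then Poly_Mapping.lookup p m else 0)"
proof -
  have "grading p = (\<Sum>m\<in>Poly_Mapping.keys p. monom (Poly_Mapping.single m (Poly_Mapping.lookup p m)) (mon_deg m))"
    by (simp add: grading_def msubst_def mon_val_monom_X single_eq_mon_val smult_monom del: One_nat_def)
  then have "Poly_Mapping.lookup (coeff (grading p) k) m =
      (\<Sum>m'\<in>Poly_Mapping.keys p. if m' = m then (if mon_deg m = k then Poly_Mapping.lookup p m else 0) else 0)"
    by (simp only: coeff_sum lookup_sum) (rule sum.cong, auto simp: lookup_single when_def)
  also have "\<dots> = (if mon_deg m = k then Poly_Mapping.lookup p m else 0)"
    by (simp add: in_keys_iff)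
  finally show ?thesis .
qed

lemma mon_deg_le_total_deg: "m \<in> Poly_Mapping.keys p \<Longrightarrow> mon_deg m \<le> total_deg p"
  by (simp add: total_deg_def)

lemma degree_grading: "degree (grading p) = total_deg p"
proof (rule antisym)
  have "coeff (grading p) k = 0" if "k > total_deg p" for k
    using mon_deg_le_total_deg[of _ p] that
    by (intro poly_mapping_eqI) (fastforce simp: lookup_coeff_grading in_keys_iff)
  then show "degree (grading p) \<le> total_deg p"
    by (intro degree_le) simp
  have "mon_deg m \<le> degree (grading p)" if "m \<in> Poly_Mapping.keys p" for m
  proof (rule le_degree)
    have "Poly_Mapping.lookup (coeff (grading p) (mon_deg m)) m \<noteq> 0"
      using that by (simp add: lookup_coeff_grading in_keys_iff)
    then show "coeff (grading p) (mon_deg m) \<noteq> 0" by auto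
  qed
  then show "total_deg p \<le> degree (grading p)"
    by (simp add: total_deg_def)
qed

lemma poly_grading_1: "poly (grading p) 1 = p"
proof -
  have "p \<in> polys UNIV" by simp
  then show ?thesis
    by (induction rule: polys_induct)
       (simp_all add: grading_def pConst_hom.msubst_simps poly_monom)
qed

lemma grading_eq_0_iff [simp]: "grading p = 0 \<longleftrightarrow> p = 0"
  by (metis grading_0 poly_0 poly_grading_1)

lemma total_deg_X: "total_deg (X v :: ('v, 'a::zero_neq_one) mpoly) = 1"
  by (simp add: X_def total_deg_def)

lemma X_neq_0 [simp]: "X v \<noteq> (0 :: ('v, 'a::zero_neq_one) mpoly)"
  by (metis X_def lookup_single_eq lookup_zero zero_neq_one)

lemma total_deg_mult:
  fixes p q :: "('v::linorder, 'a::idom) mpoly"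
  assumes "p \<noteq> 0" and "q \<noteq> 0"
  shows "total_deg (p * q) = total_deg p + total_deg q"
  using assms by (simp add: grading_mult degree_mult_eq flip: degree_grading)

lemma total_deg_eq_0D:
  assumes "total_deg p = 0"
  shows "p = Const (Poly_Mapping.lookup p 0)"
proof (rule poly_mapping_eqI)
  fix m
  show "Poly_Mapping.lookup p m = Poly_Mapping.lookup (Const (Poly_Mapping.lookup p 0)) m"
    using mon_deg_le_total_deg[of m p] assms
    by (auto simp: Const_def lookup_single when_def in_keys_iff)
qed

lemma unit_iff_total_deg:
  fixes p :: "('v::linorder, 'a::field) mpoly"
  assumes "p \<noteq> 0"
  shows "p dvd 1 \<longleftrightarrow> total_deg p = 0"
proof
  assume "p dvd 1"
  then obtain q where q: "1 = p * q" ..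
  with assms have "q \<noteq> 0" by auto
  with q assms have "total_deg (1 :: ('v, 'a) mpoly) = total_deg p + total_deg q"
    by (metis total_deg_mult)
  then show "total_deg p = 0"
    by (simp add: total_deg_def mon_deg_def)
next
  assume "total_deg p = 0"
  then obtain a where a: "p = Const a"
    using total_deg_eq_0D by blast
  with assms have "1 = p * Const (inverse a)"
    by (simp add: Const_inverse_mult)
  then show "p dvd 1" ..
qed

lemma unitE:
  fixes p :: "('v::linorder, 'a::field) mpoly"
  assumes "p dvd 1"
  obtains a where "a \<noteq> 0" "p = Const a"
  using assms unit_iff_total_deg[of p] total_deg_eq_0D[of p]
  by (metis Const_eq_0_iff dvd_0_left zero_neq_one)

lemma Const_unit: "a \<noteq> 0 \<Longrightarrow> Const a dvd (1 :: ('v, 'a::field) mpoly)"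
  by (metis Const_inverse_mult(2) dvd_triv_left)

lemma irreducible_X: "irreducible (X v :: ('v::linorder, 'a::field) mpoly)"
proof (rule irreducibleI)
  show "\<not> (X v :: ('v, 'a) mpoly) dvd 1"
    by (simp add: unit_iff_total_deg total_deg_X)
  fix a b :: "('v, 'a) mpoly"
  assume ab: "X v = a * b"
  then have "a * b \<noteq> 0" by (metis X_neq_0)
  then have nz: "a \<noteq> 0" "b \<noteq> 0" by auto
  then have "total_deg a + total_deg b = 1"
    using ab total_deg_X[of v] by (metis total_deg_mult)
  then show "a dvd 1 \<or> b dvd 1"
    using nz by (auto simp: unit_iff_total_deg)
qed simp

text \<open>Units are the nonzero elements of total degree 0 and degrees add, so both factors of a
  proper factorization have smaller total degree.\<close>

lemma irreducible_factorization:
  fixes p :: "('v::linorder, 'a::field) mpoly"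
  assumes "p \<noteq> 0" and "\<not> p dvd 1"
  shows "\<exists>ps. (\<forall>q\<in>set ps. irreducible q) \<and> prod_list ps = p"
  using assms
proof (induction "total_deg p" arbitrary: p rule: less_induct)
  case less
  show ?case
  proof (cases "irreducible p")
    case True
    then show ?thesis
      by (intro exI[of _ "[p]"]) simp
  next
    case False
    with less.prems obtain a b where ab: "p = a * b" "\<not> a dvd 1" "\<not> b dvd 1"
      by (auto simp: irreducible_def)
    with less.prems have "a \<noteq> 0" "b \<noteq> 0" by auto
    with ab have "total_deg a < total_deg p" "total_deg b < total_deg p"
      by (simp_all add: total_deg_mult unit_iff_total_deg)
    with less.hyps ab \<open>a \<noteq> 0\<close> \<open>b \<noteq> 0\<close> obtain ps qs
      where "\<forall>q\<in>set ps. irreducible q" "prod_list ps = a" "\<forall>q\<in>set qs. irreducible q" "prod_list qs = b"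
      by meson
    with ab show ?thesis
      by (intro exI[of _ "ps @ qs"]) auto
  qed
qed

section \<open>Unique factorization\<close>

text \<open>Closure under divisors lets units, divisibility and irreducibility be taken in the
  ambient domain without change of meaning. The induction over sets of variables can then run
  through subrings of one ring.\<close>

locale factorial_subring =
  fixes A :: "'r::idom set"
  assumes one_closed: "1 \<in> A"
    and diff_closed: "a \<in> A \<Longrightarrow> b \<in> A \<Longrightarrow> a - b \<in> A"
    and mult_closed: "a \<in> A \<Longrightarrow> b \<in> A \<Longrightarrow> a * b \<in> A"
    and divisor_closed: "a * b \<in> A \<Longrightarrow> a * b \<noteq> 0 \<Longrightarrow> a \<in> A"
    and factorization: "a \<in> A \<Longrightarrow> a \<noteq> 0 \<Longrightarrow> \<not> a dvd 1 \<Longrightarrow>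
      \<exists>ps. (\<forall>p\<in>set ps. irreducible p) \<and> prod_list ps = a"
    and irreducible_prime: "p \<in> A \<Longrightarrow> irreducible p \<Longrightarrow> a \<in> A \<Longrightarrow> b \<in> A \<Longrightarrow>
      p dvd a * b \<Longrightarrow> p dvd a \<or> p dvd b"
begin

lemma zero_closed: "0 \<in> A"
  using diff_closed[OF one_closed one_closed] by simp

lemma uminus_closed: "a \<in> A \<Longrightarrow> - a \<in> A"
  using diff_closed[OF zero_closed, of a] by simp

lemma add_closed: "a \<in> A \<Longrightarrow> b \<in> A \<Longrightarrow> a + b \<in> A"
  using diff_closed[OF _ uminus_closed, of a b] by simp

lemma sum_closed: "(\<And>i. i \<in> I \<Longrightarrow> f i \<in> A) \<Longrightarrow> sum f I \<in> A"
  by (induction I rule: infinite_finite_induct) (auto intro: add_closed zero_closed)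

lemma unit_inverse_closed: "a * b = 1 \<Longrightarrow> a \<in> A" "a * b = 1 \<Longrightarrow> b \<in> A"
  using divisor_closed[of a b] divisor_closed[of b a] one_closed by (auto simp: mult.commute)

definition pol :: "'r poly set" where
  "pol = {q. \<forall>i. coeff q i \<in> A}"

lemma pol_diff: "f \<in> pol \<Longrightarrow> g \<in> pol \<Longrightarrow> f - g \<in> pol"
  and pol_add: "f \<in> pol \<Longrightarrow> g \<in> pol \<Longrightarrow> f + g \<in> pol"
  and pol_mult: "f \<in> pol \<Longrightarrow> g \<in> pol \<Longrightarrow> f * g \<in> pol"
  and pol_smult: "a \<in> A \<Longrightarrow> f \<in> pol \<Longrightarrow> smult a f \<in> pol"
  and pol_monom: "a \<in> A \<Longrightarrow> monom a n \<in> pol"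
  and pol_const: "a \<in> A \<Longrightarrow> [:a:] \<in> pol"
  and pol_0: "0 \<in> pol"
  and pol_1: "1 \<in> pol"
  by (auto simp: pol_def diff_closed add_closed coeff_mult mult_closed zero_closed one_closed coeff_pCons
        split: nat.splits intro!: sum_closed mult_closed)

lemma pol_of_smult:
  assumes "smult a f \<in> pol" and "a \<noteq> 0"
  shows "f \<in> pol"
  unfolding pol_def
proof safe
  fix i
  have "coeff f i * a \<in> A"
    using assms(1) by (simp add: pol_def mult.commute)
  then show "coeff f i \<in> A"
    using divisor_closed zero_closed assms(2) by (cases "coeff f i = 0") auto
qed

text \<open>Gauss' lemma on contents: c divides the product of the leading coefficients of f and g,
  hence one of them, and dropping that leading term lowers the sum of the degrees.\<close>

lemma const_prime:
  assumes "c \<in> A" and "irreducible c"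
  shows "f \<in> pol \<Longrightarrow> g \<in> pol \<Longrightarrow> [:c:] dvd f * g \<Longrightarrow> [:c:] dvd f \<or> [:c:] dvd g"
proof (induction "degree f + degree g" arbitrary: f g rule: less_induct)
  case less
  \<comment> \<open>A leading term divisible by \<open>c\<close> may be removed.\<close>
  have drop: "[:c:] dvd f \<or> [:c:] dvd g"
    if "f \<in> pol" "g \<in> pol" "[:c:] dvd f * g" "c dvd lead_coeff f"
      and "degree f + degree g = d" and IH: "\<And>f' g'. degree f' + degree g' < d \<Longrightarrow> f' \<in> pol \<Longrightarrow> g' \<in> pol \<Longrightarrow>
          [:c:] dvd f' * g' \<Longrightarrow> [:c:] dvd f' \<or> [:c:] dvd g'" for f g d
  proof -
    define l where "l = monom (lead_coeff f) (degree f)"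
    have l: "[:c:] dvd l"
      using that(4) by (auto simp: l_def const_poly_dvd_iff)
    have "l \<in> pol"
      using that(1) by (auto simp: l_def pol_def zero_closed)
    show ?thesis
    proof (cases "f = l")
      case True
      with l show ?thesis by simp
    next
      case False
      have "f - l = 0 \<or> degree (f - l) < degree f"
        unfolding l_def
        by (intro eq_zero_or_degree_less degree_diff_le) (auto simp: degree_monom_le)
      then have "degree (f - l) + degree g < d"
        using that(5) False by simp
      moreover have "[:c:] dvd (f - l) * g"
        unfolding left_diff_distrib by (intro dvd_diff) (use that(3) l in auto)
      ultimately have "[:c:] dvd f - l \<or> [:c:] dvd g"
        using IH that(1,2) \<open>l \<in> pol\<close> pol_diff by blast
      with l show ?thesis
        using dvd_add[of "[:c:]" "f - l" l] by auto
    qed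
  qed
  have "c dvd lead_coeff f * lead_coeff g"
    using less.prems(3) unfolding const_poly_dvd_iff by (metis lead_coeff_mult)
  then have "c dvd lead_coeff f \<or> c dvd lead_coeff g"
    using irreducible_prime[OF assms] less.prems by (auto simp: pol_def)
  then show ?case
  proof
    assume "c dvd lead_coeff f"
    with drop[of f g, OF less.prems _ refl] less.hyps show ?thesis by blast
  next
    assume "c dvd lead_coeff g"
    moreover have "[:c:] dvd g * f"
      using less.prems(3) by (simp add: mult.commute)
    ultimately have "[:c:] dvd g \<or> [:c:] dvd f"
      using drop[of g f "degree g + degree f"] less.hyps less.prems(1,2) by (metis add.commute)
    then show ?thesis by blast
  qed
qed

text \<open>The irreducible factors of c are distributed one by one: each divides h or s by
  \<open>const_prime\<close> and is split off there. The constants a and b collect what h and s give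
  up.\<close>

lemma const_cancel:
  assumes "c \<in> A" and "c \<noteq> 0" and "h \<in> pol" and "s \<in> pol" and "h * s = smult c q"
  obtains a b h' s' where "a \<in> A" "b \<in> A" "a \<noteq> 0" "b \<noteq> 0" "h' \<in> pol" "s' \<in> pol"
    "h = smult a h'" "s = smult b s'" "h' * s' = q"
proof -
  have main: "\<exists>a b h' s'. a \<in> A \<and> b \<in> A \<and> a \<noteq> 0 \<and> b \<noteq> 0 \<and> h' \<in> pol \<and> s' \<in> pol \<and>
      h = smult a h' \<and> s = smult b s' \<and> h' * s' = q"
    if "\<forall>p\<in>set ps. p \<in> A \<and> irreducible p" "h \<in> pol" "s \<in> pol" "h * s = smult (prod_list ps) q" for ps h s
    using that
  proof (induction ps arbitrary: h s)
    case Nil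
    then show ?case
      by (intro exI[of _ 1] exI[of _ h] exI[of _ s]) (simp add: one_closed)
  next
    case (Cons p ps)
    then have p: "p \<in> A" "irreducible p" "p \<noteq> 0" by auto
    have hs: "h * s = [:p:] * smult (prod_list ps) q"
      using Cons.prems(4) by (simp add: mult.commute)
    then have "[:p:] dvd h * s"
      by (metis dvd_triv_left)
    then have "[:p:] dvd h \<or> [:p:] dvd s"
      using const_prime p Cons.prems(2,3) by blast
    then show ?case
    proof
      assume "[:p:] dvd h"
      then obtain h1 where h1: "h = smult p h1"
        by (auto elim!: dvdE)
      with Cons.prems p have "h1 \<in> pol"
        using pol_of_smult by blast
      have "smult p (h1 * s) = smult p (smult (prod_list ps) q)"
        using hs h1 by (simp add: mult.commute)
      with p have "h1 * s = smult (prod_list ps) q"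
        using smult_cancel[of p] by simp
      then obtain a b h' s' where *: "a \<in> A" "b \<in> A" "a \<noteq> 0" "b \<noteq> 0" "h' \<in> pol" "s' \<in> pol"
          "h1 = smult a h'" "s = smult b s'" "h' * s' = q"
        using Cons.IH[of h1 s] Cons.prems \<open>h1 \<in> pol\<close> by auto
      with h1 p show ?thesis
        by (intro exI[of _ "p * a"] exI[of _ b] exI[of _ h'] exI[of _ s']) (auto intro: mult_closed)
    next
      assume "[:p:] dvd s"
      then obtain s1 where s1: "s = smult p s1"
        by (auto elim!: dvdE)
      with Cons.prems p have "s1 \<in> pol"
        using pol_of_smult by blast
      have "smult p (h * s1) = smult p (smult (prod_list ps) q)"
        using hs s1 by (simp add: mult.commute)
      with p have "h * s1 = smult (prod_list ps) q"
        using smult_cancel[of p] by simp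
      then obtain a b h' s' where *: "a \<in> A" "b \<in> A" "a \<noteq> 0" "b \<noteq> 0" "h' \<in> pol" "s' \<in> pol"
          "h = smult a h'" "s1 = smult b s'" "h' * s' = q"
        using Cons.IH[of h s1] Cons.prems \<open>s1 \<in> pol\<close> by auto
      with s1 p show ?thesis
        by (intro exI[of _ a] exI[of _ "p * b"] exI[of _ h'] exI[of _ s']) (auto intro: mult_closed)
    qed
  qed
  show ?thesis
  proof (cases "c dvd 1")
    case True
    then obtain u where u: "c * u = 1" by (metis dvdE)
    have "h * smult u s = q"
      using assms(5) u by (simp add: mult.commute)
    moreover have "s = smult c (smult u s)"
      using u by simp
    ultimately show ?thesis
      using that[of 1 c h "smult u s"] assms u one_closed unit_inverse_closed(2)[OF u]
      by (auto intro: pol_smult)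
  next
    case False
    then obtain ps where ps: "\<forall>p\<in>set ps. irreducible p" "prod_list ps = c"
      using factorization assms by blast
    have "p \<in> A" if "p \<in> set ps" for p
    proof -
      from that obtain d where "c = p * d"
        using ps(2) prod_list_dvd by (metis dvdE)
      with assms divisor_closed show ?thesis by blast
    qed
    with main[of ps h s] ps assms that show ?thesis by blast
  qed
qed

text \<open>An element \<open>h\<close> of least degree in the ideal generated by \<open>p\<close> and \<open>f\<close> divides both up to
  constants, by pseudo-division; \<open>p\<close> being irreducible, the primitive part of \<open>h\<close> is \<open>p\<close> or \<open>1\<close>
  up to units. This replaces the passage to the field of fractions in Gauss' argument.\<close>

lemma poly_prime:
  assumes p: "p \<in> pol" "degree p > 0"
    and irr: "\<And>a b. a \<in> pol \<Longrightarrow> b \<in> pol \<Longrightarrow> p = a * b \<Longrightarrow> a dvd 1 \<or> b dvd 1"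
    and fg: "f \<in> pol" "g \<in> pol" "y \<in> pol" "f * g = p * y"
  shows "p dvd f \<or> p dvd g"
proof (rule ccontr)
  assume neg: "\<not> (p dvd f \<or> p dvd g)"
  have p0: "p \<noteq> 0" using p by auto
  \<comment> \<open>\<open>const_cancel\<close> splits a constant a off p. Since p is irreducible of
    positive degree, a is a unit, so p itself divides q.\<close>
  have cancel: "p dvd q" if "c \<in> A" "c \<noteq> 0" "t \<in> pol" "p * t = smult c q" for c t q
  proof -
    from that p obtain a b p' t' where *: "a \<in> A" "p' \<in> pol" "p = smult a p'" "p' * t' = q"
      by (metis const_cancel)
    have "p = [:a:] * p'" using * by simp
    with irr[of "[:a:]" p'] * have "[:a:] dvd 1 \<or> p' dvd 1"
      using pol_const by blast
    moreover have "\<not> p' dvd 1"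
      using p * by (auto simp: is_unit_poly_iff split: if_splits)
    ultimately obtain a' where "a * a' = 1"
      by (metis dvdE is_unit_const_poly_iff)
    with * have "p' = smult a' p"
      by (simp add: mult.commute)
    with * show ?thesis
      by (metis dvd_mult2 dvd_refl dvd_smult)
  qed
  define I where "I = {u * p + w * f |u w. u \<in> pol \<and> w \<in> pol}"
  have I_pol: "I \<subseteq> pol"
    using p fg by (auto simp: I_def intro!: pol_add pol_mult)
  have I_diff: "q - r \<in> I" if "q \<in> I" "r \<in> I" for q r
  proof -
    from that obtain u w u' w' where "u \<in> pol" "w \<in> pol" "u' \<in> pol" "w' \<in> pol"
        "q = u * p + w * f" "r = u' * p + w' * f"
      by (auto simp: I_def)
    moreover from this have "q - r = (u - u') * p + (w - w') * f"
      by (simp add: algebra_simps)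
    ultimately show ?thesis
      unfolding I_def using pol_diff by blast
  qed
  have I_mult: "s * q \<in> I" if "q \<in> I" "s \<in> pol" for q s
  proof -
    from that obtain u w where "u \<in> pol" "w \<in> pol" "q = u * p + w * f"
      by (auto simp: I_def)
    moreover from this have "s * q = (s * u) * p + (s * w) * f"
      by (simp add: algebra_simps)
    ultimately show ?thesis
      unfolding I_def using pol_mult that by blast
  qed
  have "p = 1 * p + 0 * f" "f = 0 * p + 1 * f" by simp_all
  then have "p \<in> I" "f \<in> I"
    unfolding I_def using pol_0 pol_1 by blast+
  obtain h where h: "h \<in> I" "h \<noteq> 0" and min: "\<And>q. q \<in> I \<Longrightarrow> q \<noteq> 0 \<Longrightarrow> degree h \<le> degree q"
    using ex_has_least_nat[of "\<lambda>q. q \<in> I \<and> q \<noteq> 0" p degree] \<open>p \<in> I\<close> p0 by blast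
  have hp: "h \<in> pol" using h I_pol by blast
  have pseudo: "\<exists>c s. c \<in> A \<and> c \<noteq> 0 \<and> s \<in> pol \<and> h * s = smult c q" if "q \<in> I" for q
    using that
  proof (induction "degree q" arbitrary: q rule: less_induct)
    case less
    show ?case
    proof (cases "q = 0")
      case True
      then show ?thesis
        by (intro exI[of _ 1] exI[of _ 0]) (simp add: one_closed pol_0)
    next
      case False
      then have le: "degree h \<le> degree q"
        using min less.prems by blast
      define k where "k = monom (lead_coeff q) (degree q - degree h)"
      \<comment> \<open>One step of pseudo-division: multiplying q by the leading coefficient of h
        makes the leading terms cancel without any division of coefficients.\<close>
      define q' where "q' = [:lead_coeff h:] * q - k * h"
      have lc: "lead_coeff h \<in> A" "lead_coeff q \<in> A"
        using hp less.prems I_pol by (auto simp: pol_def)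
      then have kp: "k \<in> pol" by (simp add: k_def pol_monom)
      have q'I: "q' \<in> I"
        unfolding q'_def by (intro I_diff I_mult) (use less.prems h lc kp pol_const in auto)
      have q': "q' = 0 \<or> degree q' < degree q"
      proof -
        have "degree (k * h) \<le> degree q"
          using le degree_mult_le[of k h] degree_monom_le[of "lead_coeff q" "degree q - degree h"]
          unfolding k_def by linarith
        moreover have "coeff (k * h) (degree q) = lead_coeff q * lead_coeff h"
          using le by (simp add: k_def coeff_monom_mult)
        ultimately show ?thesis
          unfolding q'_def
          by (intro eq_zero_or_degree_less degree_diff_le) (auto simp: mult.commute)
      qed
      have "\<exists>c s. c \<in> A \<and> c \<noteq> 0 \<and> s \<in> pol \<and> h * s = smult c q'"
      proof (cases "q' = 0")
        case True
        then show ?thesis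
          by (intro exI[of _ 1] exI[of _ 0]) (simp add: one_closed pol_0)
      next
        case False
        with q' less.hyps q'I show ?thesis by blast
      qed
      then obtain c s where cs: "c \<in> A" "c \<noteq> 0" "s \<in> pol" "h * s = smult c q'" by blast
      then have "h * (s + smult c k) = smult (c * lead_coeff h) q"
        by (simp add: q'_def algebra_simps smult_diff_right)
      moreover have "c * lead_coeff h \<in> A" "c * lead_coeff h \<noteq> 0" "s + smult c k \<in> pol"
        using cs lc h kp by (auto intro: mult_closed pol_add pol_smult)
      ultimately show ?thesis by blast
    qed
  qed
  obtain c s where cs: "c \<in> A" "c \<noteq> 0" "s \<in> pol" "h * s = smult c p"
    using pseudo \<open>p \<in> I\<close> by blast
  obtain c' s' where cs': "c' \<in> A" "c' \<noteq> 0" "s' \<in> pol" "h * s' = smult c' f"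
    using pseudo \<open>f \<in> I\<close> by blast
  obtain a b h1 s1 where hs: "a \<in> A" "a \<noteq> 0" "h1 \<in> pol" "s1 \<in> pol" "h = smult a h1" "h1 * s1 = p"
    using const_cancel[OF cs(1,2) hp cs(3,4)] by metis
  then consider "s1 dvd 1" | "h1 dvd 1"
    using irr[of h1 s1] by auto
  then show False
  proof cases
    case 1
    then obtain e where e: "e dvd 1" "s1 = [:e:]"
      by (auto simp: is_unit_poly_iff)
    then obtain e' where e': "e * e' = 1" by (metis dvdE)
    then have "e' \<in> A" by (rule unit_inverse_closed)
    have "h1 = smult e' p"
      using hs(6) e e' by (simp add: mult.commute flip: hs(6))
    \<comment> \<open>Here h is p up to a constant, so pseudo-division of f by h exhibits a constant
      multiple of f as a multiple of p.\<close>
    then have "p * (smult (a * e') s') = smult c' f"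
      using cs'(4) hs(5) by (simp add: mult.commute)
    moreover have "smult (a * e') s' \<in> pol"
      using hs(1) \<open>e' \<in> A\<close> cs'(3) by (intro pol_smult mult_closed)
    ultimately have "p dvd f"
      using cancel cs' by blast
    with neg show False by blast
  next
    case 2
    then obtain e where e: "e dvd 1" "h1 = [:e:]"
      by (auto simp: is_unit_poly_iff)
    define d where "d = a * e"
    have "e \<in> A" using hs(3) e(2) by (auto simp: pol_def dest: spec[of _ 0])
    have d: "d \<in> A" "d \<noteq> 0"
      using hs e \<open>e \<in> A\<close> by (auto simp: d_def intro: mult_closed)
    obtain u w where uw: "u \<in> pol" "w \<in> pol" "[:d:] = u * p + w * f"
      using h(1) hs(5) e(2) by (auto simp: I_def d_def)
    \<comment> \<open>Here the ideal contains the nonzero constant d = u p + w f; multiplying by g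
      turns w f g into w p y.\<close>
    have "smult d g = [:d:] * g" by simp
    also have "\<dots> = p * (u * g + w * y)"
      using fg(4) unfolding uw(3) by (simp add: algebra_simps)
    finally have "p * (u * g + w * y) = smult d g" ..
    moreover have "u * g + w * y \<in> pol"
      using uw fg by (intro pol_add pol_mult)
    ultimately have "p dvd g"
      using cancel d by blast
    with neg show False by blast
  qed
qed

end

text \<open>Under \<open>as_poly v\<close>, adding the variable v means passing to polynomials over
  the previous ring. An irreducible of degree 0 in x_v is treated by \<open>const_prime\<close>, one
  of positive degree by \<open>poly_prime\<close>.\<close>

lemma factorial_subring_polys:
  assumes "finite V"
  shows "factorial_subring (polys V :: ('v::linorder, 'a::field) mpoly set)"
  using assms
proof (induction V)
  case empty
  \<comment> \<open>Without variables only constants remain, and no constant is irreducible.\<close>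
  have "total_deg p = 0" if "p \<in> polys {}" for p :: "('v, 'a) mpoly"
  proof -
    have "mon_deg m = 0" if "m \<in> Poly_Mapping.keys p" for m
      using \<open>p \<in> polys {}\<close> that by (auto simp: polys_def)
    then have "insert 0 (mon_deg ` Poly_Mapping.keys p) = {0}" by auto
    then show ?thesis
      unfolding total_deg_def by (simp only: Max_singleton)
  qed
  then have "\<not> irreducible p" if "p \<in> polys {}" for p :: "('v, 'a) mpoly"
    using that unit_iff_total_deg[of p] by (auto simp: irreducible_def)
  then show ?case
    by unfold_locales
       (auto intro: polys_intros dest: polys_divisor_closed(1) irreducible_factorization)
next
  case (insert v V)
  let ?B = "polys (insert v V) :: ('v, 'a) mpoly set"
  interpret A: factorial_subring "polys V :: ('v, 'a) mpoly set" by (rule insert.IH)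
  have pol: "as_poly v p \<in> A.pol" if "p \<in> ?B" for p
    using coeff_as_poly_polys[OF that, of v] insert.hyps by (simp add: A.pol_def)
  have as_poly_inv: "as_poly v (poly q (X v)) = q" if "q \<in> A.pol" for q
    using that insert.hyps by (intro as_poly_poly[of q V]) (auto simp: A.pol_def)
  have "p dvd f \<or> p dvd g"
    if p: "p \<in> ?B" "irreducible p" and fg: "f \<in> ?B" "g \<in> ?B" "p dvd f * g" for p f g
  proof (cases "f * g = 0")
    case True
    then show ?thesis by auto
  next
    case False
    from fg obtain y where y: "f * g = p * y" by (auto elim: dvdE)
    then have "y \<in> ?B"
      using False polys_divisor_closed(2) polys_mult[OF fg(1,2)] by metis
    have transfer: "as_poly v p dvd as_poly v q \<Longrightarrow> p dvd q" for q
      by (metis dvdE dvdI poly_as_poly poly_mult)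
    have "as_poly v p dvd as_poly v f \<or> as_poly v p dvd as_poly v g"
    proof (cases "degree (as_poly v p) = 0")
      case True
      then obtain a where a: "as_poly v p = [:a:]"
        by (rule degree_eq_zeroE)
      then have "p = a"
        using poly_as_poly[of v p] by simp
      with a pol[OF p(1)] have "p \<in> polys V" "as_poly v p = [:p:]"
        by (auto simp: A.pol_def dest: spec[of _ 0])
      moreover have "[:p:] dvd as_poly v f * as_poly v g"
        using \<open>as_poly v p = [:p:]\<close> y by (metis as_poly_mult dvd_triv_left)
      ultimately show ?thesis
        using A.const_prime p(2) pol fg by metis
    next
      case False
      show ?thesis
      proof (rule A.poly_prime)
        fix a b assume ab: "a \<in> A.pol" "b \<in> A.pol" "as_poly v p = a * b"
        have "p = poly a (X v) * poly b (X v)"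
          by (metis ab(3) poly_as_poly poly_mult)
        with p(2) have "poly a (X v) dvd 1 \<or> poly b (X v) dvd 1"
          by (rule irreducibleD)
        moreover have "q dvd 1" if "poly q (X v) dvd 1" "q \<in> A.pol" for q
          using that as_poly_inv[of q] by (metis as_poly_1 as_poly_mult dvd_def)
        ultimately show "a dvd 1 \<or> b dvd 1"
          using ab by blast
      next
        show "as_poly v f * as_poly v g = as_poly v p * as_poly v y"
          using y by (simp flip: as_poly_mult)
      qed (use False pol p fg \<open>y \<in> ?B\<close> in auto)
    qed
    then show ?thesis
      using transfer by blast
  qed
  then show ?case
    by unfold_locales
       (auto intro: polys_intros dest: polys_divisor_closed(1) irreducible_factorization)
qed

section \<open>Primes, coprimality and squarefree polynomials\<close>

definition vars :: "('v, 'a::zero) mpoly \<Rightarrow> 'v set" where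
  "vars p = (\<Union>m \<in> Poly_Mapping.keys p. Poly_Mapping.keys m)"

lemma finite_vars [simp]: "finite (vars p)"
  by (simp add: vars_def)

lemma polys_iff_vars: "p \<in> polys V \<longleftrightarrow> vars p \<subseteq> V"
  by (auto simp: polys_def vars_def)

text \<open>Only finitely many variables occur in p, a and b, so the question lives in a subring
  with finitely many variables.\<close>

theorem irreducible_imp_prime_elem_mpoly:
  fixes p :: "('v::linorder, 'a::field) mpoly"
  assumes "irreducible p"
  shows "prime_elem p"
proof (rule prime_elemI)
  show "p \<noteq> 0" "\<not> p dvd 1"
    using assms by (auto simp: irreducible_def)
  fix a b assume dvd: "p dvd a * b"
  let ?V = "vars p \<union> vars a \<union> vars b"
  interpret factorial_subring "polys ?V :: ('v, 'a) mpoly set"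
    by (rule factorial_subring_polys) simp
  show "p dvd a \<or> p dvd b"
    by (rule irreducible_prime) (use assms dvd in \<open>auto simp: polys_iff_vars\<close>)
qed

lemma prime_factorization_mpoly:
  fixes p :: "('v::linorder, 'a::field) mpoly"
  assumes "p \<noteq> 0" and "\<not> p dvd 1"
  obtains ps where "\<forall>q\<in>set ps. prime_elem q" "prod_list ps = p"
  using irreducible_factorization[OF assms] irreducible_imp_prime_elem_mpoly by blast

lemma prime_divisor_mpoly:
  fixes p :: "('v::linorder, 'a::field) mpoly"
  assumes "\<not> p dvd 1"
  obtains q where "prime_elem q" "q dvd p"
proof (cases "p = 0")
  case True
  \<comment> \<open>Every prime divides 0; any variable provides one.\<close>
  obtain v :: 'v where True by blast
  have "prime_elem (X v :: ('v, 'a) mpoly)"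
    by (rule irreducible_imp_prime_elem_mpoly[OF irreducible_X])
  with True that show ?thesis by simp
next
  case False
  then obtain ps where ps: "\<forall>q\<in>set ps. prime_elem q" "prod_list ps = p"
    using prime_factorization_mpoly assms by metis
  with assms obtain q where "q \<in> set ps" by (cases ps) auto
  with ps that show ?thesis
    using prod_list_dvd by blast
qed

text \<open>Coprimality of G and H is expressed by the absence of a common prime. The prime factors
  of G, none of which divides H, are cancelled from w one at a time.\<close>

lemma no_common_prime_dvd_mult:
  fixes G H w :: "('v::linorder, 'a::field) mpoly"
  assumes "\<And>p. prime_elem p \<Longrightarrow> p dvd G \<Longrightarrow> \<not> p dvd H" and "G dvd H * w" and "G \<noteq> 0"
  shows "G dvd w"
proof (cases "G dvd 1")
  case False
  then obtain ps where ps: "\<forall>q\<in>set ps. prime_elem q" "prod_list ps = G"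
    using prime_factorization_mpoly \<open>G \<noteq> 0\<close> by metis
  then have "\<forall>q\<in>set ps. prime_elem q \<and> \<not> q dvd H"
    using assms(1) prod_list_dvd by blast
  moreover have "prod_list ps dvd H * w"
    using ps assms by simp
  ultimately have "prod_list ps dvd w"
  proof (induction ps arbitrary: w)
    case (Cons p ps)
    have "p dvd H * w"
      using Cons.prems(2) by (metis dvd_mult_left prod_list.Cons)
    with Cons.prems(1) obtain w' where w': "w = p * w'"
      by (metis dvdE list.set_intros(1) prime_elem_dvd_mult_iff)
    have "p \<noteq> 0"
      using Cons.prems(1) by auto
    with Cons.prems(2) have "prod_list ps dvd H * w'"
      by (simp add: w' mult.left_commute[of H])
    then have "prod_list ps dvd w'"
      by (rule Cons.IH[rotated]) (use Cons.prems(1) in simp)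
    then show ?case
      by (simp add: w' mult_dvd_mono)
  qed simp
  with ps show ?thesis by simp
qed (metis dvd_trans one_dvd)

lemma squarefree_no_common_prime:
  fixes G H :: "('v::linorder, 'a::field) mpoly"
  assumes "squarefree (G * H)" and "prime_elem p" and "p dvd G"
  shows "\<not> p dvd H"
proof
  assume "p dvd H"
  with assms(3) have "p ^ 2 dvd G * H"
    by (simp add: power2_eq_square mult_dvd_mono)
  with assms show False
    using squarefreeD prime_elem_not_unit by blast
qed

lemma squarefree_dvd_mult:
  fixes G H w :: "('v::linorder, 'a::field) mpoly"
  assumes "squarefree (G * H)" and "G dvd H * w"
  shows "G dvd w"
proof (rule no_common_prime_dvd_mult)
  show "G dvd H * w" by fact
  show "G \<noteq> 0" using assms(1) by auto
qed (use assms(1) squarefree_no_common_prime in blast)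

lemma squarefree_mpolyI:
  fixes f :: "('v::linorder, 'a::field) mpoly"
  assumes "\<And>p. prime_elem p \<Longrightarrow> \<not> p\<^sup>2 dvd f"
  shows "squarefree f"
proof (rule squarefreeI, rule ccontr)
  fix x assume "x\<^sup>2 dvd f" "\<not> x dvd 1"
  then obtain p where "prime_elem p" "p dvd x"
    by (metis prime_divisor_mpoly)
  with \<open>x\<^sup>2 dvd f\<close> assms show False
    by (meson dvd_power_same dvd_trans)
qed

lemma squarefree_irreducible_mpoly:
  fixes q :: "('v::linorder, 'a::field) mpoly"
  assumes "irreducible q"
  shows "squarefree q"
proof (rule squarefree_mpolyI, rule notI)
  fix p assume p: "prime_elem p" "p\<^sup>2 dvd q"
  from p(2) obtain u where "q = p\<^sup>2 * u" ..
  then have "q = p * (p * u)"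
    by (simp add: power2_eq_square mult.assoc)
  with assms have "p dvd 1 \<or> p * u dvd 1"
    by (metis irreducibleD)
  with p show False
    using prime_elem_not_unit dvd_mult_left by blast
qed

text \<open>A prime whose square divides the product divides only one of the two factors, and that
  factor must absorb the whole square.\<close>

lemma squarefree_mult_mpoly:
  fixes G H :: "('v::linorder, 'a::field) mpoly"
  assumes "squarefree G" and "squarefree H"
    and "\<And>p. prime_elem p \<Longrightarrow> p dvd G \<Longrightarrow> \<not> p dvd H"
  shows "squarefree (G * H)"
proof (rule squarefree_mpolyI, rule notI)
  fix p assume p: "prime_elem p" "p\<^sup>2 dvd G * H"
  have nz: "p \<noteq> 0" using p by auto
  have sq: False if "prime_elem p" "p\<^sup>2 dvd G * H" "p dvd G" "squarefree G" "\<not> p dvd H" for G H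
  proof -
    from that(3) obtain u where u: "G = p * u" ..
    with that(2) nz have "p dvd u * H"
      by (simp add: power2_eq_square mult.assoc)
    with that u have "p\<^sup>2 dvd G"
      by (auto simp: prime_elem_dvd_mult_iff power2_eq_square)
    with that show False
      using squarefreeD prime_elem_not_unit by blast
  qed
  have "p dvd G * H"
    using p by (metis dvd_power dvd_trans zero_less_numeral)
  then have "p dvd G \<or> p dvd H"
    using p prime_elem_dvd_mult_iff by blast
  then show False
    using sq[of G H] sq[of H G] p assms by (auto simp: mult.commute)
qed

lemma prime_elem_dvd_prod:
  fixes f :: "'i \<Rightarrow> 'r::comm_semiring_1"
  assumes "prime_elem p" and "p dvd prod f I"
  shows "\<exists>i\<in>I. p dvd f i"
  using assms(2)
  by (induction I rule: infinite_finite_induct)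
     (use assms(1) in \<open>auto simp: prime_elem_dvd_mult_iff dest: prime_elem_not_unit\<close>)

lemma squarefree_prod_mpoly:
  fixes f :: "'i \<Rightarrow> ('v::linorder, 'a::field) mpoly"
  assumes "finite I" and "\<And>i. i \<in> I \<Longrightarrow> squarefree (f i)"
    and "\<And>i j p. i \<in> I \<Longrightarrow> j \<in> I \<Longrightarrow> i \<noteq> j \<Longrightarrow> prime_elem p \<Longrightarrow> p dvd f i \<Longrightarrow> \<not> p dvd f j"
  shows "squarefree (prod f I)"
  using assms
proof (induction I)
  case (insert i I)
  have "\<not> p dvd prod f I" if "prime_elem p" "p dvd f i" for p
    using insert.hyps insert.prems(2)[of i _ p] that prime_elem_dvd_prod[of p f I] by blast
  moreover have "squarefree (f i)" "squarefree (prod f I)"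
    using insert by auto
  ultimately show ?case
    using insert.hyps squarefree_mult_mpoly[of "f i" "prod f I"] by simp
qed (auto simp: squarefree_def power2_eq_square dest: dvd_mult_left)

text \<open>Squarefreeness of the product makes each factor coprime to the product of the others, so
  the factors can be divided out of w in turn.\<close>

lemma prod_dvd_of_dvd:
  fixes f :: "'i \<Rightarrow> ('v::linorder, 'a::field) mpoly"
  assumes "finite I" and "squarefree (prod f I)" and "\<And>i. i \<in> I \<Longrightarrow> f i dvd w"
  shows "prod f I dvd w"
  using assms
proof (induction I)
  case (insert i I)
  have sq: "squarefree (f i * prod f I)"
    using insert.prems insert.hyps by simp
  then have "squarefree (prod f I)"
    by (meson dvd_triv_right squarefree_mono)
  with insert obtain u where u: "w = prod f I * u"
    by (metis dvdE insertCI)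
  with insert.prems have "f i dvd prod f I * u" by auto
  with sq have "f i dvd u" by (rule squarefree_dvd_mult)
  with u insert.hyps show ?case
    by (simp add: mult.commute[of "f i"])
qed simp

section \<open>Homogenization and derivations\<close>

lemma homogeneous_0 [simp]: "homogeneous d 0"
  and homogeneous_X: "homogeneous 1 (X v :: ('v, 'a::zero_neq_one) mpoly)"
  and homogeneous_Const: "homogeneous 0 (Const a)"
  by (simp_all add: homogeneous_def X_def Const_def)

lemma homogeneous_1: "homogeneous 0 (1 :: ('v, 'a::comm_ring_1) mpoly)"
  unfolding Const_1[symmetric] by (rule homogeneous_Const)

lemma homogeneous_add: "homogeneous d p \<Longrightarrow> homogeneous d q \<Longrightarrow> homogeneous d (p + q)"
  using keys_add[of p q] by (auto simp: homogeneous_def)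

lemma homogeneous_mult:
  fixes p q :: "('v, 'a::comm_ring_1) mpoly"
  assumes "homogeneous d p" and "homogeneous e q"
  shows "homogeneous (d + e) (p * q)"
  using keys_mult[of p q] assms by (fastforce simp: homogeneous_def mon_deg_add)

lemma homogeneous_uminus: "homogeneous d p \<Longrightarrow> homogeneous d (- p)" for p :: "('v, 'a::comm_ring_1) mpoly"
  by (simp add: homogeneous_def in_keys_iff)

lemma homogeneous_diff: "homogeneous d p \<Longrightarrow> homogeneous d q \<Longrightarrow> homogeneous d (p - q)"
  for p :: "('v, 'a::comm_ring_1) mpoly"
  using homogeneous_add[OF _ homogeneous_uminus] by fastforce

lemma homogeneous_Const_mult:
  fixes p :: "('v, 'a::comm_ring_1) mpoly"
  shows "homogeneous d p \<Longrightarrow> homogeneous d (Const a * p)"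
  using homogeneous_mult[OF homogeneous_Const] by fastforce

lemma homogeneous_power: "homogeneous d p \<Longrightarrow> homogeneous (k * d) (p ^ k)"
  for p :: "('v, 'a::comm_ring_1) mpoly"
  by (induction k) (auto simp: homogeneous_1 intro: homogeneous_mult)

lemma homogeneous_sum: "(\<And>i. i \<in> A \<Longrightarrow> homogeneous d (f i)) \<Longrightarrow> homogeneous d (sum f A)"
  by (induction A rule: infinite_finite_induct) (auto intro: homogeneous_add)

lemma homogeneous_prod:
  fixes f :: "_ \<Rightarrow> ('v, 'a::comm_ring_1) mpoly"
  shows "(\<And>i. i \<in> A \<Longrightarrow> homogeneous (d i) (f i)) \<Longrightarrow> homogeneous (sum d A) (prod f A)"
  by (induction A rule: infinite_finite_induct) (auto simp: homogeneous_1 intro: homogeneous_mult)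

lemma homogeneous_X_power: "homogeneous k (X v ^ k :: ('v, 'a::comm_ring_1) mpoly)"
  using homogeneous_power[OF homogeneous_X] by simp

lemma grading_homogeneous:
  assumes "homogeneous d p"
  shows "grading p = monom p d"
proof (rule poly_eqI, rule poly_mapping_eqI)
  fix k m
  show "Poly_Mapping.lookup (coeff (grading p) k) m = Poly_Mapping.lookup (coeff (monom p d) k) m"
    using assms by (auto simp: lookup_coeff_grading homogeneous_def in_keys_iff)
qed

lemma total_deg_homogeneous:
  fixes p :: "('v, 'a::comm_ring_1) mpoly"
  assumes "homogeneous d p" and "p \<noteq> 0"
  shows "total_deg p = d"
  using assms(2) by (simp add: grading_homogeneous[OF assms(1)] degree_monom_eq flip: degree_grading)

lemma poly_eq_sum_le:
  fixes p :: "'a::comm_semiring_1 poly"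
  assumes "degree p \<le> n"
  shows "poly p x = (\<Sum>i\<le>n. coeff p i * x ^ i)"
  unfolding poly_altdef
  by (rule sum.mono_neutral_left) (use assms in \<open>auto simp: coeff_eq_0\<close>)

text \<open>The component of degree k is multiplied by z^(d - k), where d is the total degree; this
  reverses the coefficient list of the grading. Multiplicativity of homogenization is then that of
  \<open>reflect_poly\<close>.\<close>

lemma homogenize_eq_reflect:
  fixes p :: "('v, 'a::comm_ring_1) mpoly"
  shows "homogenize z p = poly (reflect_poly (grading p)) (X z)"
proof -
  have X: "X z ^ k = Poly_Mapping.single (Poly_Mapping.single z k) (1::'a)" for k
    using single_eq_mon_val[of "Poly_Mapping.single z k" "1::'a"] by simp
  have eq: "grading p = (\<Sum>m\<in>Poly_Mapping.keys p. monom (Poly_Mapping.single m (Poly_Mapping.lookup p m)) (mon_deg m))"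
    by (simp add: grading_def msubst_def mon_val_monom_X single_eq_mon_val smult_monom del: One_nat_def)
  have "poly (reflect_poly (grading p)) (X z) = (\<Sum>i\<le>total_deg p. coeff (reflect_poly (grading p)) i * X z ^ i)"
    by (rule poly_eq_sum_le) (use degree_reflect_poly_le[of "grading p"] in \<open>simp add: degree_grading\<close>)
  also have "\<dots> = (\<Sum>i\<le>total_deg p. \<Sum>m\<in>Poly_Mapping.keys p.
      if total_deg p - mon_deg m = i then Poly_Mapping.single m (Poly_Mapping.lookup p m) * X z ^ i else 0)"
  proof (rule sum.cong, rule refl)
    fix i assume i: "i \<in> {..total_deg p}"
    have "coeff (reflect_poly (grading p)) i =
        (\<Sum>m\<in>Poly_Mapping.keys p. if mon_deg m = total_deg p - i then Poly_Mapping.single m (Poly_Mapping.lookup p m) else 0)"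
      using i by (simp add: coeff_reflect_poly degree_grading) (simp add: eq coeff_sum)
    also have "\<dots> = (\<Sum>m\<in>Poly_Mapping.keys p. if total_deg p - mon_deg m = i then Poly_Mapping.single m (Poly_Mapping.lookup p m) else 0)"
      using mon_deg_le_total_deg[of _ p] i by (intro sum.cong) fastforce+
    finally show "coeff (reflect_poly (grading p)) i * X z ^ i = (\<Sum>m\<in>Poly_Mapping.keys p.
      if total_deg p - mon_deg m = i then Poly_Mapping.single m (Poly_Mapping.lookup p m) * X z ^ i else 0)"
      by (simp add: sum_distrib_right if_distrib[of "\<lambda>q. q * _"] cong: if_cong)
  qed
  also have "\<dots> = (\<Sum>m\<in>Poly_Mapping.keys p. Poly_Mapping.single m (Poly_Mapping.lookup p m) * X z ^ (total_deg p - mon_deg m))"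
    by (subst sum.swap) simp
  also have "\<dots> = homogenize z p"
    unfolding homogenize_def by (simp add: X mult_single)
  finally show ?thesis ..
qed

lemma homogenize_mult:
  fixes p q :: "('v::linorder, 'a::idom) mpoly"
  shows "homogenize z (p * q) = homogenize z p * homogenize z q"
  by (simp add: homogenize_eq_reflect grading_mult reflect_poly_mult)

text \<open>Several summands may share a degree. The hypothesis on the total degree fixes the power
  of z, which would drop if the terms of top degree cancelled.\<close>

lemma homogenize_sum_homogeneous:
  fixes f :: "_ \<Rightarrow> ('v, 'a::comm_ring_1) mpoly"
  assumes "finite A" and "\<And>i. i \<in> A \<Longrightarrow> homogeneous (d i) (f i)"
    and "\<And>i. i \<in> A \<Longrightarrow> d i \<le> D" and "total_deg (sum f A) = D"
  shows "homogenize z (sum f A) = (\<Sum>i\<in>A. X z ^ (D - d i) * f i)"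
proof -
  have gr: "grading (sum f A) = (\<Sum>i\<in>A. monom (f i) (d i))"
    unfolding grading_sum by (intro sum.cong refl grading_homogeneous assms(2))
  have "homogenize z (sum f A) = (\<Sum>k\<le>D. coeff (reflect_poly (grading (sum f A))) k * X z ^ k)"
    unfolding homogenize_eq_reflect
    by (rule poly_eq_sum_le) (use degree_reflect_poly_le[of "grading (sum f A)"] assms in \<open>simp add: degree_grading\<close>)
  also have "\<dots> = (\<Sum>k\<le>D. \<Sum>i\<in>A. if D - d i = k then X z ^ k * f i else 0)"
  proof (rule sum.cong, rule refl)
    fix k assume k: "k \<in> {..D}"
    have "coeff (reflect_poly (grading (sum f A))) k = (\<Sum>i\<in>A. if d i = D - k then f i else 0)"
      using k by (simp add: coeff_reflect_poly degree_grading assms(4)) (simp add: gr coeff_sum)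
    also have "\<dots> = (\<Sum>i\<in>A. if D - d i = k then f i else 0)"
      using assms(3) k by (intro sum.cong) fastforce+
    finally show "coeff (reflect_poly (grading (sum f A))) k * X z ^ k =
        (\<Sum>i\<in>A. if D - d i = k then X z ^ k * f i else 0)"
      by (simp only: sum_distrib_right) (rule sum.cong, auto simp: mult.commute)
  qed
  also have "\<dots> = (\<Sum>i\<in>A. X z ^ (D - d i) * f i)"
    by (subst sum.swap) simp
  finally show ?thesis .
qed

lemma total_deg_sum_homogeneous:
  fixes f :: "_ \<Rightarrow> ('v, 'a::comm_ring_1) mpoly"
  assumes "finite A" and "\<And>i. i \<in> A \<Longrightarrow> homogeneous (d i) (f i)"
    and "\<And>i. i \<in> A \<Longrightarrow> d i \<le> D" and "(\<Sum>i | i \<in> A \<and> d i = D. f i) \<noteq> 0"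
  shows "total_deg (sum f A) = D"
proof -
  have gr: "grading (sum f A) = (\<Sum>i\<in>A. monom (f i) (d i))"
    unfolding grading_sum by (intro sum.cong refl grading_homogeneous assms(2))
  have "degree (grading (sum f A)) \<le> D"
    unfolding gr by (intro degree_sum_le) (use assms in \<open>auto intro: order_trans[OF degree_monom_le]\<close>)
  moreover have "coeff (grading (sum f A)) D = (\<Sum>i | i \<in> A \<and> d i = D. f i)"
    using assms(1) by (simp add: gr coeff_sum sum.inter_filter)
  with assms(4) have "D \<le> degree (grading (sum f A))"
    by (intro le_degree) simp
  ultimately show ?thesis
    by (simp add: degree_grading)
qed

text \<open>The derivation with prescribed values \<open>a v\<close> on the variables is the linear coefficient in
  \<open>t\<close> of the substitution \<open>x\<^sub>v \<mapsto> x\<^sub>v + t a\<^sub>v\<close>.\<close>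

definition derv :: "('v \<Rightarrow> ('v, 'a::comm_ring_1) mpoly) \<Rightarrow> ('v, 'a) mpoly \<Rightarrow> ('v, 'a) mpoly" where
  "derv a p = coeff (msubst (\<lambda>c. [:Const c:]) (\<lambda>v. [:X v, a v:]) p) 1"

lemma derv_add: "derv a (p + q) = derv a p + derv a q"
  and derv_Const [simp]: "derv a (Const c) = 0"
  and derv_X [simp]: "derv a (X v) = a v"
  and derv_0 [simp]: "derv a 0 = 0"
  by (simp_all add: derv_def pConst_hom.msubst_simps)

lemma derv_mult: "derv a (p * q) = p * derv a q + q * derv a p"
proof -
  \<comment> \<open>At t = 0 the substitution is the identity, so the linear coefficient of a
    product obeys the Leibniz rule.\<close>
  have *: "coeff (msubst (\<lambda>c. [:Const c:]) (\<lambda>v. [:X v, a v:]) p) 0 = p" for p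
  proof -
    have "p \<in> polys UNIV" by simp
    then show ?thesis
      by (induction rule: polys_induct) (simp_all add: pConst_hom.msubst_simps coeff_mult)
  qed
  show ?thesis
    by (simp add: derv_def pConst_hom.msubst_mult coeff_mult *[simplified])
qed

lemma derv_Const_mult: "derv a (Const c * p) = Const c * derv a p"
  by (simp add: derv_mult)

lemma derv_sum: "derv a (sum f A) = (\<Sum>i\<in>A. derv a (f i))"
  by (induction A rule: infinite_finite_induct) (simp_all add: derv_add)

lemma derv_polys:
  assumes "p \<in> polys V" and "\<And>v. v \<in> V \<Longrightarrow> a v \<in> polys V"
  shows "derv a p \<in> polys V"
  using assms(1)
  by (induction rule: polys_induct) (use assms(2) in \<open>auto simp: derv_add derv_mult intro: polys_intros\<close>)

text \<open>The Leibniz rule determines a derivation by its values on constants, which vanish, and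
  on variables. This makes the abstract elements of \<open>Der\<close> computable.\<close>

lemma Der_eq_derv:
  assumes "\<delta> \<in> Der V" and "p \<in> polys V" and "\<And>v. v \<in> V \<Longrightarrow> \<delta> (X v) = a v"
  shows "\<delta> p = derv a p"
proof -
  have mult: "\<And>p q. p \<in> polys V \<Longrightarrow> q \<in> polys V \<Longrightarrow> \<delta> (p * q) = p * \<delta> q + q * \<delta> p"
    and add: "\<And>p q. p \<in> polys V \<Longrightarrow> q \<in> polys V \<Longrightarrow> \<delta> (p + q) = \<delta> p + \<delta> q"
    and cmult: "\<And>c p. p \<in> polys V \<Longrightarrow> \<delta> (Const c * p) = Const c * \<delta> p"
    using assms(1) by (auto simp: Der_def)
  have "\<delta> 1 = 0"
    using mult[of 1 1] by simp
  then have "\<delta> (Const c) = 0" for c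
    using cmult[of 1 c] by simp
  with assms(2) show ?thesis
    by (induction rule: polys_induct) (simp_all add: assms(3) mult add derv_mult derv_add)
qed

lemma derv_in_Der:
  assumes "\<And>v. v \<in> V \<Longrightarrow> a v \<in> polys V"
  shows "restrict (derv a) (polys V) \<in> Der V"
  using assms
  by (auto simp: Der_def derv_add derv_mult derv_polys polys_add polys_mult intro!: restrict_PiE_iff[THEN iffD2])

lemma derv_linear:
  assumes "p \<in> polys V" and "\<And>v. v \<in> V \<Longrightarrow> a v = (\<Sum>j\<in>J. c j * b j v)"
  shows "derv a p = (\<Sum>j\<in>J. c j * derv (b j) p)"
  using assms(1)
  by (induction rule: polys_induct)
     (simp_all add: assms(2) derv_add derv_mult sum.distrib sum_distrib_left algebra_simps)

text \<open>Logarithmic derivatives add up over a product; \<open>l i\<close> is that of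
  \<open>f i\<close>.\<close>

lemma derv_eigen_prod:
  assumes "\<And>i. i \<in> A \<Longrightarrow> derv a (f i) = l i * f i"
  shows "derv a (prod f A) = sum l A * prod f A"
  using assms
proof (induction A rule: infinite_finite_induct)
  case (insert i A)
  then show ?case by (simp add: derv_mult algebra_simps)
qed (simp_all flip: Const_1 del: Const_1)

lemma derv_eigen_power: "derv a p = l * p \<Longrightarrow> derv a (p ^ k) = of_nat k * l * p ^ k"
  using derv_eigen_prod[of "{..<k}" a "\<lambda>_. p" "\<lambda>_. l"] by simp

section \<open>Sums of almost full monomials\<close>

lemma prime_elem_X: "prime_elem (X v :: ('v::linorder, 'a::field) mpoly)"
  by (rule irreducible_imp_prime_elem_mpoly[OF irreducible_X])

lemma prime_dvd_irreducible:
  fixes p q :: "'r::comm_semiring_1"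
  assumes "prime_elem p" and "irreducible q" and "p dvd q"
  shows "q dvd p"
proof -
  from assms(3) obtain u where u: "q = p * u" ..
  with assms have "u dvd 1"
    using irreducibleD[OF assms(2) u] prime_elem_not_unit by blast
  then obtain w where "1 = u * w" ..
  with u have "q * w = p"
    by (metis mult.assoc mult.right_neutral)
  then show ?thesis
    by (metis dvd_triv_left)
qed

lemma prime_dvd_X:
  fixes p :: "('v::linorder, 'a::field) mpoly"
  shows "prime_elem p \<Longrightarrow> p dvd X v \<Longrightarrow> X v dvd p"
  using prime_dvd_irreducible irreducible_X by blast

lemma prime_dvd_X_power_prod:
  fixes p :: "('v::linorder, 'a::field) mpoly"
  assumes "prime_elem p" and "p dvd (\<Prod>j\<in>A. X j ^ e j)"
  obtains j where "j \<in> A" "X j dvd p"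
proof -
  obtain j where "j \<in> A" "p dvd X j ^ e j"
    using prime_elem_dvd_prod[OF assms] by blast
  then have "p dvd X j"
    using assms(1) prime_elem_dvd_power by blast
  with \<open>j \<in> A\<close> assms(1) that show ?thesis
    using prime_dvd_X by blast
qed

lemma X_dvd_X_iff: "(X v :: ('v::linorder, 'a::field) mpoly) dvd X w \<longleftrightarrow> v = w"
proof
  assume "(X v :: ('v, 'a) mpoly) dvd X w"
  then have "msubst (\<lambda>a. a) (\<lambda>u. if u = v then 0 else 1) (X v :: ('v, 'a) mpoly) dvd
      msubst (\<lambda>a. a) (\<lambda>u. if u = v then 0 else (1::'a)) (X w)"
    by (rule id_hom.msubst_dvd)
  then show "v = w"
    by (simp add: id_hom.msubst_X split: if_splits)
qed simp

lemma prime_power_dvd_cancel: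
  fixes p u w :: "'r::idom"
  assumes "prime_elem p" and "\<not> p dvd u" and "p ^ k dvd u * w"
  shows "p ^ k dvd w"
  using assms(3)
proof (induction k arbitrary: w)
  case (Suc k)
  then have "p dvd u * w"
    by (metis dvd_mult_left power_Suc)
  with assms obtain w' where w': "w = p * w'"
    by (metis dvdE prime_elem_dvd_mult_iff)
  have "p \<noteq> 0" using assms(1) by auto
  with Suc.prems have "p ^ k dvd u * w'"
    by (simp add: w' mult.left_commute[of u])
  then have "p ^ k dvd w'"
    by (rule Suc.IH)
  then show ?case
    by (simp add: w' mult_dvd_mono)
qed simp

lemma derv_dvd_of_square_dvd:
  assumes "p\<^sup>2 dvd f"
  shows "p dvd derv a f"
proof -
  from assms obtain w where "f = p\<^sup>2 * w" ..
  then have "derv a f = p * (p * derv a w + 2 * w * derv a p)"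
    by (simp add: derv_mult power2_eq_square algebra_simps)
  then show ?thesis by simp
qed

locale block =
  fixes z :: nat and r :: "nat \<Rightarrow> nat" and J :: "nat set" and b :: nat
  assumes finite_J: "finite J" and b_in_J: "b \<in> J" and z_notin_J: "z \<notin> J"
    and r_pos: "i \<in> J \<Longrightarrow> r i > 0" and r_min: "i \<in> J \<Longrightarrow> r b \<le> r i"
begin

text \<open>With u_i = (x_z / x_i)^(r i), this is u_i times the Laurent monomial common to the
  block, the product of all x_j^(r j) divided by x_z^(r b). As r b is the least exponent the result
  is a polynomial, and \<open>cof b\<close> is free of x_z.\<close>

definition cof :: "nat \<Rightarrow> (nat, 'a::comm_ring_1) mpoly" where
  "cof i = X z ^ (r i - r b) * (\<Prod>j \<in> J - {i}. X j ^ r j)"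

definition W :: "(nat \<Rightarrow> (nat, 'a::comm_ring_1) mpoly) \<Rightarrow> (nat, 'a) mpoly" where
  "W g = (\<Sum>i\<in>J. g i * cof i)"

lemma W_cong: "(\<And>i. i \<in> J \<Longrightarrow> g i = h i) \<Longrightarrow> W g = W h"
  by (simp add: W_def)

lemma W_add: "W (\<lambda>i. g i + h i) = W g + W h"
  and W_diff: "W (\<lambda>i. g i - h i) = W g - W h"
  and W_mult: "W (\<lambda>i. p * g i) = p * W g"
  by (simp_all add: W_def algebra_simps sum.distrib sum_subtractf sum_distrib_left)

lemma cof_polys: "insert z J \<subseteq> V \<Longrightarrow> cof i \<in> polys V"
  by (auto simp: cof_def intro!: polys_intros)

lemma W_polys: "insert z J \<subseteq> V \<Longrightarrow> (\<And>i. i \<in> J \<Longrightarrow> g i \<in> polys V) \<Longrightarrow> W g \<in> polys V"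
  by (auto simp: W_def intro!: polys_sum polys_mult cof_polys)

lemma homogeneous_cof:
  assumes "i \<in> J"
  shows "homogeneous (sum r J - r b) (cof i :: (nat, 'a::comm_ring_1) mpoly)"
proof -
  have "r i - r b + sum r (J - {i}) = sum r J - r b"
    using assms finite_J r_min[OF assms] by (simp add: sum.remove[of J i])
  moreover have "homogeneous (r i - r b + sum r (J - {i})) (cof i :: (nat, 'a) mpoly)"
    unfolding cof_def by (intro homogeneous_mult homogeneous_X_power homogeneous_prod)
  ultimately show ?thesis by simp
qed

lemma homogeneous_W:
  "(\<And>i. i \<in> J \<Longrightarrow> homogeneous e (g i)) \<Longrightarrow> homogeneous (e + (sum r J - r b)) (W g)"
  unfolding W_def by (intro homogeneous_sum homogeneous_mult homogeneous_cof)

text \<open>Evaluation at a point where x_v vanishes and exactly one cofactor survives gives a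
  nonzero value.\<close>

lemma X_not_dvd_W:
  fixes c :: "nat \<Rightarrow> 'a::field"
  assumes "\<And>i. i \<in> J \<Longrightarrow> c i \<noteq> 0"
  shows "\<not> X v dvd W (\<lambda>i. Const (c i))"
proof
  assume dvd: "X v dvd W (\<lambda>i. Const (c i))"
  \<comment> \<open>For v outside the block the surviving index is b, whose cofactor is free of x_z;
    this covers v = z.\<close>
  define k where "k = (if v \<in> J then v else b)"
  define x :: "nat \<Rightarrow> 'a" where "x u = (if u = v \<or> u = k then 0 else 1)" for u
  let ?e = "msubst (\<lambda>a. a) x"
  have k: "k \<in> J" "r k - r b = 0 \<or> x z \<noteq> 0"
    using b_in_J z_notin_J by (auto simp: k_def x_def)
  have "?e (cof i) = (if i = k then 1 else 0)" if "i \<in> J" for i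
  proof (cases "i = k")
    case True
    have "x j = 1" if "j \<in> J - {k}" for j
      using that by (auto simp: x_def k_def split: if_splits)
    then show ?thesis
      using True k by (auto simp: cof_def id_hom.msubst_simps id_hom.msubst_X x_def k_def z_notin_J)
  next
    case False
    then have "(\<Prod>j \<in> J - {i}. x j ^ r j) = 0"
      using k finite_J r_pos by (auto simp: prod_zero_iff x_def intro!: bexI[of _ k])
    then show ?thesis
      using False by (simp add: cof_def id_hom.msubst_simps id_hom.msubst_X)
  qed
  then have "?e (W (\<lambda>i. Const (c i))) = (\<Sum>i\<in>J. if i = k then c i else 0)"
    unfolding W_def by (auto simp: id_hom.msubst_simps id_hom.msubst_Const intro!: sum.cong)
  also have "\<dots> = c k"
    using k finite_J by simp
  finally have "?e (X v) dvd c k"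
    using id_hom.msubst_dvd[OF dvd] by metis
  then show False
    using assms[OF k(1)] by (simp add: id_hom.msubst_X x_def)
qed

lemma derv_X_power: "derv (\<lambda>v. \<alpha> v * X v) (X j ^ k) = of_nat k * \<alpha> j * X j ^ k"
  by (rule derv_eigen_power) simp

text \<open>The logarithmic derivative splits into a part common to the block and - r i (\<alpha>_i
  - \<alpha>_z), so tangency to a block sum depends on the latter terms only.\<close>

lemma derv_cof:
  fixes \<alpha> :: "nat \<Rightarrow> (nat, 'a::comm_ring_1) mpoly"
  assumes "i \<in> J"
  shows "derv (\<lambda>v. \<alpha> v * X v) (cof i) =
    ((\<Sum>j\<in>J. of_nat (r j) * \<alpha> j) - of_nat (r b) * \<alpha> z - of_nat (r i) * (\<alpha> i - \<alpha> z)) * cof i"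
proof -
  define P :: "(nat, 'a) mpoly" where "P = (\<Prod>j\<in>J - {i}. X j ^ r j)"
  define S where "S = (\<Sum>j\<in>J. of_nat (r j) * \<alpha> j)"
  have "derv (\<lambda>v. \<alpha> v * X v) P = (\<Sum>j\<in>J - {i}. of_nat (r j) * \<alpha> j) * P"
    unfolding P_def by (intro derv_eigen_prod derv_X_power)
  also have "(\<Sum>j\<in>J - {i}. of_nat (r j) * \<alpha> j) = S - of_nat (r i) * \<alpha> i"
    using assms finite_J by (simp add: sum_diff1 S_def)
  finally have P: "derv (\<lambda>v. \<alpha> v * X v) P = (S - of_nat (r i) * \<alpha> i) * P" .
  have k: "(of_nat (r i - r b) :: (nat, 'a) mpoly) = of_nat (r i) - of_nat (r b)"
    using r_min[OF assms] by simp
  show ?thesis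
    unfolding cof_def derv_mult derv_X_power P_def[symmetric] S_def[symmetric] P k
    by (simp add: algebra_simps)
qed

lemma derv_W_Const:
  "derv (\<lambda>v. \<alpha> v * X v) (W (\<lambda>i. Const (c i))) =
    ((\<Sum>j\<in>J. of_nat (r j) * \<alpha> j) - of_nat (r b) * \<alpha> z) * W (\<lambda>i. Const (c i))
      - W (\<lambda>i. Const (c i) * (of_nat (r i) * (\<alpha> i - \<alpha> z)))"
proof -
  have "derv (\<lambda>v. \<alpha> v * X v) (W (\<lambda>i. Const (c i))) =
    (\<Sum>i\<in>J. Const (c i) * derv (\<lambda>v. \<alpha> v * X v) (cof i))"
    by (simp add: W_def derv_sum derv_Const_mult)
  also have "\<dots> = (\<Sum>i\<in>J. ((\<Sum>j\<in>J. of_nat (r j) * \<alpha> j) - of_nat (r b) * \<alpha> z) * (Const (c i) * cof i)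
      - Const (c i) * (of_nat (r i) * (\<alpha> i - \<alpha> z)) * cof i)"
    by (intro sum.cong refl) (simp only: derv_cof, simp add: algebra_simps)
  finally show ?thesis
    by (simp add: W_def sum_subtractf sum_distrib_left)
qed

text \<open>The derivation x_b d/dx_b multiplies all terms but the b-th by one common factor. A
  prime whose square divides the sum therefore divides the nonzero constant c b * r b times the
  monomial \<open>cof b\<close>; so it is a variable up to a unit, but no variable divides the
  sum.\<close>

lemma squarefree_W:
  fixes c :: "nat \<Rightarrow> 'a::field_char_0"
  assumes "\<And>i. i \<in> J \<Longrightarrow> c i \<noteq> 0"
  shows "squarefree (W (\<lambda>i. Const (c i)))"
proof (rule squarefree_mpolyI, rule notI)
  fix p :: "(nat, 'a) mpoly"
  assume p: "prime_elem p" and sq: "p\<^sup>2 dvd W (\<lambda>i. Const (c i))"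
  then have dvd: "p dvd W (\<lambda>i. Const (c i))"
    by (metis dvd_power dvd_trans zero_less_numeral)
  define \<alpha> :: "nat \<Rightarrow> (nat, 'a) mpoly" where "\<alpha> v = (if v = b then 1 else 0)" for v
  have "\<alpha> z = 0"
    using b_in_J z_notin_J by (auto simp: \<alpha>_def)
  then have "W (\<lambda>i. Const (c i) * (of_nat (r i) * (\<alpha> i - \<alpha> z))) =
      (\<Sum>j\<in>J. of_nat (r j) * \<alpha> j) * W (\<lambda>i. Const (c i)) - derv (\<lambda>v. \<alpha> v * X v) (W (\<lambda>i. Const (c i)))"
    unfolding derv_W_Const by (simp add: algebra_simps)
  moreover have "p dvd \<dots>"
    using derv_dvd_of_square_dvd[OF sq] dvd by (intro dvd_diff dvd_mult)
  moreover have "W (\<lambda>i. Const (c i) * (of_nat (r i) * (\<alpha> i - \<alpha> z))) =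
      (\<Sum>i\<in>J. if i = b then Const (c i * of_nat (r i)) * cof i else 0)"
    unfolding W_def by (intro sum.cong refl) (simp add: \<alpha>_def \<open>\<alpha> z = 0\<close>[unfolded \<alpha>_def] Const_mult Const_of_nat)
  ultimately have "p dvd Const (c b * of_nat (r b)) * cof b"
    using b_in_J finite_J by simp
  moreover have "\<not> p dvd Const (c b * of_nat (r b))"
    using p assms[OF b_in_J] r_pos[OF b_in_J] Const_unit[of "c b * of_nat (r b)"] prime_elem_not_unit dvd_trans
    by (metis no_zero_divisors not_gr_zero of_nat_eq_0_iff)
  ultimately have "p dvd cof b"
    using p prime_elem_dvd_mult_iff by blast
  then have "p dvd (\<Prod>j \<in> J - {b}. X j ^ r j)"
    by (simp add: cof_def)
  with p obtain j where "X j dvd p"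
    by (rule prime_dvd_X_power_prod)
  with dvd have "X j dvd W (\<lambda>i. Const (c i))"
    by (rule dvd_trans[rotated])
  with X_not_dvd_W assms show False by blast
qed

lemma cof_times: "i \<in> J \<Longrightarrow> X i ^ r i * cof i = X z ^ (r i - r b) * (\<Prod>j\<in>J. X j ^ r j)"
  using finite_J by (simp add: cof_def prod.remove[of J i] mult_ac)

text \<open>The factor x_i^(r i) completes each cofactor to the same monomial up to a power of x_z,
  so for such coefficients the sum reduces to one linear relation over powers of x_z.\<close>

lemma W_X_power:
  "W (\<lambda>i. \<epsilon> i * X i ^ r i) = (\<Sum>i\<in>J. X z ^ (r i - r b) * \<epsilon> i) * (\<Prod>j\<in>J. X j ^ r j)"
  unfolding W_def sum_distrib_right 
  by (intro sum.cong refl) (simp only: mult.assoc cof_times, simp only: mult_ac)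

text \<open>These are the syzygies of the cofactors: x_i^(r i) divides all cofactors except the
  i-th, which is prime to x_i, so it divides \<open>g i\<close>. What remains is the relation of
  \<open>W_X_power\<close>.\<close>

lemma W_eq_0D:
  fixes g :: "nat \<Rightarrow> (nat, 'a::field) mpoly"
  assumes "W g = 0" and "\<And>i. i \<in> J \<Longrightarrow> g i \<in> polys V"
  obtains \<epsilon> where "\<And>i. i \<in> J \<Longrightarrow> \<epsilon> i \<in> polys V" "\<And>i. i \<in> J \<Longrightarrow> g i = \<epsilon> i * X i ^ r i"
    "(\<Sum>i\<in>J. X z ^ (r i - r b) * \<epsilon> i) = 0"
proof -
  have ex: "\<exists>e. e \<in> polys V \<and> g i = e * X i ^ r i" if i: "i \<in> J" for i
  proof -
    have "g i * cof i = - (\<Sum>k\<in>J - {i}. g k * cof k)"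
      using assms(1) i finite_J by (simp add: W_def sum.remove[of J i] add_eq_0_iff)
    moreover have "X i ^ r i dvd g k * cof k" if "k \<in> J - {i}" for k
    proof -
      have "X i ^ r i dvd (\<Prod>j \<in> J - {k}. X j ^ r j :: (nat, 'a) mpoly)"
        using that i finite_J by (intro dvd_prodI) auto
      then show ?thesis
        by (auto simp: cof_def)
    qed
    then have "X i ^ r i dvd (\<Sum>k\<in>J - {i}. g k * cof k)"
      by (rule dvd_sum)
    ultimately have "X i ^ r i dvd cof i * g i"
      by (simp add: mult.commute)
    moreover have "\<not> X i dvd (cof i :: (nat, 'a) mpoly)"
    proof
      assume "X i dvd (cof i :: (nat, 'a) mpoly)"
      then have "X i dvd (X z ^ (r i - r b) :: (nat, 'a) mpoly) \<or> X i dvd (\<Prod>j \<in> J - {i}. X j ^ r j :: (nat, 'a) mpoly)"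
        unfolding cof_def using prime_elem_X prime_elem_dvd_mult_iff by blast
      then show False
      proof
        assume "X i dvd (X z ^ (r i - r b) :: (nat, 'a) mpoly)"
        then have "i = z"
          using prime_elem_dvd_power[OF prime_elem_X] X_dvd_X_iff by blast
        with i z_notin_J show False by simp
      next
        assume "X i dvd (\<Prod>j \<in> J - {i}. X j ^ r j :: (nat, 'a) mpoly)"
        then obtain j where "j \<in> J - {i}" "X j dvd (X i :: (nat, 'a) mpoly)"
          by (rule prime_dvd_X_power_prod[OF prime_elem_X])
        then show False
          by (simp add: X_dvd_X_iff)
      qed
    qed
    ultimately have "X i ^ r i dvd g i"
      using prime_power_dvd_cancel[OF prime_elem_X] by blast
    then obtain e where e: "g i = e * X i ^ r i"
      by (metis dvdE mult.commute)
    show ?thesis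
    proof (cases "g i = 0")
      case True
      then show ?thesis by (intro exI[of _ 0]) simp
    next
      case False
      then have "e \<in> polys V"
        using e assms(2)[OF i] polys_divisor_closed(1)[of e "X i ^ r i" V] by simp
      with e show ?thesis by blast
    qed
  qed
  then obtain \<epsilon> where \<epsilon>: "\<And>i. i \<in> J \<Longrightarrow> \<epsilon> i \<in> polys V \<and> g i = \<epsilon> i * X i ^ r i"
    by metis
  have "(\<Sum>i\<in>J. X z ^ (r i - r b) * \<epsilon> i) * (\<Prod>j\<in>J. X j ^ r j) = W g"
    unfolding W_X_power[symmetric] by (intro W_cong) (simp add: \<epsilon>)
  with assms(1) finite_J have "(\<Sum>i\<in>J. X z ^ (r i - r b) * \<epsilon> i) = 0"
    by simp
  with that[of \<epsilon>] \<epsilon> show ?thesis by blast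
qed

end

section \<open>The divisor\<close>

locale exponents =
  fixes n m :: nat and r :: "nat \<Rightarrow> nat"
  assumes m_less_n: "m < n" and r_pos: "i \<le> n \<Longrightarrow> r i > 0"
    and r_mono: "i \<le> j \<Longrightarrow> j \<le> n \<Longrightarrow> r i \<le> r j"
begin

text \<open>\<open>lo\<close> and \<open>hi\<close> carry the two block sums, \<open>al\<close> the
  members of the pencil. Monotonicity puts the least exponent of each block at its first
  index.\<close>

sublocale lo: block "n + 1" r "{0..m}" 0
  by unfold_locales (use m_less_n r_pos r_mono in auto)

sublocale hi: block "n + 1" r "{m+1..n}" "m + 1"
  by unfold_locales (use m_less_n r_pos r_mono in auto)

sublocale al: block "n + 1" r "{0..n}" 0
  by unfold_locales (use m_less_n r_pos r_mono in auto)

definition glo :: "(nat, 'a::comm_ring_1) mpoly" where "glo = lo.W (\<lambda>_. 1)"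

definition ghi :: "(nat, 'a::comm_ring_1) mpoly" where "ghi = hi.W (\<lambda>_. 1)"

text \<open>The coordinate b weights the first block because the second generator of the pencil is
  the sum over i \<le> m.\<close>

definition member :: "'a::comm_ring_1 \<Rightarrow> 'a \<Rightarrow> (nat, 'a) mpoly" where
  "member a b = al.W (\<lambda>i. Const (if i \<le> m then b else a))"

text \<open>\<open>phi\<close> and \<open>plo\<close> are the monomials by which the cofactors of
  \<open>al\<close> exceed those of \<open>lo\<close> and \<open>hi\<close>: each collects the
  variables of the other block. The power of x_(n+1) makes up for the different least
  exponents.\<close>

definition plo :: "(nat, 'a::comm_ring_1) mpoly" where
  "plo = X (n+1) ^ (r (m+1) - r 0) * (\<Prod>j\<in>{0..m}. X j ^ r j)"

definition phi :: "(nat, 'a::comm_ring_1) mpoly" where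
  "phi = (\<Prod>j\<in>{m+1..n}. X j ^ r j)"

lemma al_W_split: "al.W g = phi * lo.W g + plo * hi.W g"
proof -
  have lo: "al.cof i = phi * (lo.cof i :: (nat, 'a) mpoly)" if "i \<in> {0..m}" for i
  proof -
    have "{0..n} - {i} = ({0..m} - {i}) \<union> {m+1..n}" "({0..m} - {i}) \<inter> {m+1..n} = {}"
      using that m_less_n by auto
    then have "(\<Prod>j\<in>{0..n} - {i}. X j ^ r j :: (nat, 'a) mpoly) =
        (\<Prod>j\<in>{0..m} - {i}. X j ^ r j) * (\<Prod>j\<in>{m+1..n}. X j ^ r j)"
      by (simp add: prod.union_disjoint)
    then show ?thesis
      unfolding al.cof_def lo.cof_def phi_def by (simp only: mult_ac)
  qed
  have hi: "al.cof i = plo * (hi.cof i :: (nat, 'a) mpoly)" if "i \<in> {m+1..n}" for i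
  proof -
    have "{0..n} - {i} = {0..m} \<union> ({m+1..n} - {i})" "{0..m} \<inter> ({m+1..n} - {i}) = {}"
      using that m_less_n by auto
    then have "(\<Prod>j\<in>{0..n} - {i}. X j ^ r j :: (nat, 'a) mpoly) =
        (\<Prod>j\<in>{0..m}. X j ^ r j) * (\<Prod>j\<in>{m+1..n} - {i}. X j ^ r j)"
      by (simp add: prod.union_disjoint)
    moreover have "r i - r 0 = (r (m+1) - r 0) + (r i - r (m+1))"
      using that r_mono[of "m+1" i] r_mono[of 0 "m+1"] by simp
    then have "(X (n+1) ^ (r i - r 0) :: (nat, 'a) mpoly) =
        X (n+1) ^ (r (m+1) - r 0) * X (n+1) ^ (r i - r (m+1))"
      by (simp only: power_add)
    ultimately show ?thesis
      unfolding al.cof_def hi.cof_def plo_def by (simp only: mult_ac)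
  qed
  have "{0..n} = {0..m} \<union> {m+1..n}" "{0..m} \<inter> {m+1..n} = {}"
    using m_less_n by auto
  then have "al.W g = (\<Sum>i\<in>{0..m}. g i * al.cof i) + (\<Sum>i\<in>{m+1..n}. g i * al.cof i)"
    unfolding al.W_def by (simp only: sum.union_disjoint finite_atLeastAtMost)
  also have "(\<Sum>i\<in>{0..m}. g i * al.cof i) = phi * lo.W g"
    unfolding lo.W_def sum_distrib_left by (intro sum.cong refl) (simp only: lo mult_ac)
  also have "(\<Sum>i\<in>{m+1..n}. g i * al.cof i) = plo * hi.W g"
    unfolding hi.W_def sum_distrib_left by (intro sum.cong refl) (simp only: hi mult_ac)
  finally show ?thesis .
qed

lemma lo_W_const: "lo.W (\<lambda>_. p) = p * glo"
  using lo.W_mult[of p "\<lambda>_. 1"] by (simp add: glo_def)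

lemma hi_W_const: "hi.W (\<lambda>_. p) = p * ghi"
  using hi.W_mult[of p "\<lambda>_. 1"] by (simp add: ghi_def)

lemma member_eq: "member a b = Const b * (phi * glo) + Const a * (plo * ghi)"
proof -
  have "lo.W (\<lambda>i. Const (if i \<le> m then b else a)) = lo.W (\<lambda>_. Const b)"
    by (rule lo.W_cong) simp
  moreover have "hi.W (\<lambda>i. Const (if i \<le> m then b else a)) = hi.W (\<lambda>_. Const a)"
    by (rule hi.W_cong) simp
  ultimately show ?thesis
    unfolding member_def al_W_split by (simp only: lo_W_const hi_W_const mult_ac)
qed

lemma X_not_dvd_glo: "\<not> X v dvd (glo :: (nat, 'a::field) mpoly)"
  using lo.X_not_dvd_W[of "\<lambda>_. 1::'a" v] by (simp add: glo_def)

lemma X_not_dvd_ghi: "\<not> X v dvd (ghi :: (nat, 'a::field) mpoly)"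
  using hi.X_not_dvd_W[of "\<lambda>_. 1::'a" v] by (simp add: ghi_def)

lemma X_not_dvd_member: "a \<noteq> 0 \<Longrightarrow> b \<noteq> 0 \<Longrightarrow> \<not> X v dvd (member a b :: (nat, 'a::field) mpoly)"
  unfolding member_def by (rule al.X_not_dvd_W) simp

lemma glo_neq_0: "(glo :: (nat, 'a::field) mpoly) \<noteq> 0"
  using X_not_dvd_glo by (metis dvd_0_right)

lemma ghi_neq_0: "(ghi :: (nat, 'a::field) mpoly) \<noteq> 0"
  using X_not_dvd_ghi by (metis dvd_0_right)

lemma squarefree_glo: "squarefree (glo :: (nat, 'a::field_char_0) mpoly)"
  using lo.squarefree_W[of "\<lambda>_. 1::'a"] by (simp add: glo_def)

lemma squarefree_ghi: "squarefree (ghi :: (nat, 'a::field_char_0) mpoly)"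
  using hi.squarefree_W[of "\<lambda>_. 1::'a"] by (simp add: ghi_def)

lemma squarefree_member: "a \<noteq> 0 \<Longrightarrow> b \<noteq> 0 \<Longrightarrow> squarefree (member a b :: (nat, 'a::field_char_0) mpoly)"
  unfolding member_def by (rule al.squarefree_W) simp

lemma prime_dvd_phi: "prime_elem p \<Longrightarrow> p dvd (phi :: (nat, 'a::field) mpoly) \<Longrightarrow> \<exists>j. X j dvd p"
  unfolding phi_def using prime_dvd_X_power_prod by blast

lemma prime_dvd_plo:
  fixes p :: "(nat, 'a::field) mpoly"
  assumes p: "prime_elem p" and dvd: "p dvd plo"
  shows "\<exists>j. X j dvd p"
proof -
  have "p dvd X (n+1) ^ (r (m+1) - r 0) \<or> p dvd (\<Prod>j\<in>{0..m}. X j ^ r j)"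
    using dvd p by (simp add: plo_def prime_elem_dvd_mult_iff)
  then show ?thesis
  proof
    assume "p dvd X (n+1) ^ (r (m+1) - r 0)"
    with p have "p dvd X (n+1)"
      using prime_elem_dvd_power by blast
    with p show ?thesis
      using prime_dvd_X by blast
  next
    assume "p dvd (\<Prod>j\<in>{0..m}. X j ^ r j)"
    with p show ?thesis
      using prime_dvd_X_power_prod by blast
  qed
qed

text \<open>A common factor involves \<open>x\<^sub>n\<^sub>+\<^sub>1\<close> only; it is fixed by the substitution sending
  \<open>x\<^sub>m\<^sub>+\<^sub>1\<close> to \<open>0\<close> and the other variables of \<open>ghi\<close> to \<open>1\<close>, which maps \<open>ghi\<close> to \<open>1\<close>.\<close>

lemma glo_ghi_coprime:
  fixes p :: "(nat, 'a::field) mpoly"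
  assumes p: "prime_elem p" "p dvd glo"
  shows "\<not> p dvd ghi"
proof
  assume dvd: "p dvd ghi"
  define x :: "nat \<Rightarrow> (nat, 'a) mpoly" where
    "x v = (if v = m + 1 then 0 else if v \<in> {m+1..n} then 1 else X v)" for v
  obtain q where q: "glo = p * q"
    using p(2) ..
  have "(glo :: (nat, 'a) mpoly) \<in> polys (insert (n+1) {0..m})"
    unfolding glo_def by (rule lo.W_polys) auto
  then have "p \<in> polys (insert (n+1) {0..m})"
    using q glo_neq_0 by (metis polys_divisor_closed(1))
  then have "msubst Const x p = msubst Const X p"
    by (rule msubst_cong) (use m_less_n in \<open>auto simp: x_def\<close>)
  then have xp: "msubst Const x p = p" by simp
  have cof: "msubst Const x (hi.cof i) = (if i = m + 1 then 1 else 0)" if i: "i \<in> {m+1..n}" for i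
  proof (cases "i = m + 1")
    case True
    then show ?thesis
      unfolding hi.cof_def
      by (auto simp: Const_hom.msubst_simps Const_hom.msubst_X x_def intro!: prod.neutral)
  next
    case False
    then have "(\<Prod>j\<in>{m+1..n} - {i}. x j ^ r j) = 0"
      using i r_pos[of "m+1"] by (auto simp: prod_zero_iff x_def intro!: bexI[of _ "m+1"])
    then show ?thesis
      using False unfolding hi.cof_def by (simp add: Const_hom.msubst_simps Const_hom.msubst_X)
  qed
  have "msubst Const x ghi = (\<Sum>i\<in>{m+1..n}. msubst Const x (hi.cof i))"
    unfolding ghi_def hi.W_def by (simp add: Const_hom.msubst_simps)
  also have "\<dots> = (\<Sum>i\<in>{m+1..n}. if i = m + 1 then 1 else 0)"
    by (rule sum.cong) (simp_all only: cof)
  also have "\<dots> = 1"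
    using m_less_n by (subst sum.delta) auto
  finally have "p dvd 1"
    using Const_hom.msubst_dvd[OF dvd, of x] xp by simp
  with p show False
    using prime_elem_not_unit by blast
qed

text \<open>Modulo \<open>glo\<close> the member is a unit times \<open>plo * ghi\<close>, a
  monomial times a factor that shares no prime with \<open>glo\<close>.\<close>

lemma member_glo_coprime:
  fixes p :: "(nat, 'a::field) mpoly"
  assumes p: "prime_elem p" "p dvd glo" and "a \<noteq> 0"
  shows "\<not> p dvd member a b"
proof
  assume "p dvd member a b"
  moreover have "p dvd Const b * (phi * glo)"
    using p by simp
  ultimately have "p dvd Const a * (plo * ghi)"
    unfolding member_eq by (metis dvd_add_right_iff)
  moreover have "\<not> p dvd Const a"
    using p Const_unit[OF \<open>a \<noteq> 0\<close>] prime_elem_not_unit dvd_trans by blast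
  moreover have "\<not> p dvd plo"
    using prime_dvd_plo p X_not_dvd_glo dvd_trans by blast
  ultimately show False
    using p glo_ghi_coprime prime_elem_dvd_mult_iff by blast
qed

lemma member_ghi_coprime:
  fixes p :: "(nat, 'a::field) mpoly"
  assumes p: "prime_elem p" "p dvd ghi" and "b \<noteq> 0"
  shows "\<not> p dvd member a b"
proof
  assume "p dvd member a b"
  moreover have "p dvd Const a * (plo * ghi)"
    using p by simp
  ultimately have "p dvd Const b * (phi * glo)"
    unfolding member_eq by (metis dvd_add_left_iff)
  moreover have "\<not> p dvd Const b"
    using p Const_unit[OF \<open>b \<noteq> 0\<close>] prime_elem_not_unit dvd_trans by blast
  moreover have "\<not> p dvd phi"
    using prime_dvd_phi p X_not_dvd_ghi dvd_trans by blast
  ultimately show False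
    using p glo_ghi_coprime prime_elem_dvd_mult_iff by blast
qed

lemma member_phi_glo_coprime:
  fixes p :: "(nat, 'a::field) mpoly"
  assumes p: "prime_elem p" "p dvd member a b" and "a \<noteq> 0" "b \<noteq> 0"
  shows "\<not> p dvd phi * glo"
proof
  assume "p dvd phi * glo"
  then have "p dvd phi \<or> p dvd glo"
    using p prime_elem_dvd_mult_iff by blast
  then show False
    using prime_dvd_phi p X_not_dvd_member[of a b] assms member_glo_coprime dvd_trans by blast
qed

text \<open>Eliminating \<open>plo * ghi\<close> leaves the 2x2 minor times
  \<open>phi * glo\<close>; the minor is a unit for distinct points of the projective line.\<close>

lemma member_member_coprime:
  fixes p :: "(nat, 'a::field) mpoly"
  assumes p: "prime_elem p" "p dvd member a b" and nz: "a \<noteq> 0" "b \<noteq> 0" and "a * b' \<noteq> a' * b"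
  shows "\<not> p dvd member a' b'"
proof
  assume "p dvd member a' b'"
  then have "p dvd Const a * member a' b' - Const a' * member a b"
    using p by (intro dvd_diff dvd_mult)
  also have "\<dots> = Const (a * b' - a' * b) * (phi * glo)"
    by (simp add: member_eq Const_mult Const_diff algebra_simps)
  finally have "p dvd Const (a * b' - a' * b) \<or> p dvd phi * glo"
    using p prime_elem_dvd_mult_iff by blast
  moreover have "\<not> p dvd Const (a * b' - a' * b)"
    using p Const_unit[of "a * b' - a' * b"] assms(5) prime_elem_not_unit dvd_trans
    by (metis eq_iff_diff_eq_0)
  ultimately show False
    using member_phi_glo_coprime p nz by blast
qed

end

section \<open>The divisor attached to finitely many members of the pencil\<close>

locale members = exponents n m r for n m r +
  fixes T :: "nat set" and a b :: "nat \<Rightarrow> 'k::field_char_0"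
  assumes finite_T: "finite T" and a_nz: "i \<in> T \<Longrightarrow> a i \<noteq> 0" and b_nz: "i \<in> T \<Longrightarrow> b i \<noteq> 0"
    and distinct_members: "i \<in> T \<Longrightarrow> j \<in> T \<Longrightarrow> i \<noteq> j \<Longrightarrow> a i * b j \<noteq> a j * b i"
begin

abbreviation V :: "nat set" where "V \<equiv> {..n+1}"

abbreviation z :: nat where "z \<equiv> n + 1"

definition Mi :: "nat \<Rightarrow> (nat, 'k) mpoly" where "Mi i = member (a i) (b i)"

definition M :: "(nat, 'k) mpoly" where "M = prod Mi T"

definition F :: "(nat, 'k) mpoly" where "F = prod X V * (glo * (ghi * M))"

lemma squarefree_M: "squarefree M"
  unfolding M_def
proof (rule squarefree_prod_mpoly)
  show "squarefree (Mi i)" if "i \<in> T" for i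
    unfolding Mi_def using a_nz b_nz that by (intro squarefree_member)
  show "\<not> p dvd Mi j" if "i \<in> T" "j \<in> T" "i \<noteq> j" "prime_elem p" "p dvd Mi i" for i j p
    using member_member_coprime[of p "a i" "b i" "b j" "a j"] a_nz b_nz distinct_members that
    by (simp add: Mi_def)
qed (rule finite_T)

lemma prime_dvd_ME:
  assumes "prime_elem p" and "p dvd M"
  obtains i where "i \<in> T" "p dvd member (a i) (b i)"
  using prime_elem_dvd_prod[OF assms(1) assms(2)[unfolded M_def]] that by (auto simp: Mi_def)

lemma squarefree_F: "squarefree F"
  unfolding F_def
proof (intro squarefree_mult_mpoly squarefree_glo squarefree_ghi squarefree_M)
  show "squarefree (prod X V :: (nat, 'k) mpoly)"
  proof (rule squarefree_prod_mpoly)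
    show "squarefree (X i :: (nat, 'k) mpoly)" for i
      by (rule squarefree_irreducible_mpoly[OF irreducible_X])
    show "\<not> p dvd X j" if "i \<noteq> j" "prime_elem p" "p dvd X i" for i j and p :: "(nat, 'k) mpoly"
    proof
      assume "p dvd X j"
      moreover have "X i dvd p"
        using that prime_dvd_X by blast
      ultimately show False
        using that X_dvd_X_iff dvd_trans by blast
    qed
  qed simp
  fix p :: "(nat, 'k) mpoly"
  assume p: "prime_elem p"
  show "\<not> p dvd M" if "p dvd ghi"
    using that p member_ghi_coprime b_nz prime_dvd_ME by metis
  show "\<not> p dvd ghi * M" if "p dvd glo"
    using that p glo_ghi_coprime member_glo_coprime a_nz prime_dvd_ME prime_elem_dvd_mult_iff by metis
  show "\<not> p dvd glo * (ghi * M)" if "p dvd prod X V"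
  proof
    assume dvd: "p dvd glo * (ghi * M)"
    from that p obtain j where "X j dvd p"
      using prime_elem_dvd_prod prime_dvd_X by metis
    then have "\<not> p dvd glo" "\<not> p dvd ghi" "\<not> p dvd M"
      using X_not_dvd_glo X_not_dvd_ghi X_not_dvd_member a_nz b_nz p prime_dvd_ME dvd_trans by metis+
    with dvd p show False
      using prime_elem_dvd_mult_iff by blast
  qed
qed

lemma F_neq_0: "F \<noteq> 0"
  using squarefree_F by auto

lemma M_neq_0: "M \<noteq> 0"
  using squarefree_M by auto

lemma glo_polys: "(glo :: (nat, 'k) mpoly) \<in> polys V"
  unfolding glo_def by (rule lo.W_polys) (use m_less_n in auto)

lemma ghi_polys: "(ghi :: (nat, 'k) mpoly) \<in> polys V"
  unfolding ghi_def by (rule hi.W_polys) auto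

lemma Mi_polys: "Mi i \<in> polys V"
  unfolding Mi_def member_def by (rule al.W_polys) auto

lemma M_polys: "M \<in> polys V"
  unfolding M_def by (intro polys_prod Mi_polys)

lemma F_polys: "F \<in> polys V"
  unfolding F_def by (intro polys_mult polys_prod glo_polys ghi_polys M_polys) simp

lemma phi_polys: "(phi :: (nat, 'k) mpoly) \<in> polys V"
  unfolding phi_def by (intro polys_prod polys_power) simp

lemma sum_r_all: "sum r {0..n} - r 0 = sum r {1..n}"
  by (simp add: sum.atLeast_Suc_atMost)

lemma homogeneous_Mi: "homogeneous (sum r {1..n}) (Mi i)"
  unfolding Mi_def member_def sum_r_all[symmetric]
  using al.homogeneous_W[of 0 "\<lambda>j. Const (if j \<le> m then b i else a i)"]
  by (simp add: homogeneous_Const)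

text \<open>\<open>phi * glo\<close> is the degenerate member with a = 0 and b = 1, so it has the
  degree of the other members.\<close>

lemma homogeneous_phi_glo: "homogeneous (sum r {1..n}) (phi * glo :: (nat, 'k) mpoly)"
proof -
  have "al.W (\<lambda>i. Const (if i \<le> m then 1 else 0)) = (phi * glo :: (nat, 'k) mpoly)"
    using member_eq[of "0::'k" 1] by (simp add: member_def)
  then show ?thesis
    using al.homogeneous_W[of 0 "\<lambda>j. Const (if j \<le> m then 1 else (0::'k))"]
    by (simp add: homogeneous_Const sum_r_all del: One_nat_def)
qed

lemma homogeneous_M: "homogeneous (card T * sum r {1..n}) M"
  unfolding M_def using homogeneous_prod[of T "\<lambda>_. sum r {1..n}" Mi] homogeneous_Mi by simp

lemma homogeneous_F: "\<exists>d. homogeneous d F"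
proof -
  have "homogeneous (\<Sum>v\<in>V. 1) (prod X V :: (nat, 'k) mpoly)"
    by (intro homogeneous_prod homogeneous_X)
  moreover have "homogeneous (0 + (sum r {0..m} - r 0)) (glo :: (nat, 'k) mpoly)"
    unfolding glo_def by (intro lo.homogeneous_W homogeneous_1)
  moreover have "homogeneous (0 + (sum r {m+1..n} - r (m+1))) (ghi :: (nat, 'k) mpoly)"
    unfolding ghi_def by (intro hi.homogeneous_W homogeneous_1)
  ultimately show ?thesis
    unfolding F_def using homogeneous_M homogeneous_mult by blast
qed

end

section \<open>The basis\<close>

context members
begin

text \<open>A derivation \<open>\<delta>\<close> with \<open>\<delta> x\<^sub>v = \<alpha>\<^sub>v x\<^sub>v\<close> is represented by \<open>\<alpha>\<close>. The parameter \<open>\<beta>\<close> belongs to the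
  block \<open>i > m\<close>, and \<open>\<beta> + \<rho> M\<close> to the block \<open>i \<le> m\<close>.\<close>

definition formed ::
  "(nat \<Rightarrow> (nat, 'k) mpoly) \<Rightarrow> (nat, 'k) mpoly \<Rightarrow> (nat, 'k) mpoly \<Rightarrow> (nat \<Rightarrow> (nat, 'k) mpoly) \<Rightarrow> bool" where
  "formed \<alpha> \<beta> \<rho> \<epsilon> \<longleftrightarrow>
     (\<forall>v\<le>n. of_nat (r v) * (\<alpha> v - \<alpha> z) = \<beta> + (if v \<le> m then \<rho> * M else 0) + \<epsilon> v * X v ^ r v) \<and>
     (\<Sum>v\<in>{0..m}. X z ^ (r v - r 0) * \<epsilon> v) = 0 \<and>
     (\<Sum>v\<in>{m+1..n}. X z ^ (r v - r (m+1)) * \<epsilon> v) = 0"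

abbreviation dlog :: "(nat \<Rightarrow> (nat, 'k) mpoly) \<Rightarrow> (nat, 'k) mpoly \<Rightarrow> (nat, 'k) mpoly" where
  "dlog \<alpha> \<equiv> derv (\<lambda>v. \<alpha> v * X v)"

lemma derv_glo:
  "dlog \<alpha> glo = ((\<Sum>j\<in>{0..m}. of_nat (r j) * \<alpha> j) - of_nat (r 0) * \<alpha> z) * glo
     - lo.W (\<lambda>i. of_nat (r i) * (\<alpha> i - \<alpha> z))"
  using lo.derv_W_Const[of \<alpha> "\<lambda>_. 1"] unfolding glo_def by (simp only: Const_1 mult_1)

lemma derv_ghi:
  "dlog \<alpha> ghi = ((\<Sum>j\<in>{m+1..n}. of_nat (r j) * \<alpha> j) - of_nat (r (m+1)) * \<alpha> z) * ghi
     - hi.W (\<lambda>i. of_nat (r i) * (\<alpha> i - \<alpha> z))"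
  using hi.derv_W_Const[of \<alpha> "\<lambda>_. 1"] unfolding ghi_def by (simp only: Const_1 mult_1)

text \<open>The member is b * phi * glo + a * plo * ghi. Taking \<beta> times the member out of both
  blocks leaves the defect (\<beta>' - \<beta>) on the first block only, so tangency becomes a
  condition on this difference.\<close>

lemma derv_Mi:
  assumes "lo.W (\<lambda>i. of_nat (r i) * (\<alpha> i - \<alpha> z)) = \<beta>' * glo"
    and "hi.W (\<lambda>i. of_nat (r i) * (\<alpha> i - \<alpha> z)) = \<beta> * ghi"
  shows "dlog \<alpha> (Mi i) = ((\<Sum>j\<in>{0..n}. of_nat (r j) * \<alpha> j) - of_nat (r 0) * \<alpha> z - \<beta>) * Mi i
     - Const (b i) * ((\<beta>' - \<beta>) * (phi * glo))"
proof -
  let ?g = "\<lambda>i. of_nat (r i) * (\<alpha> i - \<alpha> z)"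
  let ?c = "\<lambda>j. Const (if j \<le> m then b i else a i)"
  have "lo.W (\<lambda>j. ?c j * ?g j) = lo.W (\<lambda>j. Const (b i) * ?g j)"
    by (rule lo.W_cong) simp
  then have lo: "lo.W (\<lambda>j. ?c j * ?g j) = Const (b i) * (\<beta>' * glo)"
    unfolding lo.W_mult assms(1) .
  have "hi.W (\<lambda>j. ?c j * ?g j) = hi.W (\<lambda>j. Const (a i) * ?g j)"
    by (rule hi.W_cong) simp
  then have hi: "hi.W (\<lambda>j. ?c j * ?g j) = Const (a i) * (\<beta> * ghi)"
    unfolding hi.W_mult assms(2) .
  show ?thesis
    unfolding Mi_def member_def al.derv_W_Const al_W_split[of "\<lambda>j. ?c j * ?g j"] lo hi
    unfolding member_def[symmetric] member_eq by (simp add: algebra_simps)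
qed

lemma formed_W:
  assumes "formed \<alpha> \<beta> \<rho> \<epsilon>"
  shows "lo.W (\<lambda>i. of_nat (r i) * (\<alpha> i - \<alpha> z)) = (\<beta> + \<rho> * M) * glo"
    and "hi.W (\<lambda>i. of_nat (r i) * (\<alpha> i - \<alpha> z)) = \<beta> * ghi"
proof -
  have "lo.W (\<lambda>i. of_nat (r i) * (\<alpha> i - \<alpha> z)) = lo.W (\<lambda>i. (\<beta> + \<rho> * M) + \<epsilon> i * X i ^ r i)"
    using assms m_less_n by (intro lo.W_cong) (simp add: formed_def)
  also have "\<dots> = (\<beta> + \<rho> * M) * glo"
    using assms unfolding lo.W_add lo.W_X_power lo_W_const by (simp add: formed_def algebra_simps)
  finally show "lo.W (\<lambda>i. of_nat (r i) * (\<alpha> i - \<alpha> z)) = (\<beta> + \<rho> * M) * glo" .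
  have "hi.W (\<lambda>i. of_nat (r i) * (\<alpha> i - \<alpha> z)) = hi.W (\<lambda>i. \<beta> + \<epsilon> i * X i ^ r i)"
    using assms m_less_n by (intro hi.W_cong) (simp add: formed_def)
  also have "\<dots> = \<beta> * ghi"
    using assms unfolding hi.W_add hi.W_X_power hi_W_const by (simp add: formed_def)
  finally show "hi.W (\<lambda>i. of_nat (r i) * (\<alpha> i - \<alpha> z)) = \<beta> * ghi" .
qed

text \<open>The logarithmic derivatives of the factors of F, bracketed as in F. In the last sum the
  quotient of the defect \<open>\<rho> * M * phi * glo\<close> by the i-th member is written with
  the product of the other members, so it is visibly a polynomial.\<close>

definition eigenvalue ::
  "(nat \<Rightarrow> (nat, 'k) mpoly) \<Rightarrow> (nat, 'k) mpoly \<Rightarrow> (nat, 'k) mpoly \<Rightarrow> (nat, 'k) mpoly" where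
  "eigenvalue \<alpha> \<beta> \<rho> = (\<Sum>v\<in>V. \<alpha> v)
     + (((\<Sum>j\<in>{0..m}. of_nat (r j) * \<alpha> j) - of_nat (r 0) * \<alpha> z - (\<beta> + \<rho> * M))
     + (((\<Sum>j\<in>{m+1..n}. of_nat (r j) * \<alpha> j) - of_nat (r (m+1)) * \<alpha> z - \<beta>)
     + (\<Sum>i\<in>T. (\<Sum>j\<in>{0..n}. of_nat (r j) * \<alpha> j) - of_nat (r 0) * \<alpha> z - \<beta>
          - Const (b i) * (\<rho> * prod Mi (T - {i}) * (phi * glo)))))"

lemma formed_eigen:
  assumes "formed \<alpha> \<beta> \<rho> \<epsilon>"
  shows "dlog \<alpha> F = eigenvalue \<alpha> \<beta> \<rho> * F"
proof -
  note W = formed_W[OF assms]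
  have X: "dlog \<alpha> (prod X V) = (\<Sum>v\<in>V. \<alpha> v) * prod X V"
    by (rule derv_eigen_prod) simp
  have Mi: "dlog \<alpha> (Mi i) = ((\<Sum>j\<in>{0..n}. of_nat (r j) * \<alpha> j) - of_nat (r 0) * \<alpha> z - \<beta>
      - Const (b i) * (\<rho> * prod Mi (T - {i}) * (phi * glo))) * Mi i" if "i \<in> T" for i
  proof -
    have "M = prod Mi (T - {i}) * Mi i"
      using that finite_T by (simp add: M_def prod.remove mult.commute)
    then show ?thesis
      unfolding derv_Mi[OF W] by (simp add: algebra_simps)
  qed
  have M: "dlog \<alpha> M = (\<Sum>i\<in>T. (\<Sum>j\<in>{0..n}. of_nat (r j) * \<alpha> j) - of_nat (r 0) * \<alpha> z - \<beta>
      - Const (b i) * (\<rho> * prod Mi (T - {i}) * (phi * glo))) * M"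
    unfolding M_def by (rule derv_eigen_prod) (rule Mi)
  have mult: "dlog \<alpha> (f * g) = (k + l) * (f * g)" if "dlog \<alpha> f = k * f" "dlog \<alpha> g = l * g" for f g k l
    using that by (simp add: derv_mult algebra_simps)
  have lo: "dlog \<alpha> glo = ((\<Sum>j\<in>{0..m}. of_nat (r j) * \<alpha> j) - of_nat (r 0) * \<alpha> z - (\<beta> + \<rho> * M)) * glo"
    unfolding derv_glo W by (rule left_diff_distrib[symmetric])
  have hi: "dlog \<alpha> ghi = ((\<Sum>j\<in>{m+1..n}. of_nat (r j) * \<alpha> j) - of_nat (r (m+1)) * \<alpha> z - \<beta>) * ghi"
    unfolding derv_ghi W by (rule left_diff_distrib[symmetric])
  show ?thesis
    unfolding F_def eigenvalue_def by (intro mult X lo hi M)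
qed

lemma eigenvalue_polys:
  assumes "\<And>v. v \<le> z \<Longrightarrow> \<alpha> v \<in> polys V" and "\<beta> \<in> polys V" and "\<rho> \<in> polys V"
  shows "eigenvalue \<alpha> \<beta> \<rho> \<in> polys V"
proof -
  have of_nat: "(of_nat k :: (nat, 'k) mpoly) \<in> polys V" for k
    unfolding Const_of_nat[symmetric] by (rule polys_Const)
  show ?thesis
    unfolding eigenvalue_def
    by (intro polys_add polys_diff polys_sum polys_mult polys_prod assms of_nat M_polys Mi_polys
          phi_polys glo_polys polys_Const) (use m_less_n in auto)
qed

text \<open>Replacing one member in M by \<open>phi * glo\<close> keeps the degree, so a constant
  \<rho> is compatible with e being the degree of M.\<close>

lemma homogeneous_eigenvalue:
  assumes "\<And>v. v \<le> z \<Longrightarrow> homogeneous e (\<alpha> v)" and "homogeneous e \<beta>"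
    and "\<rho> = 0 \<or> homogeneous 0 \<rho> \<and> e = card T * sum r {1..n}"
  shows "homogeneous e (eigenvalue \<alpha> \<beta> \<rho>)"
proof -
  have of_nat: "homogeneous e p \<Longrightarrow> homogeneous e (of_nat k * p)" for k and p :: "(nat, 'k) mpoly"
    unfolding Const_of_nat[symmetric] by (rule homogeneous_Const_mult)
  have M: "homogeneous e (\<rho> * M)"
    using assms(3) homogeneous_mult[OF _ homogeneous_M, of 0 \<rho>] by auto
  have "homogeneous e (\<rho> * prod Mi (T - {i}) * (phi * glo))" if "i \<in> T" for i
  proof (cases "\<rho> = 0")
    case False
    have "card T = card (T - {i}) + 1"
      using card_Suc_Diff1[OF finite_T that] by simp
    then have e: "e = 0 + (\<Sum>j\<in>T - {i}. sum r {1..n}) + sum r {1..n}"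
      using False assms(3) by (simp add: algebra_simps)
    show ?thesis
      unfolding e using False assms(3)
      by (intro homogeneous_mult homogeneous_phi_glo homogeneous_prod homogeneous_Mi) auto
  qed simp
  then show ?thesis
    unfolding eigenvalue_def
    by (intro homogeneous_add homogeneous_diff homogeneous_sum of_nat homogeneous_Const_mult M assms)
       (use m_less_n in auto)
qed

text \<open>The \<open>n + 1\<close> basis vectors are labelled by \<open>0, \<dots>, n\<close>. Label \<open>0\<close> is the field scaling both
  blocks, label \<open>m + 1\<close> is \<open>M\<close> times the field scaling the first block, and each other label
  is an index whose variable is paired with the first variable of its block.\<close>

definition base :: "nat \<Rightarrow> nat" where "base l = (if l \<le> m then 0 else m + 1)"

text \<open>The relation of a block has coefficient 1 at its first index, so it can be solved for
  that \<epsilon> with all others free. Setting the free \<epsilon> at l to 1 and the other free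
  ones to 0 forces the value at \<open>base l\<close>; the labels 0 and m + 1 carry \<beta> and
  \<rho> instead.\<close>

definition lab_eps :: "nat \<Rightarrow> nat \<Rightarrow> (nat, 'k) mpoly" where
  "lab_eps l v = (if l = 0 \<or> l = m + 1 then 0 else if v = l then 1
     else if v = base l then - (X z ^ (r l - r (base l))) else 0)"

definition lab_beta :: "nat \<Rightarrow> (nat, 'k) mpoly" where "lab_beta l = (if l = 0 then 1 else 0)"

definition lab_rho :: "nat \<Rightarrow> (nat, 'k) mpoly" where "lab_rho l = (if l = m + 1 then 1 else 0)"

definition lab_gam :: "nat \<Rightarrow> nat \<Rightarrow> (nat, 'k) mpoly" where
  "lab_gam l v = lab_beta l + (if v \<le> m then lab_rho l * M else 0) + lab_eps l v * X v ^ r v"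

text \<open>The conditions see only the differences \<alpha>_v - \<alpha>_z. Normalizing \<alpha>_z
  = 0 picks one solution modulo the Euler derivation; r v is invertible in characteristic 0.\<close>

definition lab_alpha :: "nat \<Rightarrow> nat \<Rightarrow> (nat, 'k) mpoly" where
  "lab_alpha l v = (if v = z then 0 else Const (inverse (of_nat (r v))) * lab_gam l v)"

text \<open>This is the degree of the \<alpha>; the derivation has coefficients \<alpha>_v x_v, so
  its exponent is larger by 1.\<close>

definition lab_deg :: "nat \<Rightarrow> nat" where
  "lab_deg l = (if l = 0 then 0 else if l = m + 1 then card T * sum r {1..n} else r l)"

lemma lab_alpha_z: "lab_alpha l z = 0"
  by (simp add: lab_alpha_def)

text \<open>The simplifier rewrites \<open>n + 1\<close> to \<open>Suc n\<close>; the rule is stored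
  in that form so that it can fire.\<close>

lemmas lab_alpha_Suc [simp] = lab_alpha_z[simplified]

lemma of_nat_cancel: "v \<le> n \<Longrightarrow> of_nat (r v) * (Const (inverse (of_nat (r v))) * p) = (p :: (nat, 'k) mpoly)"
  using r_pos[of v] unfolding Const_of_nat[symmetric] mult.assoc[symmetric]
  by (subst Const_inverse_mult) auto

lemma r_lab_alpha: "v \<le> n \<Longrightarrow> of_nat (r v) * lab_alpha l v = lab_gam l v"
  by (simp add: lab_alpha_def of_nat_cancel)

lemma lab_eps_sums:
  assumes "l \<le> n"
  shows "(\<Sum>v\<in>{0..m}. X z ^ (r v - r 0) * lab_eps l v) = 0"
    and "(\<Sum>v\<in>{m+1..n}. X z ^ (r v - r (m+1)) * lab_eps l v) = 0"
proof -
  show "(\<Sum>v\<in>{0..m}. X z ^ (r v - r 0) * lab_eps l v) = 0"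
  proof (cases "l \<noteq> 0 \<and> l \<le> m")
    case True
    then have "(\<Sum>v\<in>{0..m}. X z ^ (r v - r 0) * lab_eps l v) = (\<Sum>v\<in>{0, l}. X z ^ (r v - r 0) * lab_eps l v)"
      by (intro sum.mono_neutral_right) (auto simp: lab_eps_def base_def)
    with True show ?thesis
      by (simp add: lab_eps_def base_def)
  next
    case False
    then show ?thesis
      by (intro sum.neutral) (auto simp: lab_eps_def base_def)
  qed
  show "(\<Sum>v\<in>{m+1..n}. X z ^ (r v - r (m+1)) * lab_eps l v) = 0"
  proof (cases "l > m + 1")
    case True
    then have "(\<Sum>v\<in>{m+1..n}. X z ^ (r v - r (m+1)) * lab_eps l v) =
        (\<Sum>v\<in>{m+1, l}. X z ^ (r v - r (m+1)) * lab_eps l v)"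
      using assms by (intro sum.mono_neutral_right) (auto simp: lab_eps_def base_def)
    with True show ?thesis
      by (simp add: lab_eps_def base_def)
  next
    case False
    then show ?thesis
      by (intro sum.neutral) (auto simp: lab_eps_def base_def)
  qed
qed

lemma formed_lab: "l \<le> n \<Longrightarrow> formed (lab_alpha l) (lab_beta l) (lab_rho l) (lab_eps l)"
  unfolding formed_def lab_alpha_z diff_0_right
  by (intro conjI allI impI lab_eps_sums) (simp_all only: r_lab_alpha lab_gam_def)

text \<open>At an index other than 0 and m + 1 only the label equal to it contributes. At the first
  index of a block the sum is minus the rest of the block relation, hence the value of \<epsilon>
  there.\<close>

lemma lab_eps_expand:
  assumes "(\<Sum>v\<in>{0..m}. X z ^ (r v - r 0) * \<epsilon> v) = 0"
    and "(\<Sum>v\<in>{m+1..n}. X z ^ (r v - r (m+1)) * \<epsilon> v) = 0" and "v \<le> n"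
  shows "(\<Sum>l\<in>{0..n}. \<epsilon> l * lab_eps l v) = \<epsilon> v"
proof -
  have base: "(\<Sum>l\<in>{0..n}. \<epsilon> l * lab_eps l k) = \<epsilon> k"
    if k: "k = 0 \<and> J = {0..m} \<or> k = m + 1 \<and> J = {m+1..n}" and sum: "(\<Sum>v\<in>J. X z ^ (r v - r k) * \<epsilon> v) = 0" for k J
  proof -
    have kJ: "k \<in> J" "J \<subseteq> {0..n}" "finite J" using k m_less_n by auto
    have "(\<Sum>l\<in>{0..n}. \<epsilon> l * lab_eps l k) = (\<Sum>l\<in>J - {k}. - (X z ^ (r l - r k) * \<epsilon> l))"
      using kJ k by (intro sum.mono_neutral_cong_right) (auto simp: lab_eps_def base_def)
    also have "\<dots> = \<epsilon> k"
      using sum kJ by (simp add: sum.remove[of J k] sum_negf add_eq_0_iff)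
    finally show ?thesis .
  qed
  consider "v = 0" | "v = m + 1" | "v \<noteq> 0" "v \<noteq> m + 1" by blast
  then show ?thesis
  proof cases
    case 3
    then have "(\<Sum>l\<in>{0..n}. \<epsilon> l * lab_eps l v) = (\<Sum>l\<in>{0..n}. if l = v then \<epsilon> v else 0)"
      by (intro sum.cong) (auto simp: lab_eps_def base_def)
    with assms(3) show ?thesis by simp
  qed (use base assms in auto)
qed

lemma lab_gam_sum:
  "(\<Sum>l\<in>{0..n}. c l * lab_gam l v) =
     c 0 + (if v \<le> m then c (m+1) * M else 0) + (\<Sum>l\<in>{0..n}. c l * lab_eps l v) * X v ^ r v"
proof -
  have "(\<Sum>l\<in>{0..n}. c l * lab_gam l v) = (\<Sum>l\<in>{0..n}. (if l = 0 then c 0 else 0)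
      + (if l = m + 1 then (if v \<le> m then c (m+1) * M else 0) else 0) + c l * lab_eps l v * X v ^ r v)"
    by (intro sum.cong) (auto simp: lab_gam_def lab_beta_def lab_rho_def algebra_simps)
  also have "\<dots> = c 0 + (if v \<le> m then c (m+1) * M else 0) + (\<Sum>l\<in>{0..n}. c l * lab_eps l v) * X v ^ r v"
    using m_less_n unfolding sum.distrib sum_distrib_right by simp
  finally show ?thesis .
qed

text \<open>The coordinates are \<beta>, \<rho> and the free \<epsilon>. Since
  \<open>lab_eps\<close> vanishes for the labels 0 and m + 1, overwriting \<epsilon> there by
  \<beta> and \<rho> does no harm.\<close>

lemma formed_expand:
  assumes "formed \<alpha> \<beta> \<rho> \<epsilon>" and "v \<le> z"
  defines "c \<equiv> \<lambda>l. if l = 0 then \<beta> else if l = m + 1 then \<rho> else \<epsilon> l"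
  shows "\<alpha> v = \<alpha> z + (\<Sum>l\<in>{0..n}. c l * lab_alpha l v)"
proof (cases "v = z")
  case False
  with assms have v: "v \<le> n" by simp
  have "(\<Sum>l\<in>{0..n}. c l * lab_eps l v) = (\<Sum>l\<in>{0..n}. \<epsilon> l * lab_eps l v)"
    by (intro sum.cong) (auto simp: c_def lab_eps_def)
  also have "\<dots> = \<epsilon> v"
    using assms v by (intro lab_eps_expand) (auto simp: formed_def)
  finally have "(\<Sum>l\<in>{0..n}. c l * lab_gam l v) = of_nat (r v) * (\<alpha> v - \<alpha> z)"
    using assms v unfolding lab_gam_sum by (simp add: formed_def c_def)
  moreover have "(\<Sum>l\<in>{0..n}. c l * lab_gam l v) = of_nat (r v) * (\<Sum>l\<in>{0..n}. c l * lab_alpha l v)"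
    unfolding sum_distrib_left by (intro sum.cong refl) (simp only: r_lab_alpha[OF v, symmetric] mult_ac)
  ultimately have "of_nat (r v) * (\<alpha> v - \<alpha> z) = of_nat (r v) * (\<Sum>l\<in>{0..n}. c l * lab_alpha l v)"
    by metis
  then have "\<alpha> v - \<alpha> z = (\<Sum>l\<in>{0..n}. c l * lab_alpha l v)"
    using r_pos[OF v] by auto
  then show ?thesis
    by (metis add.commute diff_add_cancel)
qed simp

lemma lab_polys:
  shows "lab_eps l v \<in> polys V" "lab_beta l \<in> polys V" "lab_rho l \<in> polys V"
    and "v \<le> z \<Longrightarrow> lab_alpha l v \<in> polys V"
proof -
  show *: "lab_eps l v \<in> polys V" "lab_beta l \<in> polys V" "lab_rho l \<in> polys V"
    by (auto simp: lab_eps_def lab_beta_def lab_rho_def intro!: polys_uminus polys_power)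
  show "v \<le> z \<Longrightarrow> lab_alpha l v \<in> polys V"
    using * by (auto simp: lab_alpha_def lab_gam_def intro!: polys_mult polys_add polys_power
        M_polys[simplified])
qed

lemma homogeneous_lab:
  assumes "l \<le> n" and "v \<le> z"
  shows "homogeneous (lab_deg l) (lab_alpha l v)"
proof -
  have "homogeneous (lab_deg l) (lab_gam l v)" if v: "v \<le> n"
  proof -
    consider "l = 0" | "l = m + 1" | "l \<noteq> 0" "l \<noteq> m + 1" "v = l" |
        "l \<noteq> 0" "l \<noteq> m + 1" "v = base l" "v \<noteq> l" | "l \<noteq> 0" "l \<noteq> m + 1" "v \<noteq> l" "v \<noteq> base l" by blast
    then show ?thesis
    proof cases
      case 4
      then have "r v \<le> r l"
        using assms(1) by (intro r_mono) (auto simp: base_def split: if_splits)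
      then have "r l = (r l - r v) + r v" by simp
      moreover have "homogeneous ((r l - r v) + r v) (- (X z ^ (r l - r v)) * X v ^ r v :: (nat, 'k) mpoly)"
        by (intro homogeneous_mult homogeneous_uminus homogeneous_X_power)
      ultimately show ?thesis
        using 4 by (simp add: lab_gam_def lab_deg_def lab_beta_def lab_rho_def lab_eps_def)
    qed (auto simp: lab_gam_def lab_deg_def lab_beta_def lab_rho_def lab_eps_def homogeneous_1
        homogeneous_M[simplified] homogeneous_X_power)
  qed
  with assms show ?thesis
    by (auto simp: lab_alpha_def intro: homogeneous_Const_mult)
qed

definition lam :: "nat \<Rightarrow> (nat, 'k) mpoly" where
  "lam l = eigenvalue (lab_alpha l) (lab_beta l) (lab_rho l)"

lemma dlog_lab: "l \<le> n \<Longrightarrow> dlog (lab_alpha l) F = lam l * F"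
  unfolding lam_def by (rule formed_eigen[OF formed_lab])

lemma lam_polys: "lam l \<in> polys V"
  unfolding lam_def by (intro eigenvalue_polys lab_polys)

lemma homogeneous_lam: "l \<le> n \<Longrightarrow> homogeneous (lab_deg l) (lam l)"
  unfolding lam_def
  by (intro homogeneous_eigenvalue homogeneous_lab)
     (auto simp: lab_beta_def lab_rho_def lab_deg_def homogeneous_1)

definition deg_F :: nat where
  "deg_F = n + 2 + (sum r {0..m} - r 0) + (sum r {m+1..n} - r (m+1)) + card T * (sum r {0..n} - r 0)"

text \<open>The Euler derivation satisfies all tangency conditions with zero parameters, so its
  eigenvalue comes from the general formula and evaluates to the degree.\<close>

lemma dlog_euler: "dlog (\<lambda>_. 1) F = Const (of_nat deg_F) * F"
proof -
  have sum: "(\<Sum>j\<in>J. of_nat (r j) * 1) - of_nat (r k) * 1 = (of_nat (sum r J - r k) :: (nat, 'k) mpoly)"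
    if "finite J" "k \<in> J" for J k
    using that by (simp add: of_nat_diff member_le_sum)
  have *: "{0..m} \<noteq> {}" "{m+1..n} \<noteq> {}" "0 \<in> {0..m}" "0 \<in> {0..n}" "m + 1 \<in> {m+1..n}"
    using m_less_n by auto
  have "formed (\<lambda>_. 1) 0 0 (\<lambda>_. 0)"
    by (simp add: formed_def)
  then have "dlog (\<lambda>_. 1) F = eigenvalue (\<lambda>_. 1) 0 0 * F"
    by (rule formed_eigen)
  also have "eigenvalue (\<lambda>_. 1) 0 0 = of_nat deg_F"
    unfolding eigenvalue_def sum[OF finite_atLeastAtMost *(3)] sum[OF finite_atLeastAtMost *(4)]
      sum[OF finite_atLeastAtMost *(5)] deg_F_def by simp
  finally show ?thesis
    by (simp add: Const_of_nat)
qed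

text \<open>Euler multiplies F by \<open>deg_F\<close> and the l-th solution multiplies it by
  \<open>lam l\<close>; the subtracted multiple is the one that makes the eigenvalue on F
  zero.\<close>

definition basis_vec :: "nat \<Rightarrow> nat \<Rightarrow> (nat, 'k) mpoly" where
  "basis_vec l v = (lab_alpha l v - Const (inverse (of_nat deg_F)) * lam l) * X v"

lemma basis_vec_polys: "v \<in> V \<Longrightarrow> basis_vec l v \<in> polys V"
  unfolding basis_vec_def by (intro polys_mult polys_diff lab_polys lam_polys polys_Const) auto

lemma homogeneous_basis_vec:
  assumes "l \<le> n" and "v \<in> V"
  shows "homogeneous (lab_deg l + 1) (basis_vec l v)"
  unfolding basis_vec_def using assms
  by (intro homogeneous_mult homogeneous_X homogeneous_diff homogeneous_lab homogeneous_Const_mult homogeneous_lam) auto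

lemma deg_F_cancel: "Const (of_nat deg_F) * Const (inverse (of_nat deg_F)) = (1 :: (nat, 'k) mpoly)"
proof (rule Const_inverse_mult)
  show "(of_nat deg_F :: 'k) \<noteq> 0"
    unfolding of_nat_eq_0_iff deg_F_def by simp
qed

lemma derv_combine:
  assumes "p \<in> polys V" and "\<And>v. v \<in> V \<Longrightarrow> \<alpha> v = u + w * \<alpha>' v"
  shows "dlog \<alpha> p = u * dlog (\<lambda>_. 1) p + w * dlog \<alpha>' p"
proof -
  have "dlog \<alpha> p = (\<Sum>j\<in>{True, False}. (if j then u else w) * (if j then dlog (\<lambda>_. 1) p else dlog \<alpha>' p))"
    using derv_linear[OF assms(1), where a = "\<lambda>v. \<alpha> v * X v" and J = "{True, False}"
        and c = "\<lambda>j. if j then u else w"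
        and b = "\<lambda>j. if j then (\<lambda>v. 1 * X v) else (\<lambda>v. \<alpha>' v * X v)"] assms(2)
    by (simp add: algebra_simps if_distrib)
  then show ?thesis by simp
qed

lemma derv_basis_vec: "l \<le> n \<Longrightarrow> derv (basis_vec l) F = 0"
proof -
  assume l: "l \<le> n"
  have "derv (basis_vec l) F = dlog (\<lambda>v. lab_alpha l v - Const (inverse (of_nat deg_F)) * lam l) F"
    by (simp add: basis_vec_def[abs_def])
  also have "\<dots> = - (Const (inverse (of_nat deg_F)) * lam l) * dlog (\<lambda>_. 1) F + 1 * dlog (lab_alpha l) F"
    by (rule derv_combine[OF F_polys]) simp
  also have "\<dots> = lam l * F - (Const (of_nat deg_F) * Const (inverse (of_nat deg_F))) * lam l * F"
    unfolding dlog_euler dlog_lab[OF l] by (simp add: algebra_simps)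
  finally show ?thesis
    unfolding deg_F_cancel by simp
qed


section \<open>Spanning, independence and freeness\<close>

lemma derv_factor_dvd:
  fixes G H :: "(nat, 'k) mpoly"
  assumes "squarefree (G * H)" and "derv u (G * H) = 0"
  shows "G dvd derv u G"
proof (rule squarefree_dvd_mult[OF assms(1)])
  \<comment> \<open>The Leibniz rule shows that G divides H times its own derivative, and
    squarefreeness removes H.\<close>
  have "H * derv u G = G * (- derv u H)"
    using assms(2) by (simp add: derv_mult add_eq_0_iff)
  then show "G dvd H * derv u G" by simp
qed

lemma polys_quotient:
  fixes p q :: "(nat, 'k) mpoly"
  assumes "p \<in> polys W" and "q dvd p"
  obtains t where "t \<in> polys W" "p = t * q"
proof (cases "p = 0")
  case True
  then show ?thesis using that[of 0] by simp
next
  case False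
  from assms(2) obtain t where "p = t * q" by (metis dvdE mult.commute)
  with False assms(1) that polys_divisor_closed(1) show ?thesis by metis
qed

text \<open>Subtracting the quotient \<beta> from all g i produces a syzygy of the cofactors, whose
  shape is known from \<open>W_eq_0D\<close>. Stated for a general block to serve both
  halves.\<close>

lemma block_quotient:
  assumes "block y r J k" and "insert y J \<subseteq> V"
    and "\<And>i. i \<in> J \<Longrightarrow> g i \<in> polys V"
    and G: "G = block.W y r J k (\<lambda>_. 1)" and "G dvd block.W y r J k g"
  obtains \<beta> :: "(nat, 'k) mpoly" and \<epsilon> :: "nat \<Rightarrow> (nat, 'k) mpoly" where "\<beta> \<in> polys V" "\<And>i. i \<in> J \<Longrightarrow> \<epsilon> i \<in> polys V"
    "\<And>i. i \<in> J \<Longrightarrow> g i = \<beta> + \<epsilon> i * X i ^ r i" "(\<Sum>i\<in>J. X y ^ (r i - r k) * \<epsilon> i) = 0"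
    "block.W y r J k g = \<beta> * G"
proof -
  interpret B: block y r J k by (rule assms(1))
  have "B.W g \<in> polys V"
    using assms(2,3) by (intro B.W_polys)
  then obtain \<beta> where \<beta>: "\<beta> \<in> polys V" "B.W g = \<beta> * G"
    using polys_quotient assms(5) by metis
  have "B.W (\<lambda>i. g i - \<beta>) = 0"
    using B.W_diff[of g "\<lambda>_. \<beta>"] B.W_mult[of \<beta> "\<lambda>_. 1"] \<beta> G by simp
  then obtain \<epsilon> where "\<And>i. i \<in> J \<Longrightarrow> \<epsilon> i \<in> polys V" "\<And>i. i \<in> J \<Longrightarrow> g i - \<beta> = \<epsilon> i * X i ^ r i"
      "(\<Sum>i\<in>J. X y ^ (r i - r k) * \<epsilon> i) = 0"
    using B.W_eq_0D[of "\<lambda>i. g i - \<beta>" V] assms(3) \<beta>(1) polys_diff by blast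
  with that[of \<beta> \<epsilon>] \<beta> show ?thesis
    by (simp add: diff_eq_eq add.commute)
qed

text \<open>The converse of \<open>formed_eigen\<close> for derivations killing F: as F is
  squarefree, such a derivation is tangent to every factor, and each tangency yields one of the
  equations in \<open>formed\<close>.\<close>

lemma Der0_formed:
  assumes poly: "\<And>v. v \<in> V \<Longrightarrow> u v \<in> polys V" and zero: "derv u F = 0"
  obtains \<alpha> \<beta> \<rho> \<epsilon> where "\<And>v. v \<in> V \<Longrightarrow> u v = \<alpha> v * X v" "\<And>v. v \<in> V \<Longrightarrow> \<alpha> v \<in> polys V"
    "\<beta> \<in> polys V" "\<rho> \<in> polys V" "\<And>v. v \<le> n \<Longrightarrow> \<epsilon> v \<in> polys V" "formed \<alpha> \<beta> \<rho> \<epsilon>"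
proof -
  have factor: "G dvd derv u G" if "F = G * H" for G H
    using that derv_factor_dvd squarefree_F zero by metis
  have "\<exists>t. t \<in> polys V \<and> u v = t * X v" if v: "v \<in> V" for v
  proof -
    have "F = X v * (prod X (V - {v}) * (glo * (ghi * M)))"
      unfolding F_def prod.remove[OF finite_atMost v, of X] by (simp only: mult.assoc)
    then have "X v dvd u v"
      using factor by fastforce
    with poly[OF v] show ?thesis
      using polys_quotient by metis
  qed
  then obtain \<alpha> where \<alpha>: "\<And>v. v \<in> V \<Longrightarrow> \<alpha> v \<in> polys V \<and> u v = \<alpha> v * X v"
    by metis
  have u: "derv u p = dlog \<alpha> p" if "p \<in> polys V" for p
    using derv_linear[OF that, where a = u and J = "{()}" and c = "\<lambda>_. 1" and b = "\<lambda>_ v. \<alpha> v * X v"] \<alpha>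
    by simp
  let ?g = "\<lambda>i. of_nat (r i) * (\<alpha> i - \<alpha> z)"
  have g: "?g i \<in> polys V" if "i \<le> n" for i
    unfolding Const_of_nat[symmetric] using \<alpha> that by (intro polys_mult polys_diff) auto
  have "glo dvd dlog \<alpha> glo"
    using factor[of glo "prod X V * (ghi * M)"] u[OF glo_polys] by (simp add: F_def mult_ac)
  \<comment> \<open>By \<open>derv_glo\<close> the derivative is a multiple of \<open>glo\<close>
    minus this weighted sum.\<close>
  then have "glo dvd lo.W ?g"
    unfolding derv_glo by (subst (asm) dvd_diff_right_iff) auto
  then obtain \<beta>2 \<epsilon>2 where lo: "\<beta>2 \<in> polys V" "\<And>i. i \<in> {0..m} \<Longrightarrow> \<epsilon>2 i \<in> polys V"
    "\<And>i. i \<in> {0..m} \<Longrightarrow> ?g i = \<beta>2 + \<epsilon>2 i * X i ^ r i" "(\<Sum>i\<in>{0..m}. X z ^ (r i - r 0) * \<epsilon>2 i) = 0"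
    "lo.W ?g = \<beta>2 * glo"
    using block_quotient[OF lo.block_axioms _ _ glo_def, of ?g] g m_less_n by auto
  have "ghi dvd dlog \<alpha> ghi"
    using factor[of ghi "prod X V * (glo * M)"] u[OF ghi_polys] by (simp add: F_def mult_ac)
  then have "ghi dvd hi.W ?g"
    unfolding derv_ghi by (subst (asm) dvd_diff_right_iff) auto
  then obtain \<beta>1 \<epsilon>1 where hi: "\<beta>1 \<in> polys V" "\<And>i. i \<in> {m+1..n} \<Longrightarrow> \<epsilon>1 i \<in> polys V"
    "\<And>i. i \<in> {m+1..n} \<Longrightarrow> ?g i = \<beta>1 + \<epsilon>1 i * X i ^ r i"
    "(\<Sum>i\<in>{m+1..n}. X z ^ (r i - r (m+1)) * \<epsilon>1 i) = 0" "hi.W ?g = \<beta>1 * ghi"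
    using block_quotient[OF hi.block_axioms _ _ ghi_def, of ?g] g m_less_n by auto
  have "Mi i dvd \<beta>2 - \<beta>1" if i: "i \<in> T" for i
  proof -
    have "M = Mi i * prod Mi (T - {i})"
      using i finite_T by (simp add: M_def prod.remove)
    then have "F = Mi i * (prod X V * (glo * (ghi * prod Mi (T - {i}))))"
      by (simp add: F_def mult_ac)
    then have "Mi i dvd dlog \<alpha> (Mi i)"
      using factor u[OF Mi_polys] by metis
    \<comment> \<open>The first term of \<open>derv_Mi\<close> is a multiple of the member, so only
      the defect is left; the unit \<open>b i\<close> and the coprime factor
      \<open>phi * glo\<close> are then removed from it.\<close>
    then have "Mi i dvd Const (b i) * ((\<beta>2 - \<beta>1) * (phi * glo))"
      unfolding derv_Mi[OF lo(5) hi(5)] by (subst (asm) dvd_diff_right_iff) auto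
    then have "Mi i dvd Const (inverse (b i)) * (Const (b i) * ((\<beta>2 - \<beta>1) * (phi * glo)))"
      by (rule dvd_mult)
    also have "\<dots> = (phi * glo) * (\<beta>2 - \<beta>1)"
      unfolding mult.assoc[symmetric] Const_inverse_mult(1)[OF b_nz[OF i]] by (simp add: mult_ac)
    finally have dvd: "Mi i dvd (phi * glo) * (\<beta>2 - \<beta>1)" .
    show ?thesis
    proof (rule no_common_prime_dvd_mult[OF _ dvd])
      show "Mi i \<noteq> 0"
        using squarefree_member[OF a_nz[OF i] b_nz[OF i]] by (auto simp: Mi_def)
    qed (use member_phi_glo_coprime a_nz[OF i] b_nz[OF i] in \<open>auto simp: Mi_def\<close>)
  qed
  then have "M dvd \<beta>2 - \<beta>1"
    unfolding M_def by (intro prod_dvd_of_dvd finite_T squarefree_M[unfolded M_def])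
  then obtain \<rho> where \<rho>: "\<rho> \<in> polys V" "\<beta>2 - \<beta>1 = \<rho> * M"
    using polys_quotient polys_diff[OF lo(1) hi(1)] by metis
  define \<epsilon> where "\<epsilon> v = (if v \<le> m then \<epsilon>2 v else \<epsilon>1 v)" for v
  have "formed \<alpha> \<beta>1 \<rho> \<epsilon>"
    unfolding formed_def
  proof (intro conjI allI impI)
    fix v assume "v \<le> n"
    then show "?g v = \<beta>1 + (if v \<le> m then \<rho> * M else 0) + \<epsilon> v * X v ^ r v"
      using lo(3)[of v] hi(3)[of v] unfolding \<epsilon>_def \<rho>(2)[symmetric] by auto
  next
    show "(\<Sum>v\<in>{0..m}. X z ^ (r v - r 0) * \<epsilon> v) = 0"
      using lo(4) by (simp add: \<epsilon>_def)
    have "(\<Sum>v\<in>{m+1..n}. X z ^ (r v - r (m+1)) * \<epsilon> v) = (\<Sum>v\<in>{m+1..n}. X z ^ (r v - r (m+1)) * \<epsilon>1 v)"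
      by (intro sum.cong) (auto simp: \<epsilon>_def)
    with hi(4) show "(\<Sum>v\<in>{m+1..n}. X z ^ (r v - r (m+1)) * \<epsilon> v) = 0" by simp
  qed
  moreover have "\<epsilon> v \<in> polys V" if "v \<le> n" for v
    using lo(2)[of v] hi(2)[of v] that by (auto simp: \<epsilon>_def)
  ultimately show ?thesis
    using that[of \<alpha> \<beta>1 \<rho> \<epsilon>] \<alpha> hi(1) \<rho>(1) by blast
qed

text \<open>Expanding over the labelled solutions and the Euler derivation and then applying the
  result to F fixes the Euler coefficient \<alpha>_z; it is exactly the correction built into
  \<open>basis_vec\<close>.\<close>

lemma basis_spans:
  assumes poly: "\<And>v. v \<in> V \<Longrightarrow> u v \<in> polys V" and zero: "derv u F = 0"
  obtains c where "\<And>l. l \<le> n \<Longrightarrow> c l \<in> polys V"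
    "\<And>p. p \<in> polys V \<Longrightarrow> derv u p = (\<Sum>l\<in>{0..n}. c l * derv (basis_vec l) p)"
proof -
  obtain \<alpha> \<beta> \<rho> \<epsilon> where \<alpha>: "\<And>v. v \<in> V \<Longrightarrow> u v = \<alpha> v * X v" "\<And>v. v \<in> V \<Longrightarrow> \<alpha> v \<in> polys V"
    and c_polys: "\<beta> \<in> polys V" "\<rho> \<in> polys V" "\<And>v. v \<le> n \<Longrightarrow> \<epsilon> v \<in> polys V"
    and formed: "formed \<alpha> \<beta> \<rho> \<epsilon>"
    using Der0_formed[OF poly zero] by metis
  define c where "c l = (if l = 0 then \<beta> else if l = m + 1 then \<rho> else \<epsilon> l)" for l
  have c: "c l \<in> polys V" if "l \<le> n" for l
    using c_polys that by (simp add: c_def)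
  have expand: "\<alpha> v = \<alpha> z + (\<Sum>l\<in>{0..n}. c l * lab_alpha l v)" if "v \<in> V" for v
    using formed_expand[OF formed, of v] that by (simp add: c_def)
  let ?d = "Const (of_nat deg_F) :: (nat, 'k) mpoly"
  let ?i = "Const (inverse (of_nat deg_F)) :: (nat, 'k) mpoly"
  \<comment> \<open>The extra label n + 1 stands for the Euler derivation, with coefficient
    \<alpha>_z.\<close>
  have "derv u F = (\<Sum>l\<in>insert (n+1) {0..n}. (if l = n + 1 then \<alpha> z else c l) *
      derv (\<lambda>v. (if l = n + 1 then 1 else lab_alpha l v) * X v) F)"
  proof (rule derv_linear[OF F_polys])
    fix v assume v: "v \<in> V"
    have "(\<Sum>l\<in>{0..n}. (if l = n + 1 then \<alpha> z else c l) * ((if l = n + 1 then 1 else lab_alpha l v) * X v)) =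
        (\<Sum>l\<in>{0..n}. c l * lab_alpha l v) * X v"
      unfolding sum_distrib_right by (intro sum.cong) auto
    then show "u v = (\<Sum>l\<in>insert (n+1) {0..n}. (if l = n + 1 then \<alpha> z else c l) *
        ((if l = n + 1 then 1 else lab_alpha l v) * X v))"
      using \<alpha>(1)[OF v] expand[OF v] by (simp add: algebra_simps)
  qed
  also have "\<dots> = \<alpha> z * dlog (\<lambda>_. 1) F + (\<Sum>l\<in>{0..n}. c l * dlog (lab_alpha l) F)"
    by (subst sum.insert) (auto intro!: sum.cong)
  also have "(\<Sum>l\<in>{0..n}. c l * dlog (lab_alpha l) F) = (\<Sum>l\<in>{0..n}. c l * lam l) * F"
    unfolding sum_distrib_right by (intro sum.cong) (auto simp: dlog_lab)
  finally have "(\<alpha> z * ?d + (\<Sum>l\<in>{0..n}. c l * lam l)) * F = 0"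
    unfolding zero dlog_euler by (simp add: algebra_simps)
  \<comment> \<open>Killing F, rather than only mapping it to a multiple of itself, removes the
    Euler direction: \<alpha>_z is determined by the other coefficients.\<close>
  then have "\<alpha> z * ?d = - (\<Sum>l\<in>{0..n}. c l * lam l)"
    using F_neq_0 by (simp add: add_eq_0_iff2)
  then have "\<alpha> z * (?d * ?i) = - (\<Sum>l\<in>{0..n}. c l * lam l) * ?i"
    by (metis mult.assoc)
  then have \<alpha>z: "\<alpha> z = - (\<Sum>l\<in>{0..n}. c l * (?i * lam l))"
    unfolding deg_F_cancel by (simp add: sum_distrib_left mult_ac)
  have "u v = (\<Sum>l\<in>{0..n}. c l * basis_vec l v)" if v: "v \<in> V" for v
  proof -
    have "\<alpha> v = (\<Sum>l\<in>{0..n}. c l * (lab_alpha l v - ?i * lam l))"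
      unfolding expand[OF v] \<alpha>z right_diff_distrib sum_subtractf by simp
    then show ?thesis
      unfolding \<alpha>(1)[OF v] by (simp add: basis_vec_def sum_distrib_right mult.assoc)
  qed
  then have "derv u p = (\<Sum>l\<in>{0..n}. c l * derv (basis_vec l) p)" if "p \<in> polys V" for p
    by (rule derv_linear[OF that])
  with c that show ?thesis by blast
qed

text \<open>A vanishing combination has all its logarithmic coefficients equal to one \<kappa>,
  which the variable x_z shows to be 0. The two block sums then isolate the labels 0 and m + 1, and
  every other label is read off at its own index.\<close>

lemma basis_independent:
  assumes "\<And>v. v \<in> V \<Longrightarrow> (\<Sum>l\<in>{0..n}. c l * basis_vec l v) = 0" and "l \<le> n"
  shows "c l = 0"
proof -
  let ?i = "Const (inverse (of_nat deg_F)) :: (nat, 'k) mpoly"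
  define \<kappa> where "\<kappa> = (\<Sum>l\<in>{0..n}. c l * (?i * lam l))"
  have eq: "(\<Sum>l\<in>{0..n}. c l * lab_alpha l v) = \<kappa>" if "v \<in> V" for v
  proof -
    have "((\<Sum>l\<in>{0..n}. c l * lab_alpha l v) - \<kappa>) * X v = 0"
      using assms(1)[OF that]
      by (simp add: basis_vec_def \<kappa>_def sum_distrib_right mult.assoc flip: sum_subtractf right_diff_distrib)
    then show ?thesis by simp
  qed
  from eq[of z] have "\<kappa> = 0"
    by (simp only: lab_alpha_z mult_zero_right sum.neutral_const atMost_iff order_refl)
  define \<epsilon> where "\<epsilon> v = (\<Sum>l\<in>{0..n}. c l * lab_eps l v)" for v
  have gam: "c 0 + (if v \<le> m then c (m+1) * M else 0) + \<epsilon> v * X v ^ r v = 0" if v: "v \<le> n" for v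
  proof -
    have "(\<Sum>l\<in>{0..n}. c l * lab_gam l v) = of_nat (r v) * (\<Sum>l\<in>{0..n}. c l * lab_alpha l v)"
      unfolding sum_distrib_left by (intro sum.cong refl) (simp only: r_lab_alpha[OF v, symmetric] mult_ac)
    then show ?thesis
      using eq[of v] v \<open>\<kappa> = 0\<close> unfolding lab_gam_sum \<epsilon>_def by simp
  qed
  have sum0: "(\<Sum>v\<in>J. w v * \<epsilon> v) = 0" if "\<And>l. l \<le> n \<Longrightarrow> (\<Sum>v\<in>J. w v * lab_eps l v) = 0" for J w
  proof -
    have "(\<Sum>v\<in>J. w v * \<epsilon> v) = (\<Sum>l\<in>{0..n}. c l * (\<Sum>v\<in>J. w v * lab_eps l v))"
      unfolding \<epsilon>_def sum_distrib_left by (subst sum.swap) (simp add: mult_ac)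
    with that show ?thesis by simp
  qed
  have lo0: "(\<Sum>v\<in>{0..m}. X z ^ (r v - r 0) * \<epsilon> v) = 0"
    by (rule sum0) (rule lab_eps_sums)
  have hi0: "(\<Sum>v\<in>{m+1..n}. X z ^ (r v - r (m+1)) * \<epsilon> v) = 0"
    by (rule sum0) (rule lab_eps_sums)
  \<comment> \<open>Forming the block sum kills the \<epsilon> part by its linear relation and
    leaves the constant part times \<open>glo\<close>.\<close>
  have "lo.W (\<lambda>v. (c 0 + c (m+1) * M) + \<epsilon> v * X v ^ r v) = lo.W (\<lambda>_. 0)"
  proof (rule lo.W_cong)
    fix i assume "i \<in> {0..m}"
    then show "c 0 + c (m+1) * M + \<epsilon> i * X i ^ r i = 0"
      using gam[of i] m_less_n by simp
  qed
  then have "(c 0 + c (m+1) * M) * glo = 0"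
    unfolding lo.W_add lo_W_const lo.W_X_power lo0 by (simp add: distrib_right)
  then have \<beta>2: "c 0 + c (m+1) * M = 0"
    using glo_neq_0 by (metis mult_eq_0_iff)
  have "hi.W (\<lambda>v. c 0 + \<epsilon> v * X v ^ r v) = hi.W (\<lambda>_. 0)"
  proof (rule hi.W_cong)
    fix i assume "i \<in> {m+1..n}"
    then show "c 0 + \<epsilon> i * X i ^ r i = 0"
      using gam[of i] by simp
  qed
  then have "c 0 * ghi = 0"
    unfolding hi.W_add hi_W_const hi.W_X_power hi0 by simp
  then have c0: "c 0 = 0"
    using ghi_neq_0 by (metis mult_eq_0_iff)
  with \<beta>2 have cm: "c (m+1) = 0"
    using M_neq_0 by simp
  show ?thesis
  proof (cases "l = 0 \<or> l = m + 1")
    case True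
    with c0 cm show ?thesis by auto
  next
    case False
    have "\<epsilon> l = (\<Sum>l'\<in>{0..n}. if l' = l then c l else 0)"
      unfolding \<epsilon>_def using False by (intro sum.cong) (auto simp: lab_eps_def base_def)
    also have "\<dots> = c l"
      using assms(2) by simp
    finally have "\<epsilon> l = c l" .
    moreover have "c 0 + (if l \<le> m then c (m+1) * M else 0) = 0"
      by (simp only: c0 cm) simp
    ultimately have "c l * X l ^ r l = 0"
      using gam[OF assms(2)] by (metis add_0)
    then show ?thesis by simp
  qed
qed

text \<open>L is an arbitrary enumeration of the labels, so the exponents can be produced in
  whatever order a statement lists them.\<close>

theorem free_divisor_F:
  assumes "distinct L" and "set L = {0..n}"
  shows "free_divisor n F (map (\<lambda>l. lab_deg l + 1) L)"
  unfolding free_divisor_def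
proof (intro conjI exI[of _ "\<lambda>j. restrict (derv (basis_vec (L ! j))) (polys V)"] allI impI)
  show len: "length (map (\<lambda>l. lab_deg l + 1) L) = n + 1"
    using distinct_card[OF assms(1)] assms(2) by simp
  then have len': "length L = n + 1" by simp
  have bij: "bij_betw (nth L) {..<n+1} {0..n}"
    using bij_betw_nth[OF assms(1)] len' assms(2) by simp
  then have L: "L ! j \<le> n" if "j < n + 1" for j
    using that by (auto simp: bij_betw_def)
  show "F \<in> polys V" "\<exists>d. homogeneous d F" "squarefree F"
    by (rule F_polys homogeneous_F squarefree_F)+
  show "der_homogeneous V (map (\<lambda>l. lab_deg l + 1) L ! j) (restrict (derv (basis_vec (L ! j))) (polys V))"
    if "j < n + 1" for j
    unfolding der_homogeneous_def using homogeneous_basis_vec[OF L[OF that]] that len' by simp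
  show "is_basis V (Der0 V F) (n + 1) (\<lambda>j. restrict (derv (basis_vec (L ! j))) (polys V))"
    unfolding is_basis_def
  proof (intro conjI allI impI ballI)
    fix j assume j: "j < n + 1"
    show "restrict (derv (basis_vec (L ! j))) (polys V) \<in> Der0 V F"
      unfolding Der0_def using derv_in_Der[of V "basis_vec (L ! j)"] basis_vec_polys
        derv_basis_vec[OF L[OF j]] F_polys by simp
  next
    fix \<delta> assume "\<delta> \<in> Der0 V F"
    then have \<delta>: "\<delta> \<in> Der V" "\<delta> F = 0" by (auto simp: Der0_def)
    then have poly: "\<delta> (X v) \<in> polys V" if "v \<in> V" for v
      using that unfolding Der_def by (auto simp: PiE_def Pi_def)
    have eq: "\<delta> p = derv (\<lambda>v. \<delta> (X v)) p" if "p \<in> polys V" for p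
      using Der_eq_derv[OF \<delta>(1) that] by simp
    then have zero: "derv (\<lambda>v. \<delta> (X v)) F = 0"
      using \<delta>(2) F_polys by simp
    obtain c where c: "\<And>l. l \<le> n \<Longrightarrow> c l \<in> polys V"
        "\<And>p. p \<in> polys V \<Longrightarrow> derv (\<lambda>v. \<delta> (X v)) p = (\<Sum>l\<in>{0..n}. c l * derv (basis_vec l) p)"
      by (rule basis_spans[OF poly zero]) blast+
    show "\<exists>c. (\<forall>j<n + 1. c j \<in> polys V) \<and> (\<forall>g\<in>polys V. \<delta> g =
        (\<Sum>j<n + 1. c j * restrict (derv (basis_vec (L ! j))) (polys V) g))"
    proof (intro exI[of _ "\<lambda>j. c (L ! j)"] conjI allI impI ballI)
      show "c (L ! j) \<in> polys V" if "j < n + 1" for j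
        using c(1) L that by blast
      fix g :: "(nat, 'k) mpoly" assume "g \<in> polys V"
      then show "\<delta> g = (\<Sum>j<n + 1. c (L ! j) * restrict (derv (basis_vec (L ! j))) (polys V) g)"
        using eq c(2) sum.reindex_bij_betw[OF bij, of "\<lambda>l. c l * derv (basis_vec l) g"] by simp
    qed
  next
    fix c j
    assume "(\<forall>j<n + 1. c j \<in> polys V) \<and>
      (\<forall>g\<in>polys V. (\<Sum>j<n + 1. c j * restrict (derv (basis_vec (L ! j))) (polys V) g) = 0)" and j: "j < n + 1"
    then have zero: "(\<Sum>j<n + 1. c j * basis_vec (L ! j) v) = 0" if "v \<in> V" for v
      using that by (auto dest!: bspec[of _ _ "X v"])
    \<comment> \<open>Coefficients indexed by positions in L are moved to labels, where independence
      is known.\<close>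
    define c' where "c' l = c (inv_into {..<n+1} (nth L) l)" for l
    have c': "c' (L ! j) = c j" if "j < n + 1" for j
      using bij that unfolding c'_def bij_betw_def by (simp add: inv_into_f_f)
    have "(\<Sum>l\<in>{0..n}. c' l * basis_vec l v) = 0" if "v \<in> V" for v
    proof -
      have "(\<Sum>j<n + 1. c' (L ! j) * basis_vec (L ! j) v) = (\<Sum>j<n + 1. c j * basis_vec (L ! j) v)"
        by (intro sum.cong refl) (simp only: c' lessThan_iff)
      then have "(\<Sum>j<n + 1. c' (L ! j) * basis_vec (L ! j) v) = 0"
        using zero[OF that] by simp
      then show ?thesis
        using sum.reindex_bij_betw[OF bij, of "\<lambda>l. c' l * basis_vec l v"] by simp
    qed
    then have "c' (L ! j) = 0"
      using L[OF j] by (rule basis_independent)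
    with c' j show "c j = 0" by simp
  qed
qed

end

section \<open>Reduced polynomials\<close>

lemma homogenize_homogeneous:
  fixes p :: "('v, 'a::comm_ring_1) mpoly"
  assumes "homogeneous d p" and "p \<noteq> 0"
  shows "homogenize z p = p"
  using homogenize_sum_homogeneous[of "{()}" "\<lambda>_. d" "\<lambda>_. p" d z] assms total_deg_homogeneous[OF assms]
  by simp

lemma homogenize_dehomogenize:
  fixes p :: "('v, 'a::comm_ring_1) mpoly"
  assumes "p \<in> polys W" and "z \<notin> W"
  shows "msubst Const (\<lambda>v. if v = z then 1 else X v) (homogenize z p) = p"
proof -
  let ?x = "\<lambda>v. if v = z then 1 else X v :: ('v, 'a) mpoly"
  have "mon_val ?x (m + Poly_Mapping.single z k) = mon_val X m" if "m \<in> Poly_Mapping.keys p" for m k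
  proof -
    have "z \<notin> Poly_Mapping.keys m"
      using that assms by (auto simp: polys_def)
    then have "mon_val ?x m = mon_val X m"
      unfolding mon_val_def by (intro prod.cong) auto
    then show ?thesis
      by (simp add: mon_val_add)
  qed
  then have "msubst Const ?x (homogenize z p) =
      (\<Sum>m\<in>Poly_Mapping.keys p. Poly_Mapping.single m (Poly_Mapping.lookup p m))"
    unfolding homogenize_def Const_hom.msubst_sum Const_hom.msubst_single
    by (intro sum.cong refl) (simp add: single_eq_mon_val)
  then show ?thesis
    by (simp only: poly_mapping_expansion[symmetric])
qed

text \<open>Homogenization is multiplicative and is undone by setting x_z to 1, so a square divisor
  of f homogenizes to one of the homogenized polynomial.\<close>

lemma squarefree_of_homogenize:
  fixes f :: "('v::linorder, 'a::field) mpoly"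
  assumes "squarefree (homogenize z f)" and "f \<in> polys W" and "z \<notin> W"
  shows "squarefree f"
proof (rule squarefreeI)
  fix x assume x: "x\<^sup>2 dvd f"
  then obtain w where "f = x\<^sup>2 * w" ..
  then have w: "f = x * (x * w)"
    by (simp add: power2_eq_square mult.assoc)
  have "f \<noteq> 0"
    using assms(1) by (auto simp: homogenize_def)
  with w assms(2) have "x \<in> polys W"
    by (metis polys_divisor_closed(1))
  have "(homogenize z x)\<^sup>2 dvd homogenize z f"
    unfolding w homogenize_mult by (simp add: power2_eq_square mult.assoc[symmetric])
  with assms(1) have "homogenize z x dvd 1"
    by (rule squarefreeD)
  from Const_hom.msubst_dvd[OF this, of "\<lambda>v. if v = z then 1 else X v"] show "x dvd 1"
    using homogenize_dehomogenize[OF \<open>x \<in> polys W\<close> assms(3)] by simp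
qed

section \<open>Affine block sums and their homogenization\<close>

context block
begin

definition affine :: "(nat \<Rightarrow> 'a::comm_ring_1) \<Rightarrow> (nat, 'a) mpoly" where
  "affine c = (\<Sum>i\<in>J. Const (c i) * (\<Prod>j\<in>J - {i}. X j ^ r j))"

lemma homogeneous_affine_term:
  assumes "i \<in> J"
  shows "homogeneous (sum r J - r i) (Const (c i) * (\<Prod>j\<in>J - {i}. X j ^ r j) :: (nat, 'a::comm_ring_1) mpoly)"
proof -
  have "sum r J - r i = sum r (J - {i})"
    using assms finite_J by (simp add: sum.remove[of J i])
  then show ?thesis
    by (simp only:) (intro homogeneous_Const_mult homogeneous_prod homogeneous_X_power)
qed

text \<open>The terms of top degree are those whose exponent equals r b; their sum has to be shown
  nonzero.\<close>

lemma total_deg_affine: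
  assumes "c b \<noteq> 0"
  shows "total_deg (affine c) = sum r J - r b"
  unfolding affine_def
proof (rule total_deg_sum_homogeneous[OF finite_J homogeneous_affine_term])
  show "sum r J - r i \<le> sum r J - r b" if "i \<in> J" for i
    using r_min[OF that] by simp
  let ?S = "\<Sum>i | i \<in> J \<and> sum r J - r i = sum r J - r b. Const (c i) * (\<Prod>j\<in>J - {i}. X j ^ r j)"
  \<comment> \<open>At this point only the term of index b survives, with value c b.\<close>
  define x where "x j = (if j = b then 0 else 1 :: 'a)" for j
  have "msubst (\<lambda>a. a) x ?S = (\<Sum>i | i \<in> J \<and> sum r J - r i = sum r J - r b. if i = b then c b else 0)"
    unfolding id_hom.msubst_simps id_hom.msubst_Const id_hom.msubst_X
  proof (intro sum.cong refl)
    fix i assume i: "i \<in> {i \<in> J. sum r J - r i = sum r J - r b}"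
    show "c i * (\<Prod>j\<in>J - {i}. x j ^ r j) = (if i = b then c b else 0)"
    proof (cases "i = b")
      case False
      then have "(\<Prod>j\<in>J - {i}. x j ^ r j) = x b ^ r b * (\<Prod>j\<in>J - {i} - {b}. x j ^ r j)"
        using finite_J b_in_J by (intro prod.remove) auto
      then show ?thesis
        using False r_pos[OF b_in_J] by (simp add: x_def zero_power)
    qed (simp add: x_def)
  qed
  also have "\<dots> = c b"
    using b_in_J finite_J by simp
  finally show "?S \<noteq> 0"
    using assms by (metis id_hom.msubst_0)
qed

lemma homogenize_affine:
  assumes "c b \<noteq> 0"
  shows "homogenize z (affine c) = W (\<lambda>i. Const (c i))"
proof -
  have "homogenize z (affine c) =
      (\<Sum>i\<in>J. X z ^ (sum r J - r b - (sum r J - r i)) * (Const (c i) * (\<Prod>j\<in>J - {i}. X j ^ r j)))"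
    unfolding affine_def
  proof (rule homogenize_sum_homogeneous[OF finite_J homogeneous_affine_term])
    show "sum r J - r i \<le> sum r J - r b" if "i \<in> J" for i
      using r_min[OF that] by simp
  qed (use total_deg_affine[of c] assms in \<open>simp_all add: affine_def\<close>)
  also have "\<dots> = W (\<lambda>i. Const (c i))"
    unfolding W_def
  proof (intro sum.cong refl)
    fix i assume i: "i \<in> J"
    have "r i \<le> sum r J" "r b \<le> r i"
      using i finite_J r_min by (auto intro: member_le_sum)
    then have "sum r J - r b - (sum r J - r i) = r i - r b" by simp
    then show "X z ^ (sum r J - r b - (sum r J - r i)) * (Const (c i) * (\<Prod>j\<in>J - {i}. X j ^ r j)) = Const (c i) * cof i"
      unfolding cof_def by (simp only: mult_ac)
  qed
  finally show ?thesis .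
qed

lemma affine_polys: "affine c \<in> polys J"
  unfolding affine_def by (intro polys_sum polys_mult polys_prod polys_power polys_Const) auto

end

text \<open>Since f divides a power of g and g divides f, both have the same primes. Squarefreeness
  makes the irreducible factors of g pairwise non-associated, so their list is a set of
  representatives.\<close>

lemma is_redI:
  fixes g :: "('v::linorder, 'a::field) mpoly"
  assumes "squarefree g" and "\<not> g dvd 1" and "g dvd f" and "f dvd g ^ k"
  shows "is_red f g"
proof -
  have "g \<noteq> 0" using assms(1) by auto
  then obtain ps where ps: "\<forall>q\<in>set ps. irreducible q" "prod_list ps = g"
    using irreducible_factorization assms(2) by blast
  \<comment> \<open>Covers both a repeated factor and two associated ones.\<close>
  have no_sq: "\<not> p * q dvd g" if "p \<in> set ps" "p dvd q" for p q
  proof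
    assume "p * q dvd g"
    then have "p\<^sup>2 dvd g"
      unfolding power2_eq_square by (rule dvd_trans[OF mult_dvd_mono[OF dvd_refl that(2)]])
    with assms(1) ps(1) that(1) show False
      using squarefreeD irreducible_not_unit by blast
  qed
  have "distinct ps"
  proof (rule ccontr)
    assume "\<not> distinct ps"
    then obtain xs ys zs y where "ps = xs @ [y] @ ys @ [y] @ zs"
      using not_distinct_decomp by blast
    then have "g = y * y * (prod_list xs * prod_list ys * prod_list zs)" "y \<in> set ps"
      using ps(2) by (auto simp: mult_ac)
    then show False
      using no_sq[of y y] by simp
  qed
  then have prod: "g = \<Prod>(set ps)"
    using ps(2) by (simp add: prod.distinct_set_conv_list)
  have unique: "p = p'" if "p \<in> set ps" "p' \<in> set ps" "p dvd p'" for p p'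
  proof (rule ccontr)
    assume "p \<noteq> p'"
    then have "g = p * (p' * \<Prod>(set ps - {p} - {p'}))"
      using that unfolding prod by (simp add: prod.remove[of "set ps" p] prod.remove[of "set ps - {p}" p'])
    then have "p * p' dvd g" by (simp add: mult.assoc[symmetric])
    with no_sq that show False by blast
  qed
  show ?thesis
    unfolding is_red_def
  proof (intro exI[of _ "set ps"] conjI ballI allI impI)
    fix p assume p: "p \<in> set ps"
    with ps prod_list_dvd assms(3) show "irreducible p" "p dvd f"
      using dvd_trans by blast+
  next
    fix q assume q: "irreducible q \<and> q dvd f"
    then have prime: "prime_elem q"
      using irreducible_imp_prime_elem_mpoly by blast
    have "q dvd g"
      using q assms(4) prime prime_elem_dvd_power dvd_trans by blast
    with prime obtain p where p: "p \<in> set ps" "q dvd p"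
      using prime_elem_dvd_prod[of q "\<lambda>x. x" "set ps"] prod by auto
    then have pq: "p dvd q"
      using prime_dvd_irreducible prime ps(1) by blast
    show "\<exists>!p. p \<in> set ps \<and> p dvd q \<and> q dvd p"
    proof (rule ex1I)
      show "p \<in> set ps \<and> p dvd q \<and> q dvd p"
        using p pq by blast
      fix p' assume "p' \<in> set ps \<and> p' dvd q \<and> q dvd p'"
      then show "p' = p"
        using unique[of p' p] p(1) dvd_trans[OF _ p(2), of p'] by blast
    qed
  qed (use prod in auto)
qed

text \<open>The representatives in P are pairwise non-associated, so their product is squarefree and
  it suffices that each of them divides g'. By symmetry two reduced polynomials of f differ by a
  unit.\<close>

lemma is_red_dvd:
  fixes g g' :: "('v::linorder, 'a::field) mpoly"
  assumes "is_red f g" and "is_red f g'"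
  shows "g dvd g'"
proof -
  from assms(1) obtain P where "finite P \<and> (\<forall>p \<in> P. irreducible p \<and> p dvd f) \<and>
      (\<forall>q. irreducible q \<and> q dvd f \<longrightarrow> (\<exists>!p. p \<in> P \<and> p dvd q \<and> q dvd p)) \<and> g = \<Prod>P"
    unfolding is_red_def by (rule exE)
  then have P: "finite P" "\<And>p. p \<in> P \<Longrightarrow> irreducible p" "\<And>p. p \<in> P \<Longrightarrow> p dvd f" "g = \<Prod>P"
    and unique: "\<And>q. irreducible q \<Longrightarrow> q dvd f \<Longrightarrow> \<exists>!p. p \<in> P \<and> p dvd q \<and> q dvd p"
    by simp_all
  from assms(2) obtain P' where "finite P' \<and> (\<forall>p \<in> P'. irreducible p \<and> p dvd f) \<and>
      (\<forall>q. irreducible q \<and> q dvd f \<longrightarrow> (\<exists>!p. p \<in> P' \<and> p dvd q \<and> q dvd p)) \<and> g' = \<Prod>P'"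
    unfolding is_red_def by (rule exE)
  then have P': "finite P'" "g' = \<Prod>P'"
    and unique': "\<And>q. irreducible q \<Longrightarrow> q dvd f \<Longrightarrow> \<exists>!p. p \<in> P' \<and> p dvd q \<and> q dvd p"
    by simp_all
  have ex': "\<exists>p\<in>P'. q dvd p" if "irreducible q" "q dvd f" for q
    using ex1_implies_ex[OF unique'[OF that]] by blast
  have "\<Prod>P dvd g'"
  proof (rule prod_dvd_of_dvd[OF P(1)])
    fix p assume p: "p \<in> P"
    then obtain p' where "p' \<in> P'" "p dvd p'"
      using ex'[OF P(2)[OF p] P(3)[OF p]] by (elim bexE)
    then show "p dvd g'"
      using dvd_trans[of p p'] dvd_prodI[OF P'(1), of p' "\<lambda>x. x"] P'(2) by simp
  next
    show "squarefree (\<Prod>P)"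
    proof (rule squarefree_prod_mpoly[OF P(1)])
      show "squarefree p" if "p \<in> P" for p
        by (rule squarefree_irreducible_mpoly[OF P(2)[OF that]])
    next
      fix p p' q assume p: "p \<in> P" "p' \<in> P" "p \<noteq> p'" and q: "prime_elem q" "q dvd p"
      show "\<not> q dvd p'"
      proof
        assume "q dvd p'"
        then have "p dvd q" "p' dvd q"
          using prime_dvd_irreducible q p P(2) by blast+
        with q \<open>q dvd p'\<close> have "p dvd p'" "p' dvd p"
          using dvd_trans by blast+
        moreover have "\<exists>!p''. p'' \<in> P \<and> p'' dvd p \<and> p dvd p''"
          using unique P(2,3) p(1) by simp
        ultimately show False
          using p dvd_refl by metis
      qed
    qed
  qed
  with P(4) show ?thesis by simp
qed

lemma is_red_unique:
  fixes g g' :: "('v::linorder, 'a::field) mpoly"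
  assumes "is_red f g" and "is_red f g'" and "g' \<noteq> 0"
  obtains c where "c \<noteq> 0" "g = Const c * g'"
proof -
  obtain u w where u: "g' = g * u" and w: "g = g' * w"
    using is_red_dvd assms by (metis dvdE)
  then have "g' * (w * u) = g' * 1"
    by (simp add: mult.assoc)
  with assms(3) have "w * u = 1"
    by (metis mult_left_cancel)
  then have "w dvd 1"
    by (metis dvd_triv_left)
  then obtain c where "c \<noteq> 0" "w = Const c"
    by (rule unitE)
  with w that show ?thesis
    by (simp add: mult.commute)
qed

text \<open>A nonzero constant changes neither the annihilating derivations nor squarefreeness; this
  makes freeness independent of the choice made by \<open>is_red\<close>.\<close>

lemma free_divisor_scale:
  fixes f :: "(nat, 'a::field) mpoly"
  assumes "free_divisor n f es" and "c \<noteq> 0"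
  shows "free_divisor n (Const c * f) es"
proof -
  have f: "f \<in> polys {..n+1}" "squarefree f" "\<exists>d. homogeneous d f"
    using assms(1) by (auto simp: free_divisor_def)
  have "\<delta> (Const c * f) = 0 \<longleftrightarrow> \<delta> f = 0" if "\<delta> \<in> Der {..n+1}" for \<delta>
  proof -
    have "\<delta> (Const c * f) = Const c * \<delta> f"
      using that f(1) by (auto simp: Der_def)
    then show ?thesis
      using assms(2) by simp
  qed
  then have "Der0 {..n+1} (Const c * f) = Der0 {..n+1} f"
    unfolding Der0_def by blast
  moreover have "squarefree (Const c * f)"
  proof (rule squarefree_mono[OF _ f(2)])
    have "f = Const (inverse c) * (Const c * f)"
      unfolding mult.assoc[symmetric] Const_inverse_mult(1)[OF assms(2)] by simp
    then show "Const c * f dvd f"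
      by (metis dvd_triv_right)
  qed
  ultimately show ?thesis
    using assms(1) f unfolding free_divisor_def
    by (auto intro: polys_mult homogeneous_Const_mult)
qed

context exponents
begin

definition base_red :: "(nat, 'a::comm_ring_1) mpoly" where
  "base_red = prod X {0..n} * (lo.affine (\<lambda>_. 1) * hi.affine (\<lambda>_. 1))"

lemma homogenize_lo_affine: "homogenize (n+1) (lo.affine (\<lambda>_. 1)) = (glo :: (nat, 'a::comm_ring_1) mpoly)"
  using lo.homogenize_affine[of "\<lambda>_. 1::'a"] by (simp only: glo_def Const_1) simp

lemma homogenize_hi_affine: "homogenize (n+1) (hi.affine (\<lambda>_. 1)) = (ghi :: (nat, 'a::comm_ring_1) mpoly)"
  using hi.homogenize_affine[of "\<lambda>_. 1::'a"] by (simp only: ghi_def Const_1) simp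

lemma homogenize_base_red:
  "homogenize (n+1) base_red = prod X {0..n} * (glo * (ghi :: (nat, 'a::idom) mpoly))"
proof -
  have "homogeneous (\<Sum>j\<in>{0..n}. 1) (prod X {0..n} :: (nat, 'a) mpoly)"
    by (intro homogeneous_prod homogeneous_X)
  then have "homogenize (n+1) (prod X {0..n}) = (prod X {0..n} :: (nat, 'a) mpoly)"
    by (rule homogenize_homogeneous) simp
  then show ?thesis
    unfolding base_red_def homogenize_mult homogenize_lo_affine homogenize_hi_affine by (rule arg_cong)
qed

lemma members_axioms_empty: "members n m r {} (a :: nat \<Rightarrow> 'k::field_char_0) b"
  by unfold_locales auto

lemma X_base_red_eq_F:
  "X (n+1) * homogenize (n+1) base_red = members.F n m r {} a (b :: nat \<Rightarrow> 'k::field_char_0)"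
proof -
  interpret E: members n m r "{}" a b by (rule members_axioms_empty)
  have "prod X {..n+1} = X (n+1) * (prod X {0..n} :: (nat, 'k) mpoly)"
    by (simp add: atLeast0AtMost mult.commute)
  then show ?thesis
    unfolding homogenize_base_red E.F_def E.M_def by (simp add: mult.assoc)
qed

lemma base_divisor_eq:
  "X (n+1) * homogenize (n+1) base_red = (base_divisor n m r :: (nat, 'k::field_char_0) mpoly)"
proof -
  have "{0..n+1} = insert (n+1) {0..n}" by auto
  then have "(\<Prod>i=0..n+1. X i) = X (n+1) * (prod X {0..n} :: (nat, 'k) mpoly)"
    by simp
  then show ?thesis
    unfolding homogenize_base_red base_divisor_def glo_def ghi_def lo.W_def hi.W_def lo.cof_def hi.cof_def
    by (simp only: mult_1 mult.assoc)
qed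

lemma base_red_polys: "base_red \<in> polys {0..n}"
  unfolding base_red_def
proof (intro polys_mult polys_prod)
  show "lo.affine (\<lambda>_. 1) \<in> polys {0..n}"
    by (rule subsetD[OF polys_mono lo.affine_polys]) (use m_less_n in auto)
  show "hi.affine (\<lambda>_. 1) \<in> polys {0..n}"
    by (rule subsetD[OF polys_mono hi.affine_polys]) auto
qed simp

text \<open>Inherited from F without members: drop the factor x_(n+1), then dehomogenize.\<close>

lemma squarefree_base_red: "squarefree (base_red :: (nat, 'k::field_char_0) mpoly)"
proof (rule squarefree_of_homogenize[OF _ base_red_polys])
  interpret E: members n m r "{}" "\<lambda>_. 0" "\<lambda>_. 0 :: 'k" by (rule members_axioms_empty)
  have "squarefree (X (n+1) * homogenize (n+1) (base_red :: (nat, 'k) mpoly))"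
    unfolding X_base_red_eq_F[of "\<lambda>_. 0" "\<lambda>_. 0"] by (rule E.squarefree_F)
  then show "squarefree (homogenize (n+1) (base_red :: (nat, 'k) mpoly))"
    by (rule squarefree_mono[rotated]) simp
qed simp

lemma f1_tilde_eq:
  "f1_tilde n m r = (\<Prod>j\<in>{0..m}. X j ^ r j) * (hi.affine (\<lambda>_. 1) :: (nat, 'a::comm_ring_1) mpoly)"
  unfolding f1_tilde_def h_tilde_def hi.affine_def sum_distrib_left
proof (intro sum.cong refl)
  fix i assume i: "i \<in> {m+1..n}"
  then have "{0..n} - {i} = {0..m} \<union> ({m+1..n} - {i})"
    using m_less_n by auto
  moreover have "{0..m} \<inter> ({m+1..n} - {i}) = {}" by auto
  ultimately show "(\<Prod>j\<in>{0..n} - {i}. X j ^ r j) =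
      (\<Prod>j\<in>{0..m}. X j ^ r j) * (Const 1 * (\<Prod>j\<in>{m+1..n} - {i}. X j ^ r j) :: (nat, 'a) mpoly)"
    by (simp only: prod.union_disjoint finite_atLeastAtMost finite_Diff Const_1 mult_1)
qed

lemma f2_tilde_eq:
  "f2_tilde n m r = phi * (lo.affine (\<lambda>_. 1) :: (nat, 'a::comm_ring_1) mpoly)"
  unfolding f2_tilde_def h_tilde_def lo.affine_def sum_distrib_left phi_def
proof (intro sum.cong refl)
  fix i assume i: "i \<in> {0..m}"
  then have "{0..n} - {i} = {m+1..n} \<union> ({0..m} - {i})"
    using m_less_n by auto
  moreover have "{m+1..n} \<inter> ({0..m} - {i}) = {}" by auto
  ultimately show "(\<Prod>j\<in>{0..n} - {i}. X j ^ r j) =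
      (\<Prod>j\<in>{m+1..n}. X j ^ r j) * (Const 1 * (\<Prod>j\<in>{0..m} - {i}. X j ^ r j) :: (nat, 'a) mpoly)"
    by (simp only: prod.union_disjoint finite_atLeastAtMost finite_Diff Const_1 mult_1)
qed

lemma f_combination:
  "Const a * f1_tilde n m r + Const b * f2_tilde n m r =
    (al.affine (\<lambda>i. if i \<le> m then b else a) :: (nat, 'a::comm_ring_1) mpoly)"
proof -
  have "{0..n} = {0..m} \<union> {m+1..n}" "{0..m} \<inter> {m+1..n} = {}"
    using m_less_n by auto
  then have "al.affine (\<lambda>i. if i \<le> m then b else a) =
      (\<Sum>i\<in>{0..m}. Const (if i \<le> m then b else a) * h_tilde n r i) +
      (\<Sum>i\<in>{m+1..n}. Const (if i \<le> m then b else a) * h_tilde n r i)"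
    unfolding al.affine_def h_tilde_def by (simp only: sum.union_disjoint finite_atLeastAtMost)
  also have "(\<Sum>i\<in>{0..m}. Const (if i \<le> m then b else a) * h_tilde n r i) = Const b * f2_tilde n m r"
    unfolding f2_tilde_def sum_distrib_left by (intro sum.cong) auto
  also have "(\<Sum>i\<in>{m+1..n}. Const (if i \<le> m then b else a) * h_tilde n r i) = Const a * f1_tilde n m r"
    unfolding f1_tilde_def sum_distrib_left by (intro sum.cong) auto
  finally show ?thesis by (simp add: add.commute)
qed

text \<open>Index 0 has the least exponent and lies in the first block, so b is the coefficient
  whose nonvanishing keeps the total degree from dropping.\<close>

lemma homogenize_combination:
  assumes "b \<noteq> 0"
  shows "homogenize (n+1) (Const a * f1_tilde n m r + Const b * f2_tilde n m r) =
    (member a b :: (nat, 'a::comm_ring_1) mpoly)"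
  unfolding f_combination member_def using assms by (intro al.homogenize_affine) simp

lemma homogeneous_X_powers: "homogeneous (sum r A) (\<Prod>j\<in>A. X j ^ r j :: (nat, 'a::comm_ring_1) mpoly)"
  by (intro homogeneous_prod homogeneous_X_power)

lemma prod_X_power_neq_0: "finite A \<Longrightarrow> (\<Prod>j\<in>A. X j ^ r j) \<noteq> (0 :: (nat, 'a::idom) mpoly)"
  by simp

lemma homogenize_f1_tilde:
  "homogenize (n+1) (f1_tilde n m r) = (\<Prod>j\<in>{0..m}. X j ^ r j) * (ghi :: (nat, 'a::idom) mpoly)"
  unfolding f1_tilde_eq homogenize_mult homogenize_hi_affine
  by (subst homogenize_homogeneous[OF homogeneous_X_powers]) (auto intro: prod_X_power_neq_0)

lemma total_deg_f2_tilde: "total_deg (f2_tilde n m r :: (nat, 'a::field) mpoly) = sum r {0..n} - r 0"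
  using al.total_deg_affine[of "\<lambda>i. if i \<le> m then 1 else (0::'a)"] f_combination[of "0::'a" 1]
  by simp

lemma total_deg_f1_tilde: "total_deg (f1_tilde n m r :: (nat, 'a::field) mpoly) = sum r {0..n} - r (m+1)"
proof -
  have ne: "hi.affine (\<lambda>_. 1) \<noteq> (0 :: (nat, 'a) mpoly)"
    using homogenize_hi_affine[where 'a = 'a] ghi_neq_0[where 'a = 'a] by (auto simp: homogenize_def)
  have "r (m+1) \<le> sum r {m+1..n}"
    using m_less_n by (intro member_le_sum) auto
  moreover have "sum r {0..n} = sum r {0..m} + sum r {m+1..n}"
    using m_less_n by (subst sum.union_disjoint[symmetric]) (auto intro: arg_cong[of _ _ "sum r"])
  moreover have "total_deg (\<Prod>j\<in>{0..m}. X j ^ r j :: (nat, 'a) mpoly) = sum r {0..m}"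
    by (intro total_deg_homogeneous homogeneous_X_powers prod_X_power_neq_0) simp
  moreover have "total_deg (hi.affine (\<lambda>_. 1) :: (nat, 'a) mpoly) = sum r {m+1..n} - r (m+1)"
    by (rule hi.total_deg_affine) simp
  ultimately show ?thesis
    unfolding f1_tilde_eq by (subst total_deg_mult[OF prod_X_power_neq_0 ne]) auto
qed

lemma is_red_base_red: "is_red (f1_tilde n m r * f2_tilde n m r) (base_red :: (nat, 'k::field_char_0) mpoly)"
proof (rule is_redI)
  show "squarefree (base_red :: (nat, 'k) mpoly)" by (rule squarefree_base_red)
  have "X 0 dvd (prod X {0..n} :: (nat, 'k) mpoly)"
    by (intro dvd_prodI) auto
  then have "X 0 dvd (base_red :: (nat, 'k) mpoly)"
    unfolding base_red_def by (rule dvd_mult2)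
  then show "\<not> (base_red :: (nat, 'k) mpoly) dvd 1"
    using irreducible_X[of "0::nat"] irreducible_not_unit dvd_trans by blast
  have "{0..n} = {0..m} \<union> {m+1..n}" "{0..m} \<inter> {m+1..n} = {}"
    using m_less_n by auto
  then have X: "(\<Prod>j\<in>{0..n}. X j ^ r j) = (\<Prod>j\<in>{0..m}. X j ^ r j) * (phi :: (nat, 'k) mpoly)"
    unfolding phi_def by (simp only: prod.union_disjoint finite_atLeastAtMost)
  have eq: "f1_tilde n m r * f2_tilde n m r =
      (\<Prod>j\<in>{0..n}. X j ^ r j) * (lo.affine (\<lambda>_. 1) * hi.affine (\<lambda>_. 1) :: (nat, 'k) mpoly)"
    unfolding f1_tilde_eq f2_tilde_eq X by (simp only: mult_ac)
  have "prod X {0..n} dvd (\<Prod>j\<in>{0..n}. X j ^ r j :: (nat, 'k) mpoly)"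
    using r_pos by (intro prod_dvd_prod dvd_power) auto
  then show "base_red dvd f1_tilde n m r * (f2_tilde n m r :: (nat, 'k) mpoly)"
    unfolding eq base_red_def by (intro mult_dvd_mono) auto
  \<comment> \<open>The power r n suffices because it is the largest exponent.\<close>
  have "(\<Prod>j\<in>{0..n}. X j ^ r j) dvd (\<Prod>j\<in>{0..n}. X j ^ r n :: (nat, 'k) mpoly)"
    using r_mono by (intro prod_dvd_prod le_imp_power_dvd) auto
  moreover have "(x :: (nat, 'k) mpoly) dvd x ^ r n" for x
    using r_pos[of n] by (intro dvd_power) simp
  ultimately show "f1_tilde n m r * f2_tilde n m r dvd (base_red :: (nat, 'k) mpoly) ^ r n"
    unfolding eq base_red_def power_mult_distrib[of "prod X {0..n}"] prod_power_distrib
    by (intro mult_dvd_mono)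
qed

end

section \<open>Zariski-open conditions on the coordinates of the members\<close>

definition bigraded :: "'i set \<Rightarrow> ('i \<Rightarrow> nat) \<Rightarrow> ('i \<times> bool, 'a::zero) mpoly \<Rightarrow> bool" where
  "bigraded I d F \<longleftrightarrow> F \<in> polys (I \<times> UNIV) \<and> (\<forall>m \<in> Poly_Mapping.keys F. \<forall>i \<in> I.
     Poly_Mapping.lookup m (i, False) + Poly_Mapping.lookup m (i, True) = d i)"

text \<open>The multidegree, existentially quantified in \<open>multihomogeneous\<close>, is kept as
  a parameter until here, because differences require equal and products require additive
  degrees.\<close>

lemma bigraded_imp_multihomogeneous: "bigraded I d F \<Longrightarrow> multihomogeneous I F"
  by (auto simp: bigraded_def multihomogeneous_def)

lemma bigraded_X: "i \<in> I \<Longrightarrow> bigraded I (\<lambda>k. if k = i then 1 else 0) (X (i, s) :: ('i \<times> bool, 'a::comm_ring_1) mpoly)"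
  by (cases s) (auto simp: bigraded_def X_def polys_def lookup_single when_def)

lemma bigraded_1: "bigraded I (\<lambda>_. 0) (1 :: ('i \<times> bool, 'a::comm_ring_1) mpoly)"
  by (simp add: bigraded_def)

lemma bigraded_mult:
  fixes F G :: "('i \<times> bool, 'a::comm_ring_1) mpoly"
  assumes "bigraded I d F" and "bigraded I e G"
  shows "bigraded I (\<lambda>i. d i + e i) (F * G)"
  unfolding bigraded_def
proof (intro conjI ballI)
  show "F * G \<in> polys (I \<times> UNIV)"
    using assms by (auto simp: bigraded_def intro: polys_mult)
  fix m i assume "m \<in> Poly_Mapping.keys (F * G)" and i: "i \<in> I"
  then obtain k l where "k \<in> Poly_Mapping.keys F" "l \<in> Poly_Mapping.keys G" "m = k + l"
    using keys_mult[of F G] by blast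
  with assms i show "Poly_Mapping.lookup m (i, False) + Poly_Mapping.lookup m (i, True) = d i + e i"
    unfolding bigraded_def by (fastforce simp: lookup_add)
qed

lemma bigraded_diff:
  fixes F G :: "('i \<times> bool, 'a::comm_ring_1) mpoly"
  assumes "bigraded I d F" and "bigraded I d G"
  shows "bigraded I d (F - G)"
proof -
  have "Poly_Mapping.keys (F - G) \<subseteq> Poly_Mapping.keys F \<union> Poly_Mapping.keys G"
    by (auto simp: in_keys_iff lookup_minus)
  with assms show ?thesis
    by (auto simp: bigraded_def intro: polys_diff)
qed

lemma bigraded_prod:
  fixes F :: "'j \<Rightarrow> ('i \<times> bool, 'a::comm_ring_1) mpoly"
  assumes "\<And>j. j \<in> A \<Longrightarrow> bigraded I (d j) (F j)"
  shows "bigraded I (\<lambda>i. \<Sum>j\<in>A. d j i) (prod F A)"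
  using assms
  by (induction A rule: infinite_finite_induct) (auto simp: bigraded_1 intro: bigraded_mult)

text \<open>The product of all coordinates and all 2x2 minors is multihomogeneous, and its
  nonvanishing is exactly the condition that the points are distinct with nonzero
  coordinates.\<close>

lemma generically_distinct:
  fixes I :: "nat set" and Q :: "(nat \<Rightarrow> 'k::field_char_0 \<times> 'k) \<Rightarrow> bool"
  assumes "finite I" and "0 \<notin> I"
    and Q: "\<And>p. (\<And>i. i \<in> I \<Longrightarrow> fst (p i) \<noteq> 0 \<and> snd (p i) \<noteq> 0) \<Longrightarrow>
      (\<And>i j. i \<in> I \<Longrightarrow> j \<in> I \<Longrightarrow> i \<noteq> j \<Longrightarrow> fst (p i) * snd (p j) \<noteq> fst (p j) * snd (p i)) \<Longrightarrow> Q p"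
  shows "generically I Q"
proof -
  let ?x = "\<lambda>p :: nat \<Rightarrow> 'k \<times> 'k. \<lambda>(i, s). if s then snd (p i) else fst (p i)"
  define J where "J = {(i, j). i \<in> I \<and> j \<in> I \<and> i \<noteq> j}"
  have "finite J"
    by (rule finite_subset[of _ "I \<times> I"]) (use assms(1) in \<open>auto simp: J_def\<close>)
  define G :: "(nat \<times> bool, 'k) mpoly" where
    "G = (\<Prod>i\<in>I. X (i, False) * X (i, True)) *
       (\<Prod>q\<in>J. X (fst q, False) * X (snd q, True) - X (snd q, False) * X (fst q, True))"
  have ev: "eval_poly (?x p) G = (\<Prod>i\<in>I. fst (p i) * snd (p i)) *
      (\<Prod>q\<in>J. fst (p (fst q)) * snd (p (snd q)) - fst (p (snd q)) * snd (p (fst q)))" for p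
  proof -
    have diff: "msubst (\<lambda>a. a) y (F - H) = msubst (\<lambda>a. a) y F - msubst (\<lambda>a. a) y H"
      for y and F H :: "(nat \<times> bool, 'k) mpoly"
      using id_hom.msubst_add[of y "F - H" H] by simp
    show ?thesis
      by (simp add: eval_poly_eq_msubst G_def id_hom.msubst_simps id_hom.msubst_X diff)
  qed
  let ?e = "\<lambda>i k. if k = i then 1 else (0::nat)"
  have X: "bigraded I (\<lambda>k. ?e i k + ?e j k) (X (i, s) * X (j, t) :: (nat \<times> bool, 'k) mpoly)"
    if "i \<in> I" "j \<in> I" for i j s t
    by (rule bigraded_mult[OF bigraded_X[OF that(1)] bigraded_X[OF that(2)]])
  have "bigraded I (\<lambda>k. ?e (fst q) k + ?e (snd q) k)
      (X (fst q, False) * X (snd q, True) - X (snd q, False) * X (fst q, True) :: (nat \<times> bool, 'k) mpoly)"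
    if "q \<in> J" for q
  proof -
    from that obtain i j where q: "q = (i, j)" "i \<in> I" "j \<in> I" by (auto simp: J_def)
    have "bigraded I (\<lambda>k. ?e i k + ?e j k) (X (j, False) * X (i, True) :: (nat \<times> bool, 'k) mpoly)"
      using X[OF q(3,2)] by (simp only: add.commute)
    with X[OF q(2,3)] show ?thesis
      unfolding q(1) by (simp add: bigraded_diff)
  qed
  then have "bigraded I (\<lambda>k. (\<Sum>i\<in>I. ?e i k + ?e i k) + (\<Sum>q\<in>J. ?e (fst q) k + ?e (snd q) k)) G"
    unfolding G_def by (intro bigraded_mult[OF bigraded_prod bigraded_prod] X)
  then have "multihomogeneous I G"
    using bigraded_imp_multihomogeneous by blast
  define U where "U = {p \<in> P1_coords I. eval_poly (?x p) G \<noteq> 0}"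
  have "zariski_open I U"
    unfolding zariski_open_def U_def using \<open>multihomogeneous I G\<close> by (intro exI[of _ "{G}"]) auto
  moreover have "U \<noteq> {}"
  proof -
    \<comment> \<open>In characteristic 0 the points [1; i] are distinct, and 0 outside I keeps
      their second coordinates nonzero.\<close>
    define p :: "nat \<Rightarrow> 'k \<times> 'k" where "p = restrict (\<lambda>i. (1, of_nat i)) I"
    have "p \<in> P1_coords I"
      by (auto simp: p_def P1_coords_def)
    moreover have "eval_poly (?x p) G \<noteq> 0"
      unfolding ev using assms(1,2) \<open>finite J\<close> by (auto simp: p_def J_def prod_zero_iff)
    ultimately show ?thesis
      by (auto simp: U_def)
  qed
  moreover have "Q p" if "p \<in> U" for p
  proof (rule Q)
    have nz: "eval_poly (?x p) G \<noteq> 0"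
      using that by (simp add: U_def)
    show "fst (p i) \<noteq> 0 \<and> snd (p i) \<noteq> 0" if "i \<in> I" for i
      using nz that assms(1) unfolding ev by (auto simp: prod_zero_iff)
    show "fst (p i) * snd (p j) \<noteq> fst (p j) * snd (p i)" if "i \<in> I" "j \<in> I" "i \<noteq> j" for i j
      using nz that \<open>finite J\<close> unfolding ev by (auto simp: prod_zero_iff J_def)
  qed
  ultimately show ?thesis
    unfolding generically_def by blast
qed

section \<open>Freeness with the exponents in the required order\<close>

context exponents
begin

lemma middle_exponents_eq:
  assumes "members n m r T a b"
  shows "middle_exponents n m r = map (\<lambda>l. members.lab_deg n m r T l + 1) (filter (\<lambda>i. i \<noteq> m + 1) [1..<n+1])"
proof -
  interpret members n m r T a b by (rule assms)
  show ?thesis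
    by (auto simp: middle_exponents_def lab_deg_def)
qed

lemma set_labels: "{0} \<union> {m + 1} \<union> set (filter (\<lambda>i. i \<noteq> m + 1) [1..<n+1]) = {0..n}"
  using m_less_n by auto

lemma free_base:
  assumes "is_red (f1_tilde n m r * f2_tilde n m r) (g :: (nat, 'k::field_char_0) mpoly)"
  shows "free_divisor n (X (n+1) * homogenize (n+1) g) ([1, 1] @ middle_exponents n m r)"
proof -
  interpret members n m r "{}" "\<lambda>_. 0" "\<lambda>_. 0 :: 'k" by (rule members_axioms_empty)
  have nz: "base_red \<noteq> (0 :: (nat, 'k) mpoly)"
    using squarefree_base_red[where 'k = 'k] by auto
  obtain c where c: "c \<noteq> 0" "g = Const c * base_red"
    by (rule is_red_unique[OF assms is_red_base_red nz])
  have "homogenize (n+1) (Const c) = Const c"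
    using c(1) by (intro homogenize_homogeneous[OF homogeneous_Const]) simp
  then have eq: "X (n+1) * homogenize (n+1) g = Const c * F"
    unfolding c(2) homogenize_mult X_base_red_eq_F[symmetric] by (simp only: mult.left_commute)
  \<comment> \<open>Without members M = 1, so the label m + 1 has degree 0 and gives the second
    exponent 1.\<close>
  let ?L = "[0, m + 1] @ filter (\<lambda>i. i \<noteq> m + 1) [1..<n+1]"
  have "free_divisor n F (map (\<lambda>l. lab_deg l + 1) ?L)"
    by (rule free_divisor_F) (use set_labels in auto)
  moreover have "map (\<lambda>l. lab_deg l + 1) ?L = [1, 1] @ middle_exponents n m r"
    unfolding middle_exponents_eq[OF members_axioms] by (simp add: lab_deg_def)
  ultimately show ?thesis
    unfolding eq using free_divisor_scale c(1) by metis
qed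

lemma free_members:
  fixes p :: "nat \<Rightarrow> 'k::field_char_0 \<times> 'k"
  assumes nz: "\<And>i. i \<in> {3..k} \<Longrightarrow> fst (p i) \<noteq> 0 \<and> snd (p i) \<noteq> 0"
    and distinct: "\<And>i j. i \<in> {3..k} \<Longrightarrow> j \<in> {3..k} \<Longrightarrow> i \<noteq> j \<Longrightarrow> fst (p i) * snd (p j) \<noteq> fst (p j) * snd (p i)"
    and "is_red (f1_tilde n m r * f2_tilde n m r) g"
  shows "free_divisor n
      (X (n+1) * homogenize (n+1) g *
        (\<Prod>i = 3..k. homogenize (n+1) (Const (fst (p i)) * f1_tilde n m r + Const (snd (p i)) * f2_tilde n m r)))
      ([1] @ middle_exponents n m r @ [(k - 2) * (\<Sum>i = 1..n. r i) + 1])"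
proof -
  interpret members n m r "{3..k}" "\<lambda>i. fst (p i)" "\<lambda>i. snd (p i)"
    by unfold_locales (use nz distinct in auto)
  have nz': "base_red \<noteq> (0 :: (nat, 'k) mpoly)"
    using squarefree_base_red[where 'k = 'k] by auto
  obtain c where c: "c \<noteq> 0" "g = Const c * base_red"
    by (rule is_red_unique[OF assms(3) is_red_base_red nz'])
  have Const: "homogenize (n+1) (Const c) = Const c"
    using c(1) by (intro homogenize_homogeneous[OF homogeneous_Const]) simp
  have X: "prod X V = X (n+1) * (prod X {0..n} :: (nat, 'k) mpoly)"
    by (simp add: atLeast0AtMost mult.commute)
  have "(\<Prod>i = 3..k. homogenize (n+1) (Const (fst (p i)) * f1_tilde n m r + Const (snd (p i)) * f2_tilde n m r)) = M"
    unfolding M_def Mi_def using nz by (intro prod.cong refl homogenize_combination) blast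
  then have eq: "X (n+1) * homogenize (n+1) g *
      (\<Prod>i = 3..k. homogenize (n+1) (Const (fst (p i)) * f1_tilde n m r + Const (snd (p i)) * f2_tilde n m r)) =
      Const c * F"
    unfolding c(2) homogenize_mult Const homogenize_base_red F_def X by (simp only: mult_ac)
  \<comment> \<open>The label m + 1 comes last: its degree is that of M, the product of the k - 2
    members.\<close>
  let ?L = "[0] @ filter (\<lambda>i. i \<noteq> m + 1) [1..<n+1] @ [m + 1]"
  have "free_divisor n F (map (\<lambda>l. lab_deg l + 1) ?L)"
    by (rule free_divisor_F) (use set_labels in auto)
  moreover have "map (\<lambda>l. lab_deg l + 1) ?L = [1] @ middle_exponents n m r @ [(k - 2) * (\<Sum>i = 1..n. r i) + 1]"
    unfolding middle_exponents_eq[OF members_axioms] by (simp add: lab_deg_def)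
  ultimately show ?thesis
    unfolding eq using free_divisor_scale c(1) by metis
qed

text \<open>The difference of the total degrees is r (m+1) - r 0, the power of x_(n+1) in
  \<open>plo\<close>. With b nonzero the combination has the degree of the second generator, so
  homogenizing it agrees with combining the homogenizations.\<close>

lemma homogenize_combination_eq_pencil_member:
  fixes a b :: "'k::field_char_0"
  assumes "b \<noteq> 0"
  shows "homogenize (n+1) (Const a * f1_tilde n m r + Const b * f2_tilde n m r) =
    pencil_member (X (n+1) ^ (total_deg (f2_tilde n m r :: (nat, 'k) mpoly) - total_deg (f1_tilde n m r :: (nat, 'k) mpoly))
        * homogenize (n+1) (f1_tilde n m r)) (homogenize (n+1) (f2_tilde n m r)) (a, b)"
proof -
  have "r (m+1) \<le> sum r {0..n}" "r 0 \<le> r (m+1)"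
    using m_less_n r_mono by (auto intro: member_le_sum)
  then have deg: "sum r {0..n} - r 0 - (sum r {0..n} - r (m+1)) = r (m+1) - r 0" by simp
  have f2: "homogenize (n+1) (f2_tilde n m r) = phi * (glo :: (nat, 'k) mpoly)"
    using homogenize_combination[of "1::'k" 0] by (simp add: member_eq)
  show ?thesis
    unfolding homogenize_combination[OF assms] pencil_member_def total_deg_f1_tilde total_deg_f2_tilde deg
      homogenize_f1_tilde f2 member_eq plo_def by (simp add: mult.assoc add.commute)
qed

end

text \<open>A reduced polynomial is determined only up to a constant: the explicit formula is
  therefore claimed for one choice of g and freeness for all of them. The generic statement also
  records that the homogenized combinations really are members of the pencil.\<close>

theorem theorem6p24:
  fixes n m :: nat and r :: "nat \<Rightarrow> nat"
    and f1 f2 :: "(nat, 'k::field_char_0) mpoly"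
  assumes "n \<ge> 1" and "m \<le> n - 1"
    and "\<forall>i \<le> n. r i > 0"
    and "\<forall>i j. i \<le> j \<and> j \<le> n \<longrightarrow> r i \<le> r j"
    and "f1 = f1_tilde n m r" and "f2 = f2_tilde n m r"
  shows "total_deg f1 \<le> total_deg f2 \<and>
    ((\<exists>g. is_red (f1 * f2) g \<and> X (n+1) * homogenize (n+1) g = base_divisor n m r) \<and>
     (\<forall>g. is_red (f1 * f2) g \<longrightarrow>
        free_divisor n (X (n+1) * homogenize (n+1) g) ([1, 1] @ middle_exponents n m r))) \<and>
    (\<forall>k \<ge> 3. generically {3..k} (\<lambda>p.
       (\<forall>i \<in> {3..k}. fst (p i) \<noteq> 0 \<and> snd (p i) \<noteq> 0) \<and>
       (\<forall>i \<in> {3..k}. \<forall>j \<in> {3..k}. i \<noteq> j \<longrightarrow>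
          fst (p i) * snd (p j) \<noteq> fst (p j) * snd (p i)) \<and>
       (\<forall>i \<in> {3..k}.
          homogenize (n+1) (Const (fst (p i)) * f1 + Const (snd (p i)) * f2) =
          pencil_member (X (n+1) ^ (total_deg f2 - total_deg f1) * homogenize (n+1) f1)
            (homogenize (n+1) f2) (p i)) \<and>
       (\<forall>g. is_red (f1 * f2) g \<longrightarrow>
          free_divisor n
            (X (n+1) * homogenize (n+1) g *
             (\<Prod>i = 3..k. homogenize (n+1) (Const (fst (p i)) * f1 + Const (snd (p i)) * f2)))
            ([1] @ middle_exponents n m r @ [(k - 2) * (\<Sum>i = 1..n. r i) + 1]))))"
proof -
  interpret exponents n m r
    by unfold_locales (use assms(1-4) in auto)
  have le: "total_deg f1 \<le> total_deg f2"
    unfolding assms(5,6) total_deg_f1_tilde total_deg_f2_tilde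
    using r_mono[of 0 "m+1"] m_less_n by simp
  have ex: "is_red (f1 * f2) base_red \<and> X (n+1) * homogenize (n+1) (base_red :: (nat, 'k) mpoly) = base_divisor n m r"
    unfolding assms(5,6) using is_red_base_red base_divisor_eq by blast
  show ?thesis
  proof (intro conjI allI impI exI)
    show "total_deg f1 \<le> total_deg f2" by (rule le)
    show "is_red (f1 * f2) base_red" "X (n+1) * homogenize (n+1) (base_red :: (nat, 'k) mpoly) = base_divisor n m r"
      using ex by blast+
    show "free_divisor n (X (n+1) * homogenize (n+1) g) ([1, 1] @ middle_exponents n m r)"
      if "is_red (f1 * f2) g" for g
      using that unfolding assms(5,6) by (rule free_base)
  next
    fix k :: nat
    show "generically {3..k} (\<lambda>p.
       (\<forall>i \<in> {3..k}. fst (p i) \<noteq> 0 \<and> snd (p i) \<noteq> 0) \<and>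
       (\<forall>i \<in> {3..k}. \<forall>j \<in> {3..k}. i \<noteq> j \<longrightarrow>
          fst (p i) * snd (p j) \<noteq> fst (p j) * snd (p i)) \<and>
       (\<forall>i \<in> {3..k}.
          homogenize (n+1) (Const (fst (p i)) * f1 + Const (snd (p i)) * f2) =
          pencil_member (X (n+1) ^ (total_deg f2 - total_deg f1) * homogenize (n+1) f1)
            (homogenize (n+1) f2) (p i)) \<and>
       (\<forall>g. is_red (f1 * f2) g \<longrightarrow>
          free_divisor n
            (X (n+1) * homogenize (n+1) g *
             (\<Prod>i = 3..k. homogenize (n+1) (Const (fst (p i)) * f1 + Const (snd (p i)) * f2)))
            ([1] @ middle_exponents n m r @ [(k - 2) * (\<Sum>i = 1..n. r i) + 1])))"
    proof (rule generically_distinct)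
      fix p :: "nat \<Rightarrow> 'k \<times> 'k"
      assume nz: "\<And>i. i \<in> {3..k} \<Longrightarrow> fst (p i) \<noteq> 0 \<and> snd (p i) \<noteq> 0"
        and distinct: "\<And>i j. i \<in> {3..k} \<Longrightarrow> j \<in> {3..k} \<Longrightarrow> i \<noteq> j \<Longrightarrow>
          fst (p i) * snd (p j) \<noteq> fst (p j) * snd (p i)"
      show "(\<forall>i \<in> {3..k}. fst (p i) \<noteq> 0 \<and> snd (p i) \<noteq> 0) \<and>
       (\<forall>i \<in> {3..k}. \<forall>j \<in> {3..k}. i \<noteq> j \<longrightarrow>
          fst (p i) * snd (p j) \<noteq> fst (p j) * snd (p i)) \<and>
       (\<forall>i \<in> {3..k}.
          homogenize (n+1) (Const (fst (p i)) * f1 + Const (snd (p i)) * f2) =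
          pencil_member (X (n+1) ^ (total_deg f2 - total_deg f1) * homogenize (n+1) f1)
            (homogenize (n+1) f2) (p i)) \<and>
       (\<forall>g. is_red (f1 * f2) g \<longrightarrow>
          free_divisor n
            (X (n+1) * homogenize (n+1) g *
             (\<Prod>i = 3..k. homogenize (n+1) (Const (fst (p i)) * f1 + Const (snd (p i)) * f2)))
            ([1] @ middle_exponents n m r @ [(k - 2) * (\<Sum>i = 1..n. r i) + 1]))"
        unfolding assms(5,6)
      proof (intro conjI ballI allI impI)
        fix i assume "i \<in> {3..k}"
        then have "snd (p i) \<noteq> 0" using nz by blast
        from homogenize_combination_eq_pencil_member[OF this, of "fst (p i)"]
        show "homogenize (n+1) (Const (fst (p i)) * f1_tilde n m r + Const (snd (p i)) * f2_tilde n m r) =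
          pencil_member (X (n+1) ^ (total_deg (f2_tilde n m r :: (nat, 'k) mpoly) -
              total_deg (f1_tilde n m r :: (nat, 'k) mpoly)) * homogenize (n+1) (f1_tilde n m r))
            (homogenize (n+1) (f2_tilde n m r)) (p i)"
          by simp
      qed (use nz distinct in \<open>blast intro: free_members\<close>)+
    qed simp_all
  qed
qed

end
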